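(* Let $T$ be an arbitrary index set and let $X=\{X(t), t\in T\}$ be a max-i.d. process with $\operatorname{essinf} X(t)=0$ for all $t\in T$ which satisfies Condition S. Then there exists a minimal spectral representation of $X$ defined on $[0,1]$ (with its Borel $\sigma$-algebra) endowed with a $\sigma$-finite Borel measure.
   Context: Throughout, $\stackrel{d}{=}$ denotes equality of finite-dimensional distributions. A real-valued process $X=\{X(t),t\in T\}$ is max-infinitely divisible (max-i.d.) if for every $n\in\mathbb N$ there are i.i.d. processes $\{X_{i,n}(t),t\in T\}$, $i=1,\dots,n$, with $\{X(t),t\in T\}\stackrel{d}{=}\{\max_{1\le i\le n}X_{i,n}(t),t\in T\}$. Condition S: there is an at most countable set $T_0\subset T$ such that for every $t\in T$ there is a sequence $\{t_n\}_{n\in\mathbb N}\subset T_0$ with $X(t_n)\to X(t)$ in probability. For a $\sigma$-finite measure space $(\Omega,\mathcal B,\mu)$, $\mathcal L^\vee=\mathcal L^\vee(\Omega,\mathcal B,\mu)$ is the set of measurable $f:\Omega\to\mathbb R$ with $f\ge0$ $\mu$-a.e. and $\mu\{f>a\}<\infty$ for all $a>0$ (functions equal $\mu$-a.e. are identified). Let $\Pi_\mu=\{U_i,i\in J\}$ ($J$ at most countable) be a Poisson point process on $(\Omega,\mathcal B)$ with intensity $\mu$. For $f\in\mathcal L^\vee$ put $I(f)=\int_\Omega^\vee f\,d\Pi_\mu:=\sup_{i\in J}f(U_i)$, interpreted as $0$ if $\Pi_\mu$ is empty. A family $\{f_t,t\in T\}\subset\mathcal L^\vee(\Omega,\mathcal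 B,\mu)$ is a spectral representation of $X$ (defined on $(\Omega,\mathcal B,\mu)$) if $\{X(t),t\in T\}\stackrel{d}{=}\{I(f_t),t\in T\}$. It is minimal if (i) for every $B\in\mathcal B$ there is $A\in\sigma\{f_t,t\in T\}$ with $\mu(A\Delta B)=0$; and (ii) there is no $B\in\mathcal B$ with $\mu(B)>0$ such that for every $t\in T$, $f_t=0$ $\mu$-a.e. on $B$. *)

theory Defs
  imports "HOL-Probability.Probability"
begin

definition process :: "'i set \<Rightarrow> 'w measure \<Rightarrow> ('i \<Rightarrow> 'w \<Rightarrow> real) \<Rightarrow> bool" where
  "process T P X \<longleftrightarrow> prob_space P \<and> (\<forall>t\<in>T. X t \<in> borel_measurable P)"

definition fdd_eq ::
  "'i set \<Rightarrow> 'w measure \<Rightarrow> ('i \<Rightarrow> 'w \<Rightarrow> real) \<Rightarrow> 'v measure \<Rightarrow> ('i \<Rightarrow> 'v \<Rightarrow> real) \<Rightarrow> bool" where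
  "fdd_eq T P X Q Y \<longleftrightarrow> process T P X \<and> process T Q Y \<and>
     (\<forall>F. finite F \<and> F \<subseteq> T \<longrightarrow>
        distr P (PiM F (\<lambda>_. borel)) (\<lambda>\<omega>. \<lambda>t\<in>F. X t \<omega>)
      = distr Q (PiM F (\<lambda>_. borel)) (\<lambda>\<omega>. \<lambda>t\<in>F. Y t \<omega>))"

definition iid_processes ::
  "'i set \<Rightarrow> 'v measure \<Rightarrow> nat \<Rightarrow> (nat \<Rightarrow> 'i \<Rightarrow> 'v \<Rightarrow> real) \<Rightarrow> bool" where
  "iid_processes T Q n Y \<longleftrightarrow> (\<forall>i<n. process T Q (Y i)) \<and>
     prob_space.indep_vars Q (\<lambda>_. PiM T (\<lambda>_. borel)) (\<lambda>i \<omega>. \<lambda>t\<in>T. Y i t \<omega>) {..<n} \<and>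
     (\<forall>i<n. \<forall>j<n. fdd_eq T Q (Y i) Q (Y j))"

text \<open>HOL cannot quantify existentially over the type of the sample space. In the definition
  below the copies live on a type containing all their joint sample paths. This is no
  restriction: any sequence of processes can be transported to it by pushing the probability
  measure forward along the sample path map.\<close>

definition max_infinitely_divisible ::
  "'i set \<Rightarrow> 'w measure \<Rightarrow> ('i \<Rightarrow> 'w \<Rightarrow> real) \<Rightarrow> bool" where
  "max_infinitely_divisible T P X \<longleftrightarrow>
     (\<forall>n\<ge>1. \<exists>(Q :: (nat \<Rightarrow> 'i \<Rightarrow> real) measure) Y.
        prob_space Q \<and> iid_processes T Q n Y \<and>
        fdd_eq T P X Q (\<lambda>t \<omega>. Max ((\<lambda>i. Y i t \<omega>) ` {..<n})))"

definition converges_in_probability ::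
  "'w measure \<Rightarrow> (nat \<Rightarrow> 'w \<Rightarrow> real) \<Rightarrow> ('w \<Rightarrow> real) \<Rightarrow> bool" where
  "converges_in_probability P Z Z' \<longleftrightarrow>
     (\<forall>\<epsilon>>0. (\<lambda>n. measure P {\<omega> \<in> space P. \<bar>Z n \<omega> - Z' \<omega>\<bar> > \<epsilon>}) \<longlonglongrightarrow> 0)"

definition condition_S :: "'i set \<Rightarrow> 'w measure \<Rightarrow> ('i \<Rightarrow> 'w \<Rightarrow> real) \<Rightarrow> bool" where
  "condition_S T P X \<longleftrightarrow>
     (\<exists>T0. T0 \<subseteq> T \<and> countable T0 \<and>
       (\<forall>t\<in>T. \<exists>s :: nat \<Rightarrow> 'i. range s \<subseteq> T0 \<and>
          converges_in_probability P (\<lambda>n. X (s n)) (X t)))"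

text \<open>Dual to \<open>esssup\<close> of the library, which is the \<open>Limsup\<close> along the
  almost-everywhere filter.\<close>

definition essinf :: "'w measure \<Rightarrow> ('w \<Rightarrow> real) \<Rightarrow> ereal" where
  "essinf P Z = Liminf (ae_filter P) (\<lambda>\<omega>. ereal (Z \<omega>))"

definition L_vee :: "'a measure \<Rightarrow> ('a \<Rightarrow> real) set" where
  "L_vee M = {f \<in> borel_measurable M. (AE x in M. f x \<ge> 0) \<and>
                (\<forall>a>0. emeasure M {x \<in> space M. f x > a} < \<infinity>)}"

text \<open>A point process is given by random points \<open>U i \<omega>\<close>, \<open>i \<in> J \<omega>\<close>, with a random index set
  \<open>J \<omega> \<subseteq> \<nat>\<close>; points may coincide, as they do when the intensity has atoms.\<close>

definition point_count :: "('w \<Rightarrow> nat set) \<Rightarrow> (nat \<Rightarrow> 'w \<Rightarrow> 'a) \<Rightarrow> 'a set \<Rightarrow> 'w \<Rightarrow> ennreal" where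
  "point_count J U B \<omega> = emeasure (count_space UNIV) {i \<in> J \<omega>. U i \<omega> \<in> B}"

definition poisson_point_process ::
  "'a measure \<Rightarrow> 'w measure \<Rightarrow> ('w \<Rightarrow> nat set) \<Rightarrow> (nat \<Rightarrow> 'w \<Rightarrow> 'a) \<Rightarrow> bool" where
  "poisson_point_process M P J U \<longleftrightarrow>
     prob_space P \<and>
     (\<forall>\<omega>\<in>space P. \<forall>i\<in>J \<omega>. U i \<omega> \<in> space M) \<and>
     (\<forall>B\<in>sets M. point_count J U B \<in> borel_measurable P) \<and>
     (\<forall>B\<in>sets M. emeasure M B < \<infinity> \<longrightarrow>
        (\<forall>k::nat. measure P {\<omega> \<in> space P. point_count J U B \<omega> = of_nat k}
                  = measure M B ^ k / fact k * exp (- measure M B))) \<and>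
     (\<forall>B\<in>sets M. emeasure M B = \<infinity> \<longrightarrow> (AE \<omega> in P. point_count J U B \<omega> = \<infinity>)) \<and>
     (\<forall>(n::nat) A. (\<forall>i<n. A i \<in> sets M) \<and> disjoint_family_on A {..<n} \<longrightarrow>
        prob_space.indep_vars P (\<lambda>_. borel) (\<lambda>i. point_count J U (A i)) {..<n})"

text \<open>For \<open>f \<in> L_vee M\<close> and a Poisson process with intensity \<open>M\<close> the supremum is almost surely
  finite; on the exceptional null event the real \<open>Sup\<close> takes an unspecified fixed value.\<close>

definition sup_integral ::
  "('w \<Rightarrow> nat set) \<Rightarrow> (nat \<Rightarrow> 'w \<Rightarrow> 'a) \<Rightarrow> ('a \<Rightarrow> real) \<Rightarrow> 'w \<Rightarrow> real" where
  "sup_integral J U f \<omega> = (if J \<omega> = {} then 0 else (SUP i\<in>J \<omega>. f (U i \<omega>)))"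

text \<open>The Poisson process is taken on a type containing all enumerations of its points
  (\<open>None\<close> marking unused indices). As above this is no restriction; and the finite-dimensional
  distributions of the suprema depend only on \<open>M\<close>, not on the chosen Poisson process.\<close>

definition spectral_representation ::
  "'i set \<Rightarrow> 'w measure \<Rightarrow> ('i \<Rightarrow> 'w \<Rightarrow> real) \<Rightarrow> 'a measure \<Rightarrow> ('i \<Rightarrow> 'a \<Rightarrow> real) \<Rightarrow> bool" where
  "spectral_representation T P X M f \<longleftrightarrow>
     sigma_finite_measure M \<and> (\<forall>t\<in>T. f t \<in> L_vee M) \<and>
     (\<exists>(Q :: (nat \<Rightarrow> 'a option) measure) J U. poisson_point_process M Q J U \<and>
        fdd_eq T P X Q (\<lambda>t. sup_integral J U (f t)))"

definition generated_sets :: "'i set \<Rightarrow> 'a measure \<Rightarrow> ('i \<Rightarrow> 'a \<Rightarrow> real) \<Rightarrow> 'a set set" where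
  "generated_sets T M f =
     sigma_sets (space M) {f t -` S \<inter> space M | t S. t \<in> T \<and> S \<in> sets borel}"

definition minimal_spectral_representation ::
  "'i set \<Rightarrow> 'w measure \<Rightarrow> ('i \<Rightarrow> 'w \<Rightarrow> real) \<Rightarrow> 'a measure \<Rightarrow> ('i \<Rightarrow> 'a \<Rightarrow> real) \<Rightarrow> bool" where
  "minimal_spectral_representation T P X M f \<longleftrightarrow>
     spectral_representation T P X M f \<and>
     (\<forall>B\<in>sets M. \<exists>A\<in>generated_sets T M f. emeasure M (sym_diff A B) = 0) \<and>
     \<not> (\<exists>B\<in>sets M. emeasure M B > 0 \<and> (\<forall>t\<in>T. AE x in M. x \<in> B \<longrightarrow> f t x = 0))"

end

theory Submission
  imports Defs "HOL-Real_Asymp.Real_Asymp"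
begin

text \<open>
\<^bold>\<open>The exponent measure.\<close> If \<open>X\<close> is distributed as the maximum of \<open>n\<close> independent copies of a
process \<open>Y\<close> (depending on \<open>n\<close>), and \<open>p\<close> is the probability that \<open>X\<close> stays below finitely many given levels, then \<open>Y\<close>
stays below them with probability \<open>p\<^sup>1\<^sup>/\<^sup>n\<close>, and \<open>n (1 - p\<^sup>1\<^sup>/\<^sup>n)\<close> tends to \<open>- ln p\<close>. Hence \<open>n\<close> times the
law of \<open>Y\<close>, away from the zero path, converges to a measure that gives mass \<open>- ln p\<close> to the paths
which exceed one of the levels. To take this limit, only countably many comparisons
\<open>X (s i) > q i\<close> are recorded, where \<open>s i\<close> runs through the countable set \<open>T0\<close> of Condition S.
This replaces a path by a point of the compact space
\<open>nat \<Rightarrow> bool\<close>, in which convergence on cylinder sets is inclusion-exclusion, and countable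
additivity of the limit on the ring of cylinder sets that force an exceedance is automatic by
compactness. A base 4 expansion carries the result to \<open>[0, 1]\<close>: there are a measure \<open>\<mu>\<close> and sets \<open>A i\<close>,
generating the Borel sets up to null sets, such that the probability that no \<open>C i = {X (s i) > q i}\<close>,
\<open>i \<in> Z\<close>, occurs is \<open>exp (- \<mu> (\<Union>i\<in>Z. A i))\<close> (\<open>exponent_measure_unit_interval\<close>).

\<^bold>\<open>The spectral functions.\<close> This formula expresses \<open>\<mu>\<close> of a symmetric difference of two sets \<open>A i\<close>
through probabilities, so a sequence of events \<open>C i\<close> that converges in probability gives a Cauchy
sequence of sets \<open>A i\<close>, which has a limit in \<open>\<mu>\<close> (\<open>matches_exists\<close>), and the formula persists for
such limits (\<open>matches_hit\<close>). By Condition S each event \<open>{X t > a}\<close>, where \<open>a > 0\<close> is not an atom of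
\<open>X t\<close>, is such a limit (\<open>exceedance_approximable\<close>). The sets matched with \<open>{X t > a}\<close> decrease in \<open>a\<close> and
are the level sets of a function \<open>f t\<close> (\<open>layer_cake\<close>). Minimality is visible from the construction:
up to null sets, \<open>A i\<close> is the level set \<open>{f (s i) > q i}\<close> with \<open>q i > 0\<close>, and the \<open>A i\<close> cover the space.

\<^bold>\<open>The Poisson process.\<close> The supremum of \<open>f\<close> over a Poisson process of intensity \<open>\<mu>\<close> is at most \<open>a\<close> iff
there is no point in \<open>{f > a}\<close>, and no point lies in \<open>B\<close> with probability \<open>exp (- \<mu> B)\<close>. So the joint
distribution functions of the suprema of the \<open>f t\<close> are those of \<open>X\<close> (\<open>fdd_eq_sup_integral\<close>). A Poisson
process is obtained by throwing a Poisson number of independent points into each piece of a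
partition into sets of finite measure (\<open>exists_poisson_point_process\<close>). Its counts on disjoint sets are
identified jointly by their generating function, which is insensitive to whether they are finite.
\<close>

section \<open>Exceedance patterns and their cylinder sets\<close>

abbreviation bool_seq :: "(nat \<Rightarrow> bool) measure" where
  "bool_seq \<equiv> PiM UNIV (\<lambda>_. count_space UNIV)"

lemma measurable_bool_seqI:
  assumes "\<And>i. {\<omega> \<in> space N. h \<omega> i} \<in> sets N"
  shows "h \<in> measurable N bool_seq"
proof (rule measurable_PiM_single)
  fix b :: "bool set" and i :: nat
  let ?H = "{\<omega> \<in> space N. h \<omega> i}"
  have "{\<omega> \<in> space N. h \<omega> i \<in> b}
    = (if True \<in> b then ?H else {}) \<union> (if False \<in> b then space N - ?H else {})"
  proof (intro set_eqI)
    fix \<omega>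
    show "\<omega> \<in> {\<omega> \<in> space N. h \<omega> i \<in> b} \<longleftrightarrow>
      \<omega> \<in> (if True \<in> b then ?H else {}) \<union> (if False \<in> b then space N - ?H else {})"
      by (cases "h \<omega> i") auto
  qed
  then show "{\<omega> \<in> space N. h \<omega> i \<in> b} \<in> sets N" using assms[of i] by simp
qed auto

definition depends_upto :: "nat \<Rightarrow> (nat \<Rightarrow> bool) set \<Rightarrow> bool" where
  "depends_upto N C \<longleftrightarrow> (\<forall>x y. (\<forall>i<N. x i = y i) \<longrightarrow> (x \<in> C \<longleftrightarrow> y \<in> C))"

text \<open>The limit measure may be infinite near the zero sequence, so only cylinders that force a
  one among the coordinates they depend on are measured; on these it is finite.\<close>

definition hit_cylinders :: "(nat \<Rightarrow> bool) set set" where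
  "hit_cylinders = {C. \<exists>N. depends_upto N C \<and> C \<subseteq> {x. \<exists>i<N. x i}}"

lemma depends_upto_mono: "depends_upto N C \<Longrightarrow> N \<le> N' \<Longrightarrow> depends_upto N' C"
  by (simp add: depends_upto_def)

lemma depends_uptoD:
  "depends_upto N C \<Longrightarrow> (\<And>i. i < N \<Longrightarrow> x i = y i) \<Longrightarrow> x \<in> C \<Longrightarrow> y \<in> C"
  unfolding depends_upto_def by blast

lemma ring_hit_cylinders: "ring_of_sets {x. \<exists>i. x i} hit_cylinders"
proof (rule ring_of_setsI)
  show "hit_cylinders \<subseteq> Pow {x. \<exists>i. x i}"
    by (auto simp: hit_cylinders_def)
  show "{} \<in> hit_cylinders"
    by (auto simp: hit_cylinders_def depends_upto_def)
  fix C D assume "C \<in> hit_cylinders" "D \<in> hit_cylinders"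
  then obtain N M where N: "depends_upto N C" "C \<subseteq> {x. \<exists>i<N. x i}"
    and M: "depends_upto M D" "D \<subseteq> {x. \<exists>i<M. x i}"
    by (auto simp: hit_cylinders_def)
  let ?K = "max N M"
  have K: "depends_upto ?K C" "depends_upto ?K D"
    using depends_upto_mono[OF N(1), of ?K] depends_upto_mono[OF M(1), of ?K] by auto
  have D: "x \<in> C \<longleftrightarrow> y \<in> C" "x \<in> D \<longleftrightarrow> y \<in> D" if "\<forall>i<?K. x i = y i" for x y
    using K that unfolding depends_upto_def by blast+
  have "depends_upto ?K (C \<union> D)" "depends_upto ?K (C - D)"
    unfolding depends_upto_def using D by auto
  moreover have "C \<union> D \<subseteq> {x. \<exists>i<?K. x i}" "C - D \<subseteq> {x. \<exists>i<?K. x i}"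
    using N(2) M(2) by (auto simp: less_max_iff_disj)
  ultimately show "C \<union> D \<in> hit_cylinders" "C - D \<in> hit_cylinders"
    unfolding hit_cylinders_def by blast+
qed

lemma open_bool_singleton: "open {b :: bool}"
proof -
  have "{True} = {False<..}" "{False} = {..<True}" by auto
  then show ?thesis by (cases b) (simp_all only: open_greaterThan open_lessThan)
qed

lemma open_depends_upto:
  assumes "depends_upto N C" shows "open C"
proof -
  have "open {y :: nat \<Rightarrow> bool. y i = b}" for i b
  proof -
    have "open ((\<lambda>y :: nat \<Rightarrow> bool. y i) -` {b})"
      by (rule open_vimage) (auto intro: open_bool_singleton continuous_on_product_coordinates)
    then show ?thesis by (simp add: vimage_def)
  qed
  then have "open (\<Inter>i\<in>{..<N}. {y. y i = x i})" for x :: "nat \<Rightarrow> bool"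
    by (intro open_INT) auto
  moreover have "C = (\<Union>x\<in>C. \<Inter>i\<in>{..<N}. {y. y i = x i})"
  proof (intro equalityI subsetI)
    fix y assume "y \<in> (\<Union>x\<in>C. \<Inter>i\<in>{..<N}. {y. y i = x i})"
    then obtain x where "x \<in> C" "\<forall>i<N. y i = x i" by auto
    with assms show "y \<in> C" unfolding depends_upto_def by blast
  qed auto
  ultimately show ?thesis
    by (metis (no_types, lifting) open_UN)
qed

lemma compact_bool_seq: "compact (UNIV :: (nat \<Rightarrow> bool) set)"
proof -
  have "compact_space (euclidean :: bool topology)"
    by (simp add: compact_space_def finite_imp_compact)
  then have "compact_space (product_topology (\<lambda>_::nat. euclidean :: bool topology) UNIV)"
    by (simp add: compact_space_product_topology)
  then show ?thesis
    by (simp add: compact_space_def euclidean_product_topology)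
qed

text \<open>Countable additivity on the ring reduces to finite additivity: a cylinder is compact, and the
  disjoint cylinders that cover it are open.\<close>

lemma hit_cylinder_disjoint_Union_finite:
  assumes A: "range A \<subseteq> hit_cylinders" "(\<Union>i. A i) \<in> hit_cylinders"
    and disj: "disjoint_family (A :: nat \<Rightarrow> _)"
  shows "\<exists>n. \<forall>i\<ge>n. A i = {}"
proof -
  have op: "open (A i)" for i
  proof -
    have "A i \<in> hit_cylinders" using A(1) by auto
    then show ?thesis using open_depends_upto by (auto simp: hit_cylinders_def)
  qed
  obtain N where "depends_upto N (\<Union>i. A i)" using A by (auto simp: hit_cylinders_def)
  then have "depends_upto N (- (\<Union>i. A i))" unfolding depends_upto_def Compl_iff by blast
  then have "closed (\<Union>i. A i)" using open_depends_upto closed_def by blast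
  then have "compact (\<Union>i. A i)"
    using compact_bool_seq compact_Int_closed by fastforce
  then obtain F where F: "finite F" "(\<Union>i. A i) \<subseteq> (\<Union>i\<in>F. A i)"
    using compactE_image[of "\<Union>i. A i" UNIV A] op by auto
  obtain n where n: "F \<subseteq> {..<n}" using F(1) finite_nat_iff_bounded by blast
  have "A i = {}" if "i \<ge> n" for i
  proof (rule ccontr)
    assume "A i \<noteq> {}"
    then obtain x where x: "x \<in> A i" by auto
    then obtain j where "j \<in> F" "x \<in> A j" using F by blast
    moreover have "j \<noteq> i" using n that \<open>j \<in> F\<close> by auto
    ultimately show False using x disj by (auto simp: disjoint_family_on_def)
  qed
  then show ?thesis by blast
qed

abbreviation pattern :: "nat set \<Rightarrow> nat set \<Rightarrow> (nat \<Rightarrow> bool) set" where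
  "pattern S Z \<equiv> {x. (\<forall>i\<in>S. x i) \<and> (\<forall>i\<in>Z. \<not> x i)}"

lemma pattern_in_sets [measurable]:
  assumes "countable S" "countable Z"
  shows "pattern S Z \<in> sets bool_seq"
proof -
  have "{x \<in> space bool_seq. (\<forall>i\<in>S. x i) \<and> (\<forall>i\<in>Z. \<not> x i)} \<in> sets bool_seq"
    using assms by measurable
  then show ?thesis by (simp add: space_PiM)
qed

lemma coordinate_in_sets [measurable]: "{x :: nat \<Rightarrow> bool. x i} \<in> sets bool_seq"
  using pattern_in_sets[of "{i}" "{}"] by simp

text \<open>A pattern fixes the first \<open>N\<close> coordinates, \<open>S\<close> being the set of ones. The probabilities of patterns
  are accessible by inclusion-exclusion, and \<open>S\<close> is nonempty for a cylinder in the ring.\<close>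

lemma hit_cylinder_patterns:
  assumes "C \<in> hit_cylinders"
  obtains \<S> N where "finite \<S>" "\<And>S. S \<in> \<S> \<Longrightarrow> S \<noteq> {} \<and> S \<subseteq> {..<N}"
    "C = (\<Union>S\<in>\<S>. pattern S ({..<N} - S))"
    "disjoint_family_on (\<lambda>S. pattern S ({..<N} - S)) \<S>"
proof -
  obtain N where N: "depends_upto N C" "C \<subseteq> {x. \<exists>i<N. x i}"
    using assms by (auto simp: hit_cylinders_def)
  define \<S> where "\<S> = {S. S \<subseteq> {..<N} \<and> (\<lambda>i. i \<in> S) \<in> C}"
  let ?P = "\<lambda>S. pattern S ({..<N} - S)"
  have "finite \<S>" by (rule finite_subset[of _ "Pow {..<N}"]) (auto simp: \<S>_def)
  moreover have "S \<noteq> {} \<and> S \<subseteq> {..<N}" if "S \<in> \<S>" for S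
    using that N by (auto simp: \<S>_def)
  moreover have "C = (\<Union>S\<in>\<S>. ?P S)"
  proof (intro equalityI subsetI)
    fix x assume x: "x \<in> C"
    let ?S = "{i. i < N \<and> x i}"
    have "(\<lambda>i. i \<in> ?S) \<in> C" by (rule depends_uptoD[OF N(1) _ x]) simp
    then have "?S \<in> \<S>" by (auto simp: \<S>_def)
    then show "x \<in> (\<Union>S\<in>\<S>. ?P S)" by (rule UN_I) auto
  next
    fix x assume "x \<in> (\<Union>S\<in>\<S>. ?P S)"
    then obtain S where S: "S \<in> \<S>" "x \<in> ?P S" by auto
    then have "\<forall>i<N. (i \<in> S) = x i" by auto
    then show "x \<in> C"
      using depends_uptoD[OF N(1), of "\<lambda>i. i \<in> S" x] S(1) by (simp add: \<S>_def)
  qed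
  moreover have "disjoint_family_on ?P \<S>"
    unfolding disjoint_family_on_def
  proof (intro ballI impI)
    fix S S' assume "S \<in> \<S>" "S' \<in> \<S>" "S \<noteq> S'"
    then obtain i where i: "i < N" "i \<in> S \<longleftrightarrow> i \<notin> S'"
      unfolding \<S>_def by (metis (mono_tags, lifting) lessThan_iff mem_Collect_eq subsetD subsetI subset_antisym)
    show "?P S \<inter> ?P S' = {}"
    proof (intro equals0I)
      fix x assume "x \<in> ?P S \<inter> ?P S'"
      then show False using i by (cases "x i") auto
    qed
  qed
  ultimately show thesis using that by blast
qed

lemma hit_cylinder_in_sets: "C \<in> hit_cylinders \<Longrightarrow> C \<in> sets bool_seq"
  by (erule hit_cylinder_patterns)
     (auto intro!: sets.finite_UN pattern_in_sets countable_finite intro: finite_subset)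

section \<open>The exponent measure as a limit of scaled root laws\<close>

lemma root_limit_ln:
  assumes "0 < p" and a: "\<And>n. 0 \<le> a n" "\<And>n. a n ^ Suc n = p"
  shows "(\<lambda>n. real (Suc n) * (1 - a n)) \<longlonglongrightarrow> - ln p"
proof -
  have "a n = exp (ln p / real (Suc n))" for n
  proof -
    have "a n > 0" using a[of n] \<open>0 < p\<close> by (cases "a n = 0") (auto simp: less_le)
    moreover have "ln p = real (Suc n) * ln (a n)"
      using a(2)[of n] \<open>a n > 0\<close> ln_realpow[of "a n" "Suc n"] by simp
    ultimately show ?thesis by simp
  qed
  moreover have "(\<lambda>n. real (Suc n) * (1 - exp (c / real (Suc n)))) \<longlonglongrightarrow> - c" for c :: real
    by real_asymp
  ultimately show ?thesis by simp
qed

text \<open>\<open>R n\<close> plays the law of the exceedance pattern of the \<open>(n + 1)\<close>-st root of a process; \<open>p Z\<close> is the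
  probability that the process itself exceeds none of the levels in \<open>Z\<close>.\<close>

locale max_roots =
  fixes R :: "nat \<Rightarrow> (nat \<Rightarrow> bool) measure" and p :: "nat set \<Rightarrow> real"
  assumes prob_R: "\<And>n. prob_space (R n)"
    and sets_R [measurable_cong]: "\<And>n. sets (R n) = sets bool_seq"
    and void_R: "\<And>n Z. finite Z \<Longrightarrow> measure (R n) {x. \<forall>i\<in>Z. \<not> x i} ^ Suc n = p Z"
    and p_pos: "\<And>Z. finite Z \<Longrightarrow> 0 < p Z"
begin

definition intensity :: "(nat \<Rightarrow> bool) set \<Rightarrow> real" where
  "intensity C = lim (\<lambda>n. real (Suc n) * measure (R n) C)"

text \<open>Inclusion-exclusion, one required one at a time: a pattern in which coordinate \<open>j\<close> is one is
  the difference of the patterns where \<open>j\<close> is free and where \<open>j\<close> is zero. With a single one left, both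
  terms are void probabilities \<open>p\<^sup>1\<^sup>/\<^sup>n\<close>, and the scaled difference of two of them converges.\<close>

lemma convergent_pattern:
  assumes "finite S" "S \<noteq> {}" "finite Z"
  shows "convergent (\<lambda>n. real (Suc n) * measure (R n) (pattern S Z))"
  using assms
proof (induction S arbitrary: Z rule: finite_ne_induct)
  case (singleton j)
  have eq: "real (Suc n) * measure (R n) (pattern {j} Z)
    = real (Suc n) * (1 - measure (R n) {x. \<forall>i\<in>insert j Z. \<not> x i})
      - real (Suc n) * (1 - measure (R n) {x. \<forall>i\<in>Z. \<not> x i})" for n
  proof -
    interpret prob_space "R n" by (rule prob_R)
    have "pattern {j} Z
        = {x. \<forall>i\<in>Z. \<not> x i} - {x. \<forall>i\<in>insert j Z. \<not> x i}" by auto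
    moreover have "{x. \<forall>i\<in>insert j Z. \<not> x i} \<subseteq> {x. \<forall>i\<in>Z. \<not> x i}" by auto
    ultimately have "measure (R n) (pattern {j} Z)
        = measure (R n) {x. \<forall>i\<in>Z. \<not> x i} - measure (R n) {x. \<forall>i\<in>insert j Z. \<not> x i}"
      using singleton pattern_in_sets[of "{}" Z] pattern_in_sets[of "{}" "insert j Z"]
      by (simp add: finite_measure_Diff sets_R countable_finite)
    then show ?thesis by (simp only:) (simp only: right_diff_distrib)
  qed
  have lim: "(\<lambda>n. real (Suc n) * (1 - measure (R n) {x. \<forall>i\<in>Z. \<not> x i})) \<longlonglongrightarrow> - ln (p Z)"
    if "finite Z" for Z
    by (rule root_limit_ln) (use that in \<open>auto intro: p_pos void_R simp del: power_Suc\<close>)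
  show ?case unfolding eq
    by (rule convergentI, rule tendsto_diff[OF lim lim]) (use singleton in auto)
next
  case (insert j S)
  have "measure (R n) (pattern (insert j S) Z)
    = measure (R n) (pattern S Z)
      - measure (R n) (pattern S (insert j Z))" for n
  proof -
    interpret prob_space "R n" by (rule prob_R)
    have "pattern (insert j S) Z
      = pattern S Z - pattern S (insert j Z)"
      by auto
    moreover have "pattern S (insert j Z)
      \<subseteq> pattern S Z" by auto
    ultimately show ?thesis
      using insert.hyps insert.prems pattern_in_sets[of S Z] pattern_in_sets[of S "insert j Z"]
      by (simp add: finite_measure_Diff sets_R countable_finite)
  qed
  then show ?case
    using insert.IH[of Z] insert.IH[of "insert j Z"] insert.prems
    by (simp only: right_diff_distrib) (intro convergent_diff, auto)
qed

lemma intensity_tendsto: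
  assumes "C \<in> hit_cylinders"
  shows "(\<lambda>n. real (Suc n) * measure (R n) C) \<longlonglongrightarrow> intensity C"
proof -
  obtain \<S> N where \<S>: "finite \<S>" "\<And>S. S \<in> \<S> \<Longrightarrow> S \<noteq> {} \<and> S \<subseteq> {..<N}"
    "C = (\<Union>S\<in>\<S>. pattern S ({..<N} - S))"
    "disjoint_family_on (\<lambda>S. pattern S ({..<N} - S)) \<S>"
    using hit_cylinder_patterns[OF assms] by blast
  let ?P = "\<lambda>S. pattern S ({..<N} - S)"
  have "real (Suc n) * measure (R n) C = (\<Sum>S\<in>\<S>. real (Suc n) * measure (R n) (?P S))" for n
  proof -
    interpret prob_space "R n" by (rule prob_R)
    have "?P ` \<S> \<subseteq> sets (R n)"
      using \<S>(2) by (auto simp: sets_R intro!: pattern_in_sets countable_finite intro: finite_subset)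
    then show ?thesis unfolding \<S>(3)
      by (subst finite_measure_finite_Union) (use \<S> in \<open>auto simp: sum_distrib_left\<close>)
  qed
  moreover have "convergent (\<lambda>n. \<Sum>S\<in>\<S>. real (Suc n) * measure (R n) (?P S))"
    by (intro convergent_sum convergent_pattern)
       (use \<S>(2) in \<open>auto intro: finite_subset\<close>)
  ultimately have "convergent (\<lambda>n. real (Suc n) * measure (R n) C)" by simp
  then show ?thesis unfolding intensity_def by (simp add: convergent_LIMSEQ_iff)
qed

lemma intensity_nonneg: "C \<in> hit_cylinders \<Longrightarrow> 0 \<le> intensity C"
  by (rule LIMSEQ_le_const[OF intensity_tendsto]) auto

lemma intensity_Un:
  assumes "C \<in> hit_cylinders" "D \<in> hit_cylinders" "C \<inter> D = {}"
  shows "intensity (C \<union> D) = intensity C + intensity D"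
proof -
  interpret H: ring_of_sets "{x. \<exists>i. x i}" hit_cylinders by (rule ring_hit_cylinders)
  have "(\<lambda>n. real (Suc n) * measure (R n) (C \<union> D)) \<longlonglongrightarrow> intensity C + intensity D"
  proof -
    have "real (Suc n) * measure (R n) (C \<union> D)
      = real (Suc n) * measure (R n) C + real (Suc n) * measure (R n) D" for n
    proof -
      interpret prob_space "R n" by (rule prob_R)
      show ?thesis using assms
        by (subst finite_measure_Union) (auto simp: sets_R hit_cylinder_in_sets algebra_simps)
    qed
    then show ?thesis
      using tendsto_add[OF intensity_tendsto[OF assms(1)] intensity_tendsto[OF assms(2)]] by simp
  qed
  with intensity_tendsto[of "C \<union> D"] assms show ?thesis
    using LIMSEQ_unique by blast
qed

lemma hitting_in_hit_cylinders:
  assumes "finite Z" shows "{x. \<exists>i\<in>Z. x i} \<in> hit_cylinders"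
proof -
  obtain N where "Z \<subseteq> {..<N}" using assms finite_nat_iff_bounded by blast
  then have "depends_upto N {x. \<exists>i\<in>Z. x i}" "{x. \<exists>i\<in>Z. x i} \<subseteq> {x. \<exists>i<N. x i}"
    unfolding depends_upto_def by (auto simp: subset_eq)
  then show ?thesis unfolding hit_cylinders_def by blast
qed

lemma intensity_hitting:
  assumes "finite Z" shows "intensity {x. \<exists>i\<in>Z. x i} = - ln (p Z)"
proof -
  have "(\<lambda>n. real (Suc n) * measure (R n) {x. \<exists>i\<in>Z. x i}) \<longlonglongrightarrow> - ln (p Z)"
  proof -
    have "measure (R n) {x. \<exists>i\<in>Z. x i} = 1 - measure (R n) {x. \<forall>i\<in>Z. \<not> x i}" for n
    proof -
      interpret prob_space "R n" by (rule prob_R)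
      have "space (R n) = UNIV"
        using sets_eq_imp_space_eq[OF sets_R[of n]] by (simp add: space_PiM)
      then have "{x. \<exists>i\<in>Z. x i} = space (R n) - {x. \<forall>i\<in>Z. \<not> x i}" by auto
      then show ?thesis
        using pattern_in_sets[of "{}" Z] assms by (simp add: prob_compl sets_R countable_finite)
    qed
    moreover have "(\<lambda>n. real (Suc n) * (1 - measure (R n) {x. \<forall>i\<in>Z. \<not> x i})) \<longlonglongrightarrow> - ln (p Z)"
      by (rule root_limit_ln) (use assms in \<open>auto intro: p_pos void_R simp del: power_Suc\<close>)
    ultimately show ?thesis by simp
  qed
  then show ?thesis
    using intensity_tendsto[OF hitting_in_hit_cylinders[OF assms]] LIMSEQ_unique by blast
qed

lemma intensity_countably_additive:
  "countably_additive hit_cylinders (\<lambda>C. ennreal (intensity C))"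
  unfolding countably_additive_def
proof (intro allI impI)
  interpret H: ring_of_sets "{x. \<exists>i. x i}" hit_cylinders by (rule ring_hit_cylinders)
  fix A :: "nat \<Rightarrow> (nat \<Rightarrow> bool) set"
  assume A: "range A \<subseteq> hit_cylinders" "disjoint_family A" "\<Union> (range A) \<in> hit_cylinders"
  obtain n where n: "\<And>i. i \<ge> n \<Longrightarrow> A i = {}"
    using hit_cylinder_disjoint_Union_finite[OF A(1,3,2)] by blast
  have z: "intensity {} = 0" by (simp add: intensity_def)
  have un: "(\<Union>i<m. A i) \<in> hit_cylinders" for m using A by (intro H.finite_UN) auto
  have fin: "intensity (\<Union>i<m. A i) = (\<Sum>i<m. intensity (A i))" for m
  proof (induction m)
    case (Suc m)
    have d: "(\<Union>i<m. A i) \<inter> A m = {}"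
    proof (intro equals0I)
      fix x assume "x \<in> (\<Union>i<m. A i) \<inter> A m"
      then obtain i where "i < m" "x \<in> A i \<inter> A m" by auto
      then show False using A(2) by (auto dest!: disjoint_family_onD[of A UNIV i m])
    qed
    have "A m \<in> hit_cylinders" using A(1) by blast
    then have "intensity ((\<Union>i<m. A i) \<union> A m) = (\<Sum>i<m. intensity (A i)) + intensity (A m)"
      using Suc intensity_Un[OF un[of m] _ d] by simp
    moreover have "(\<Union>i<Suc m. A i) = (\<Union>i<m. A i) \<union> A m" by (auto simp: lessThan_Suc)
    ultimately show ?case by simp
  qed (simp add: z)
  have U: "(\<Union>i<n. A i) = \<Union> (range A)"
    using n by (auto simp: not_less[symmetric])
  have "(\<Sum>i. ennreal (intensity (A i))) = (\<Sum>i<n. ennreal (intensity (A i)))"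
    by (rule suminf_finite) (use n z in auto)
  also have "\<dots> = ennreal (\<Sum>i<n. intensity (A i))"
    using A by (intro sum_ennreal) (auto intro: intensity_nonneg)
  also have "\<dots> = ennreal (intensity (\<Union> (range A)))"
    by (simp only: fin[symmetric] U)
  finally show "(\<Sum>i. ennreal (intensity (A i))) = ennreal (intensity (\<Union> (range A)))" .
qed

text \<open>The ring lives on the nonzero sequences; the extended measure is pushed forward along the
  inclusion to make it a measure on the full product space that does not charge zero.\<close>

lemma exponent_measure_bool_seq:
  "\<exists>M :: (nat \<Rightarrow> bool) measure. sets M = sets bool_seq \<and>
     (\<forall>Z. finite Z \<longrightarrow> emeasure M {x. \<exists>i\<in>Z. x i} = ennreal (- ln (p Z))) \<and>
     emeasure M {x. \<forall>i. \<not> x i} = 0"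
proof -
  let ?O = "{x :: nat \<Rightarrow> bool. \<exists>i. x i}"
  interpret H: ring_of_sets ?O hit_cylinders by (rule ring_hit_cylinders)
  have "positive hit_cylinders (\<lambda>C. ennreal (intensity C))"
    by (simp add: positive_def intensity_def)
  then obtain m :: "(nat \<Rightarrow> bool) set \<Rightarrow> ennreal"
    where m: "\<And>C. C \<in> hit_cylinders \<Longrightarrow> m C = ennreal (intensity C)"
      and ms: "measure_space ?O (sigma_sets ?O hit_cylinders) m"
    using H.caratheodory'[OF _ intensity_countably_additive] by auto
  define N where "N = measure_of ?O (sigma_sets ?O hit_cylinders) m"
  have sig: "sigma_algebra ?O (sigma_sets ?O hit_cylinders)"
    by (rule sigma_algebra_sigma_sets[OF H.space_closed])
  have N: "space N = ?O" "sets N = sigma_sets ?O hit_cylinders"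
    unfolding N_def using sigma_algebra.sets_measure_of_eq[OF sig]
    by (simp_all add: sigma_algebra.space_measure_of_eq[OF sig])
  have eN: "emeasure N C = m C" if "C \<in> sets N" for C
    using that ms emeasure_measure_of_sigma[OF sig, of m C] unfolding N
    by (simp add: N_def measure_space_def)
  have meas: "(\<lambda>x. x) \<in> measurable N bool_seq"
  proof (rule measurable_bool_seqI)
    fix i
    have "{x \<in> space N. x i} = {x. \<exists>j\<in>{i}. x j}" using N(1) by auto
    then show "{x \<in> space N. x i} \<in> sets N"
      using hitting_in_hit_cylinders[of "{i}"] N(2) by simp
  qed
  let ?M = "distr N bool_seq (\<lambda>x. x)"
  have "emeasure ?M {x. \<exists>i\<in>Z. x i} = ennreal (- ln (p Z))" if "finite Z" for Z
  proof -
    have h: "{x. \<exists>i\<in>Z. x i} \<in> hit_cylinders" by (rule hitting_in_hit_cylinders[OF that])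
    have "(\<lambda>x. x) -` {x. \<exists>i\<in>Z. x i} \<inter> space N = {x. \<exists>i\<in>Z. x i}" using N by auto
    then show ?thesis
      using h meas hit_cylinder_in_sets[OF h] eN[of "{x. \<exists>i\<in>Z. x i}"] N m[OF h] that
      by (simp add: emeasure_distr intensity_hitting)
  qed
  moreover have "emeasure ?M {x. \<forall>i. \<not> x i} = 0"
  proof -
    have "(\<lambda>x. x) -` {x. \<forall>i. \<not> x i} \<inter> space N = {}" using N by auto
    then show ?thesis
      using meas pattern_in_sets[of "{}" UNIV] by (simp add: emeasure_distr)
  qed
  ultimately show ?thesis by (intro exI[of _ ?M]) auto
qed

end

section \<open>Transfer to the unit interval\<close>

text \<open>Base 4 instead of base 2: the tail of the series is at most one third of the last unit, so the
  digits can be read off by rounding, for every sequence.\<close>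

definition binary_code :: "(nat \<Rightarrow> bool) \<Rightarrow> real" where
  "binary_code x = (\<Sum>i. of_bool (x i) / 4 ^ Suc i)"

definition binary_digit :: "nat \<Rightarrow> real \<Rightarrow> bool" where
  "binary_digit i u \<longleftrightarrow> odd \<lfloor>4 ^ Suc i * u\<rfloor>"

lemma quarter_sums: "(\<lambda>i. 1 / 4 ^ Suc i :: real) sums (1 / 3)"
proof -
  have "(\<lambda>i. (1 / 4) * (1 / 4) ^ i :: real) sums ((1 / 4) * (1 / (1 - 1 / 4)))"
    by (intro sums_mult geometric_sums) simp
  then show ?thesis by (simp add: power_divide)
qed

lemma summable_binary_code: "summable (\<lambda>i. of_bool (x i) / 4 ^ Suc i :: real)"
  by (rule summable_comparison_test'[OF sums_summable[OF quarter_sums], of 0]) auto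

lemma binary_code_bounds: "0 \<le> binary_code x" "binary_code x \<le> 1 / 3"
proof -
  show "0 \<le> binary_code x"
    unfolding binary_code_def by (rule suminf_nonneg[OF summable_binary_code]) simp
  show "binary_code x \<le> 1 / 3"
    unfolding binary_code_def sums_unique[OF quarter_sums]
    by (rule suminf_le[OF _ summable_binary_code sums_summable[OF quarter_sums]])
       (simp add: divide_right_mono)
qed

lemma binary_code_unit_interval: "binary_code x \<in> {0..1}"
  using binary_code_bounds[of x] by simp

lemma binary_digit_code: "binary_digit i (binary_code x) = x i"
proof -
  let ?a = "\<lambda>j. of_bool (x j) / 4 ^ Suc j :: real"
  have "binary_code x = (\<Sum>j. ?a (j + Suc i)) + (\<Sum>j<Suc i. ?a j)"
    unfolding binary_code_def by (rule suminf_split_initial_segment[OF summable_binary_code])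
  also have "(\<Sum>j. ?a (j + Suc i)) = binary_code (\<lambda>j. x (j + Suc i)) / 4 ^ Suc i"
    unfolding binary_code_def
    by (subst suminf_divide[OF summable_binary_code, symmetric]) (simp add: power_add field_simps)
  finally have "4 ^ Suc i * binary_code x
    = binary_code (\<lambda>j. x (j + Suc i)) + (\<Sum>j<Suc i. 4 ^ Suc i * ?a j)"
    by (simp add: distrib_left sum_distrib_left del: power_Suc)
  also have "(\<Sum>j<Suc i. 4 ^ Suc i * ?a j) = (\<Sum>j<Suc i. of_bool (x j) * 4 ^ (i - j))"
  proof (intro sum.cong refl)
    fix j assume "j \<in> {..<Suc i}"
    then have "4 ^ Suc i = (4 ^ Suc j * 4 ^ (i - j) :: real)"
      by (simp add: power_add[symmetric] flip: power_Suc)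
    then show "4 ^ Suc i * ?a j = of_bool (x j) * 4 ^ (i - j)" by simp
  qed
  also have "\<dots> = of_int (\<Sum>j<Suc i. of_bool (x j) * 4 ^ (i - j))" by simp
  finally have "\<lfloor>4 ^ Suc i * binary_code x\<rfloor> = (\<Sum>j<Suc i. of_bool (x j) * 4 ^ (i - j))"
    using binary_code_bounds[of "\<lambda>j. x (j + Suc i)"] by linarith
  also have "\<dots> = of_bool (x i) + (\<Sum>j<i. of_bool (x j) * 4 ^ (i - j))" by simp
  finally have "\<lfloor>4 ^ Suc i * binary_code x\<rfloor> = of_bool (x i) + (\<Sum>j<i. of_bool (x j) * 4 ^ (i - j))" .
  moreover have "even (\<Sum>j<i. of_bool (x j) * 4 ^ (i - j) :: int)"
    by (intro dvd_sum) auto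
  ultimately show ?thesis unfolding binary_digit_def by (cases "x i") auto
qed

lemma measurable_binary_code [measurable]: "binary_code \<in> borel_measurable bool_seq"
  unfolding binary_code_def by measurable

lemma measurable_binary_digit [measurable]: "(\<lambda>u i. binary_digit i u) \<in> measurable borel bool_seq"
  unfolding binary_digit_def
  by (rule measurable_PiM_single') auto

text \<open>The coding has a measurable left inverse. Therefore every Borel set \<open>B\<close> coincides almost everywhere
  with the set of points whose decoded sequence has its code in \<open>B\<close>, and that set is generated by
  the digits.\<close>

lemma (in max_roots) exponent_measure_unit_interval:
  obtains M :: "real measure" and A :: "nat \<Rightarrow> real set"
  where "sets M = sets (restrict_space borel {0..1})" "\<And>i. A i \<in> sets M"
    "\<And>Z. finite Z \<Longrightarrow> emeasure M (\<Union>i\<in>Z. A i) = ennreal (- ln (p Z))"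
    "emeasure M (space M - (\<Union>i. A i)) = 0"
    "\<And>B. B \<in> sets M \<Longrightarrow> \<exists>B'\<in>sigma_sets (space M) (range A). emeasure M (sym_diff B' B) = 0"
proof -
  obtain N :: "(nat \<Rightarrow> bool) measure" where N [measurable_cong]: "sets N = sets bool_seq"
    and hit: "\<And>Z. finite Z \<Longrightarrow> emeasure N {x. \<exists>i\<in>Z. x i} = ennreal (- ln (p Z))"
    and zero: "emeasure N {x. \<forall>i. \<not> x i} = 0"
    using exponent_measure_bool_seq by blast
  have spN: "space N = UNIV" using sets_eq_imp_space_eq[OF N] by (simp add: space_PiM)
  let ?I = "restrict_space borel {0..1::real}"
  have code: "binary_code \<in> measurable N ?I"
    using binary_code_unit_interval by (intro measurable_restrict_space2) (auto simp: measurable_cong_sets[OF N refl])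
  define M where "M = distr N ?I binary_code"
  have M: "sets M = sets ?I" "space M = {0..1}" by (simp_all add: M_def space_restrict_space)
  define A where "A i = {u \<in> {0..1}. binary_digit i u}" for i
  have digit: "(\<lambda>u i. binary_digit i u) \<in> measurable M bool_seq"
    unfolding measurable_cong_sets[OF M(1) refl]
    by (rule measurable_restrict_space1) measurable
  have A: "A i \<in> sets M" for i
  proof -
    have "(\<lambda>u i. binary_digit i u) -` {x. x i} \<inter> space M \<in> sets M"
      by (rule measurable_sets[OF digit coordinate_in_sets])
    moreover have "(\<lambda>u i. binary_digit i u) -` {x. x i} \<inter> space M = A i"
      by (auto simp: A_def M)
    ultimately show ?thesis by simp
  qed
  have vim: "binary_code x \<in> A i \<longleftrightarrow> x i" for x i
    using binary_code_unit_interval by (auto simp: A_def binary_digit_code)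
  have e: "emeasure M B = emeasure N (binary_code -` B \<inter> space N)" if "B \<in> sets M" for B
    using that code M(1) unfolding M_def by (subst emeasure_distr) auto
  show thesis
  proof (rule that[of M A])
    show "sets M = sets ?I" "\<And>i. A i \<in> sets M" using M A by auto
    show "emeasure M (\<Union>i\<in>Z. A i) = ennreal (- ln (p Z))" if "finite Z" for Z
    proof -
      have "binary_code -` (\<Union>i\<in>Z. A i) \<inter> space N = {x. \<exists>i\<in>Z. x i}" by (auto simp: vim spN)
      then show ?thesis using that A by (subst e) (auto simp: hit)
    qed
    show "emeasure M (space M - (\<Union>i. A i)) = 0"
    proof -
      have "binary_code -` (space M - (\<Union>i. A i)) \<inter> space N = {x. \<forall>i. \<not> x i}"
        using binary_code_unit_interval by (auto simp: M vim spN)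
      then show ?thesis using A by (subst e) (auto simp: zero)
    qed
    fix B assume B: "B \<in> sets M"
    let ?C = "binary_code -` B \<inter> space N"
    let ?D = "\<lambda>u i. binary_digit i u"
    have C: "?C \<in> sets bool_seq" using measurable_sets[OF code] B M(1) N by auto
    have "?D -` C \<inter> {0..1} \<in> sigma_sets {0..1} (range A)" if "C \<in> sets bool_seq" for C
    proof -
      have "(\<lambda>u i. binary_digit i u) \<in> measurable (sigma {0..1} (range A)) bool_seq"
      proof (rule measurable_bool_seqI)
        fix i
        have "{u \<in> space (sigma {0..1} (range A)). binary_digit i u} = A i"
          by (auto simp: A_def space_measure_of_conv)
        then show "{u \<in> space (sigma {0..1} (range A)). binary_digit i u} \<in> sets (sigma {0..1} (range A))"
          by (auto simp: A_def)
      qed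
      from measurable_sets[OF this that] show ?thesis
        by (simp add: space_measure_of_conv A_def subset_eq)
    qed
    from this[OF C] have D: "?D -` ?C \<inter> {0..1} \<in> sigma_sets (space M) (range A)" by (simp add: M)
    have DM: "?D -` ?C \<inter> {0..1} \<in> sets M"
      using measurable_sets[OF digit C] by (simp add: M)
    have "binary_code -` (sym_diff (?D -` ?C \<inter> {0..1}) B) \<inter> space N = {}"
      using measurable_space[OF code] by (auto simp: binary_digit_code spN space_restrict_space)
    then have "emeasure M (sym_diff (?D -` ?C \<inter> {0..1}) B) = 0"
      using DM B by (subst e) auto
    with D show "\<exists>B'\<in>sigma_sets (space M) (range A). emeasure M (sym_diff B' B) = 0" by blast
  qed
qed

section \<open>Symmetric differences in measure\<close>

lemma measure_sym_diff:
  assumes "A \<in> fmeasurable M" "B \<in> fmeasurable M"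
  shows "measure M (sym_diff A B) = 2 * measure M (A \<union> B) - measure M A - measure M B"
proof -
  have "measure M (A \<union> B) = measure M A + measure M (B - A)" "measure M (B \<union> A) = measure M B + measure M (A - B)"
    using assms by (simp_all add: measure_Un2)
  moreover have "measure M (sym_diff A B) = measure M (A - B) + measure M (B - A)"
  proof -
    have "(A - B) \<inter> (B - A) = {}" by blast
    then show ?thesis using assms by (subst measure_Un3) auto
  qed
  ultimately show ?thesis by (simp add: Un_commute)
qed

lemma measure_Union_diff_le:
  assumes F: "finite F" and A: "\<And>j. j \<in> F \<Longrightarrow> A j \<in> fmeasurable M" and B: "\<And>j. j \<in> F \<Longrightarrow> B j \<in> fmeasurable M"
  shows "\<bar>measure M (\<Union>j\<in>F. A j) - measure M (\<Union>j\<in>F. B j)\<bar> \<le> (\<Sum>j\<in>F. measure M (sym_diff (A j) (B j)))"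
proof -
  have *: "measure M (\<Union>j\<in>F. A j) \<le> measure M (\<Union>j\<in>F. B j) + (\<Sum>j\<in>F. measure M (sym_diff (A j) (B j)))"
    if A: "\<And>j. j \<in> F \<Longrightarrow> A j \<in> fmeasurable M" and B: "\<And>j. j \<in> F \<Longrightarrow> B j \<in> fmeasurable M" for A B
  proof -
    let ?D = "\<lambda>j. sym_diff (A j) (B j)"
    have D: "?D j \<in> fmeasurable M" if "j \<in> F" for j using A[OF that] B[OF that] by (intro fmeasurable.Un fmeasurable.Diff)
    have UB: "(\<Union>j\<in>F. B j) \<in> fmeasurable M" and UD: "(\<Union>j\<in>F. ?D j) \<in> fmeasurable M"
      using F B D by (auto intro!: fmeasurable.finite_UN)
    have UA: "(\<Union>j\<in>F. A j) \<in> sets M" using F A by (intro sets.finite_UN) auto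
    have "measure M (\<Union>j\<in>F. A j) \<le> measure M ((\<Union>j\<in>F. B j) \<union> (\<Union>j\<in>F. ?D j))"
      by (rule measure_mono_fmeasurable[OF _ UA fmeasurable.Un[OF UB UD]]) blast
    also have "\<dots> \<le> measure M (\<Union>j\<in>F. B j) + measure M (\<Union>j\<in>F. ?D j)"
      using UB UD by (intro measure_Un_le) auto
    also have "measure M (\<Union>j\<in>F. ?D j) \<le> (\<Sum>j\<in>F. measure M (?D j))"
      using F D by (intro measure_UNION_le) auto
    finally show ?thesis by simp
  qed
  have "sym_diff (B j) (A j) = sym_diff (A j) (B j)" for j by blast
  then show ?thesis using *[of A B] *[of B A] A B by simp
qed

lemma measure_diff_le:
  assumes "A \<in> fmeasurable M" "B \<in> fmeasurable M"
  shows "\<bar>measure M A - measure M B\<bar> \<le> measure M (sym_diff A B)"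
  using measure_Union_diff_le[of "{()}" "\<lambda>_. A" M "\<lambda>_. B"] assms by simp

text \<open>Completeness of the measure algebra. The limit is the limes superior of the sets: a point at which
  membership never changes from index \<open>n\<close> on belongs to it iff it belongs to \<open>A n\<close>.\<close>

lemma fast_cauchy_sets_limit:
  assumes A: "\<And>n. A n \<in> sets M"
    and cauchy: "\<And>n. emeasure M (sym_diff (A n) (A (Suc n))) \<le> ennreal ((1 / 2) ^ n)"
  shows "\<exists>B\<in>sets M. \<forall>n. emeasure M (sym_diff (A n) B) \<le> ennreal (2 * (1 / 2) ^ n)"
proof -
  define B where "B = (\<Inter>m. \<Union>k. A (m + k))"
  have B: "B \<in> sets M" unfolding B_def using A by auto
  have "emeasure M (sym_diff (A n) B) \<le> ennreal (2 * (1 / 2) ^ n)" for n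
  proof -
    let ?D = "\<lambda>k. sym_diff (A (n + k)) (A (Suc (n + k)))"
    have "sym_diff (A n) B \<subseteq> (\<Union>k. ?D k)"
    proof
      fix x assume x: "x \<in> sym_diff (A n) B"
      show "x \<in> (\<Union>k. ?D k)"
      proof (rule ccontr)
        assume "x \<notin> (\<Union>k. ?D k)"
        then have step: "x \<in> A (n + k) \<longleftrightarrow> x \<in> A (Suc (n + k))" for k by blast
        have const: "x \<in> A (n + k) \<longleftrightarrow> x \<in> A n" for k
          by (induction k) (use step in auto)
        have "x \<in> B \<longleftrightarrow> x \<in> A n"
        proof
          assume "x \<in> B"
          then obtain k where "x \<in> A (n + k)" unfolding B_def by blast
          then show "x \<in> A n" using const by blast
        next
          assume "x \<in> A n"
          then have "x \<in> A (m + n)" for m using const[of m] by (simp add: add.commute)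
          then show "x \<in> B" unfolding B_def by blast
        qed
        then show False using x by blast
      qed
    qed
    then have "emeasure M (sym_diff (A n) B) \<le> emeasure M (\<Union>k. ?D k)"
      using A by (intro emeasure_mono) auto
    also have "\<dots> \<le> (\<Sum>k. emeasure M (?D k))"
      using A by (intro emeasure_subadditive_countably) auto
    also have "\<dots> \<le> (\<Sum>k. ennreal ((1 / 2) ^ (n + k)))"
      by (intro suminf_le cauchy) auto
    also have "\<dots> = ennreal (2 * (1 / 2) ^ n)"
    proof -
      have "(\<lambda>k. (1 / 2) ^ n * (1 / 2) ^ k :: real) sums ((1 / 2) ^ n * (1 / (1 - 1 / 2)))"
        by (intro sums_mult geometric_sums) simp
      then have "(\<lambda>k. (1 / 2) ^ (n + k) :: real) sums (2 * (1 / 2) ^ n)"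
        by (simp add: power_add mult.commute)
      then show ?thesis by (intro suminf_ennreal_eq) auto
    qed
    finally show ?thesis .
  qed
  then show ?thesis using B by blast
qed

text \<open>The sets that agree with a member of \<open>\<G>\<close> up to a null set form a sigma-algebra.\<close>

lemma sigma_sets_almost_in_subalgebra:
  assumes "sigma_algebra (space M) \<G>" and sub: "\<G> \<subseteq> sets M" and \<A>: "\<A> \<subseteq> sets M"
    and basic: "\<And>A. A \<in> \<A> \<Longrightarrow> \<exists>G\<in>\<G>. sym_diff G A \<in> null_sets M"
    and B: "B \<in> sigma_sets (space M) \<A>"
  shows "\<exists>G\<in>\<G>. sym_diff G B \<in> null_sets M"
proof -
  interpret sigma_algebra "space M" \<G> by fact
  from B show ?thesis
  proof (induction rule: sigma_sets.induct)
    case (Basic B)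
    then show ?case by (rule basic)
  next
    case Empty
    show ?case by (rule bexI[of _ "{}"]) auto
  next
    case (Compl B)
    then obtain G where G: "G \<in> \<G>" "sym_diff G B \<in> null_sets M" by blast
    have "B \<subseteq> space M"
      using Compl.hyps sets.sigma_sets_subset[OF \<A>] sets.sets_into_space by blast
    then have "sym_diff (space M - G) (space M - B) = sym_diff G B"
      using sets_into_space[OF G(1)] by blast
    then show ?case using G by (intro bexI[of _ "space M - G"]) auto
  next
    case (Union B)
    then obtain G where G: "\<And>i. G i \<in> \<G>" "\<And>i. sym_diff (G i) (B i) \<in> null_sets M" by metis
    have Bs: "B i \<in> sets M" for i
      using Union.hyps[of i] sets.sigma_sets_subset[OF \<A>] by blast
    have "sym_diff (\<Union>i. G i) (\<Union>i. B i) \<in> null_sets M"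
    proof (rule null_sets_subset)
      show "(\<Union>i. sym_diff (G i) (B i)) \<in> null_sets M" using G(2) by (intro null_sets_UN)
      show "sym_diff (\<Union>i. G i) (\<Union>i. B i) \<in> sets M"
        using Bs G(1) sub by (intro sets.Un sets.Diff sets.countable_UN) auto
    qed blast
    then show ?case using G(1) by (intro bexI[of _ "\<Union>i. G i"]) auto
  qed
qed

section \<open>Dense sets of levels\<close>

text \<open>Levels that suffice to determine a distribution function on the positive half-line, by
  right-continuity. They will be chosen among the continuity points.\<close>

definition dense_levels :: "real set \<Rightarrow> bool" where
  "dense_levels D \<longleftrightarrow> D \<subseteq> {0<..} \<and> (\<forall>x y. 0 \<le> x \<and> x < y \<longrightarrow> (\<exists>d\<in>D. x < d \<and> d < y))"

lemma dense_levels_sequence: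
  assumes "dense_levels D" "0 \<le> a"
  obtains d :: "nat \<Rightarrow> real" where "\<And>n. d n \<in> D" "\<And>n. a < d n" "d \<longlonglongrightarrow> a"
proof -
  have "\<exists>d\<in>D. a < d \<and> d < a + 1 / real (Suc n)" for n
    using assms by (auto simp: dense_levels_def)
  then obtain d where d: "\<And>n. d n \<in> D" "\<And>n. a < d n" "\<And>n. d n < a + 1 / real (Suc n)" by metis
  have "d \<longlonglongrightarrow> a"
  proof (rule real_tendsto_sandwich)
    show "(\<lambda>_. a) \<longlonglongrightarrow> a" by simp
    show "(\<lambda>n. a + 1 / real (Suc n)) \<longlonglongrightarrow> a"
      using tendsto_add[OF tendsto_const[of a] LIMSEQ_inverse_real_of_nat] by (simp add: inverse_eq_divide)
  qed (use d in \<open>auto intro!: always_eventually less_imp_le simp del: of_nat_Suc\<close>)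
  with d show thesis using that by blast
qed

lemma exists_dense_levels_avoiding:
  assumes "countable (N :: real set)"
  shows "\<exists>D. countable D \<and> dense_levels D \<and> D \<inter> N = {}"
proof -
  have "\<exists>d. q < d \<and> d < r \<and> d \<notin> N" if "q < r" for q r :: real
  proof (rule ccontr)
    assume "\<not> ?thesis"
    then have "{q<..<r} \<subseteq> N" by auto
    then show False using assms that uncountable_open_interval[of q r] countable_subset by blast
  qed
  then obtain g where g: "\<And>q r :: real. q < r \<Longrightarrow> q < g q r \<and> g q r < r \<and> g q r \<notin> N" by metis
  let ?S = "{z \<in> \<rat> \<times> \<rat>. 0 \<le> fst z \<and> fst z < snd z}"
  define D where "D = (\<lambda>z. g (fst z) (snd z)) ` ?S"
  have "countable D" unfolding D_def
    by (intro countable_image countable_subset[of ?S "\<rat> \<times> \<rat>"] countable_SIGMA) (auto simp: countable_rat)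
  moreover have "dense_levels D"
    unfolding dense_levels_def
  proof (intro conjI allI impI)
    show "D \<subseteq> {0<..}" unfolding D_def using g by (auto intro: le_less_trans)
    fix x y :: real assume xy: "0 \<le> x \<and> x < y"
    obtain q where q: "q \<in> \<rat>" "x < q" "q < y" using Rats_dense_in_real[of x y] xy by auto
    obtain r where r: "r \<in> \<rat>" "q < r" "r < y" using Rats_dense_in_real[of q y] q by auto
    have "g q r \<in> D" unfolding D_def using q r xy by (intro image_eqI[of _ _ "(q, r)"]) auto
    moreover have "x < g q r" "g q r < y" using g[OF r(2)] q r by auto
    ultimately show "\<exists>d\<in>D. x < d \<and> d < y" by blast
  qed
  moreover have "D \<inter> N = {}" unfolding D_def using g by auto
  ultimately show ?thesis by blast
qed

section \<open>Sets of points matching events\<close>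

text \<open>The link formula between events and sets of points: \<open>C i\<close> for \<open>i \<in> Z\<close> all fail with the probability
  that a Poisson process of intensity \<open>M\<close> has no point in \<open>A i\<close> for any \<open>i \<in> Z\<close>.\<close>

locale exponent_model = prob_space P for P :: "'w measure" +
  fixes M :: "'a measure" and C :: "nat \<Rightarrow> 'w set" and A :: "nat \<Rightarrow> 'a set"
  assumes C: "\<And>i. C i \<in> events" and A: "\<And>i. A i \<in> fmeasurable M"
    and hit: "\<And>Z. finite Z \<Longrightarrow> prob (space P - (\<Union>i\<in>Z. C i)) = exp (- measure M (\<Union>i\<in>Z. A i))"
begin

text \<open>The correspondence \<open>C i \<mapsto> A i\<close>, closed under joint limits in probability and in measure.\<close>

definition matches :: "'w set \<Rightarrow> 'a set \<Rightarrow> bool" where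
  "matches E B \<longleftrightarrow> E \<in> events \<and> B \<in> fmeasurable M \<and>
     (\<exists>i. (\<lambda>n. prob (sym_diff (C (i n)) E)) \<longlonglongrightarrow> 0 \<and> (\<lambda>n. measure M (sym_diff (A (i n)) B)) \<longlonglongrightarrow> 0)"

lemma matches_self: "matches (C i) (A i)"
  unfolding matches_def using A C by (intro conjI exI[of _ "\<lambda>_. i"]) auto

lemma events_fmeasurable: "E \<in> events \<Longrightarrow> E \<in> fmeasurable P"
  by (intro fmeasurableI) (auto simp: emeasure_eq_measure)

lemma matches_hit:
  assumes F: "finite F" and m: "\<And>j. j \<in> F \<Longrightarrow> matches (E j) (B j)"
  shows "prob (space P - (\<Union>j\<in>F. E j)) = exp (- measure M (\<Union>j\<in>F. B j))"
proof -
  have E: "E j \<in> events" and B: "B j \<in> fmeasurable M" if "j \<in> F" for j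
    using m[OF that] by (auto simp: matches_def)
  have "\<forall>j\<in>F. \<exists>i. (\<lambda>n. prob (sym_diff (C (i n)) (E j))) \<longlonglongrightarrow> 0 \<and> (\<lambda>n. measure M (sym_diff (A (i n)) (B j))) \<longlonglongrightarrow> 0"
    using m by (auto simp: matches_def)
  then obtain i where i: "\<forall>j\<in>F. (\<lambda>n. prob (sym_diff (C (i j n)) (E j))) \<longlonglongrightarrow> 0 \<and>
      (\<lambda>n. measure M (sym_diff (A (i j n)) (B j))) \<longlonglongrightarrow> 0"
    by (auto dest!: bchoice)
  have "(\<lambda>n. prob (\<Union>j\<in>F. C (i j n)) - prob (\<Union>j\<in>F. E j)) \<longlonglongrightarrow> 0"
  proof (rule Lim_null_comparison)
    show "eventually (\<lambda>n. norm (prob (\<Union>j\<in>F. C (i j n)) - prob (\<Union>j\<in>F. E j)) \<le> (\<Sum>j\<in>F. prob (sym_diff (C (i j n)) (E j)))) sequentially"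
      using F C E by (intro always_eventually allI) (simp add: measure_Union_diff_le events_fmeasurable)
    show "(\<lambda>n. \<Sum>j\<in>F. prob (sym_diff (C (i j n)) (E j))) \<longlonglongrightarrow> 0"
      using i by (intro tendsto_null_sum) auto
  qed
  then have 1: "(\<lambda>n. prob (\<Union>j\<in>F. C (i j n))) \<longlonglongrightarrow> prob (\<Union>j\<in>F. E j)" by (simp add: LIM_zero_iff)
  have "(\<lambda>n. measure M (\<Union>j\<in>F. A (i j n)) - measure M (\<Union>j\<in>F. B j)) \<longlonglongrightarrow> 0"
  proof (rule Lim_null_comparison)
    show "eventually (\<lambda>n. norm (measure M (\<Union>j\<in>F. A (i j n)) - measure M (\<Union>j\<in>F. B j)) \<le> (\<Sum>j\<in>F. measure M (sym_diff (A (i j n)) (B j)))) sequentially"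
      using F A B by (intro always_eventually allI) (simp add: measure_Union_diff_le)
    show "(\<lambda>n. \<Sum>j\<in>F. measure M (sym_diff (A (i j n)) (B j))) \<longlonglongrightarrow> 0"
      using i by (intro tendsto_null_sum) auto
  qed
  then have 2: "(\<lambda>n. measure M (\<Union>j\<in>F. A (i j n))) \<longlonglongrightarrow> measure M (\<Union>j\<in>F. B j)" by (simp add: LIM_zero_iff)
  have "prob (space P - (\<Union>j\<in>F. C (i j n))) = exp (- measure M (\<Union>j\<in>F. A (i j n)))" for n
    using hit[of "(\<lambda>j. i j n) ` F"] F by simp
  moreover have "prob (space P - (\<Union>j\<in>F. C (i j n))) = 1 - prob (\<Union>j\<in>F. C (i j n))" for n
    using F C by (intro prob_compl sets.finite_UN) auto
  ultimately have "1 - prob (\<Union>j\<in>F. C (i j n)) = exp (- measure M (\<Union>j\<in>F. A (i j n)))" for n by simp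
  moreover have "(\<lambda>n. 1 - prob (\<Union>j\<in>F. C (i j n))) \<longlonglongrightarrow> 1 - prob (\<Union>j\<in>F. E j)"
    by (intro tendsto_intros 1)
  moreover have "(\<lambda>n. exp (- measure M (\<Union>j\<in>F. A (i j n)))) \<longlonglongrightarrow> exp (- measure M (\<Union>j\<in>F. B j))"
    by (intro tendsto_intros 2)
  ultimately have "1 - prob (\<Union>j\<in>F. E j) = exp (- measure M (\<Union>j\<in>F. B j))"
    using LIMSEQ_unique by simp
  moreover have "prob (space P - (\<Union>j\<in>F. E j)) = 1 - prob (\<Union>j\<in>F. E j)"
    using F E by (intro prob_compl sets.finite_UN) auto
  ultimately show ?thesis by simp
qed

lemma matches_hit1: "matches E B \<Longrightarrow> prob (space P - E) = exp (- measure M B)"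
  using matches_hit[of "{()}" "\<lambda>_. E" "\<lambda>_. B"] by simp

lemma matches_hit2:
  "matches E B \<Longrightarrow> matches E' B' \<Longrightarrow> prob (space P - (E \<union> E')) = exp (- measure M (B \<union> B'))"
  using matches_hit[of "{True, False}" "\<lambda>b. if b then E else E'" "\<lambda>b. if b then B else B'"]
  by (simp add: Un_commute split: if_splits)

lemma matches_fmeasurable: "matches E B \<Longrightarrow> B \<in> fmeasurable M"
  by (simp add: matches_def)

lemma matches_unique:
  assumes "matches E B" "matches E B'"
  shows "emeasure M (sym_diff B B') = 0"
proof -
  have "measure M (B \<union> B') = measure M B" "measure M (B \<union> B') = measure M B'"
    using matches_hit2[OF assms] matches_hit1[OF assms(1)] matches_hit1[OF assms(2)] by auto
  moreover have B: "B \<in> fmeasurable M" "B' \<in> fmeasurable M" using assms by (auto simp: matches_def)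
  ultimately have "measure M (sym_diff B B') = 0" by (simp add: measure_sym_diff)
  moreover have "sym_diff B B' \<in> fmeasurable M" using B by (intro fmeasurable.Un fmeasurable.Diff)
  ultimately show ?thesis by (simp add: emeasure_eq_measure2)
qed

text \<open>Symmetric difference is a group operation, so \<open>A i\<close> differs from \<open>B\<close> and from \<open>B'\<close> by sets which
  themselves differ by a null set.\<close>

lemma matches_cong:
  assumes m: "matches E B" and B': "B' \<in> sets M" "emeasure M (sym_diff B B') = 0"
  shows "matches E B'"
proof -
  have B: "B \<in> fmeasurable M" using m by (simp add: matches_def)
  have N: "sym_diff B B' \<in> null_sets M" using B B' by (auto simp: null_sets_def)
  then have N': "sym_diff B B' \<in> fmeasurable M" by (rule fmeasurableI_null_sets)
  have fB': "B' \<in> fmeasurable M"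
    by (rule fmeasurableI2[OF fmeasurable.Un[OF B N'] _ B'(1)]) blast
  have eq: "measure M (sym_diff (A i) B') = measure M (sym_diff (A i) B)" for i
  proof -
    have "sym_diff (A i) B \<in> fmeasurable M" "sym_diff (A i) B' \<in> fmeasurable M"
      using A B fB' by (auto intro!: fmeasurable.Un fmeasurable.Diff)
    then have "\<bar>measure M (sym_diff (A i) B') - measure M (sym_diff (A i) B)\<bar>
        \<le> measure M (sym_diff (sym_diff (A i) B') (sym_diff (A i) B))" by (intro measure_diff_le)
    also have "sym_diff (sym_diff (A i) B') (sym_diff (A i) B) = sym_diff B B'" by blast
    also have "measure M (sym_diff B B') = 0" using B'(2) by (simp add: measure_def)
    finally show ?thesis by simp
  qed
  show ?thesis using m fB' unfolding matches_def eq by simp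
qed

lemma measure_A: "measure M (A i) = - ln (1 - prob (C i))"
  and measure_A_Un: "measure M (A i \<union> A j) = - ln (1 - prob (C i \<union> C j))"
proof -
  have "1 - prob (C i) = exp (- measure M (A i))"
    using matches_hit1[OF matches_self] C by (simp add: prob_compl)
  then show "measure M (A i) = - ln (1 - prob (C i))" by simp
  have "1 - prob (C i \<union> C j) = exp (- measure M (A i \<union> A j))"
    using matches_hit2[OF matches_self matches_self] C by (simp add: prob_compl sets.Un flip: prob_compl)
  then show "measure M (A i \<union> A j) = - ln (1 - prob (C i \<union> C j))" by simp
qed

text \<open>By the link formula, \<open>M (A i \<triangle> A j)\<close> equals
  \<open>ln P(not C i) + ln P(not C j) - 2 ln P(neither)\<close>. Along a sequence with \<open>C (i n) \<rightarrow> E\<close> all three logarithms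
  tend to \<open>ln P(not E)\<close>, which is finite; so the sets \<open>A (i n)\<close> are Cauchy.\<close>

lemma matches_exists:
  assumes E: "E \<in> events" "prob E < 1" and i: "(\<lambda>n. prob (sym_diff (C (i n)) E)) \<longlonglongrightarrow> 0"
  shows "\<exists>B. matches E B"
proof -
  let ?u = "\<lambda>n. prob (sym_diff (C (i n)) E)"
  let ?d = "\<lambda>n m. measure M (sym_diff (A (i n)) (A (i m)))"
  have cauchy: "\<exists>N. \<forall>n\<ge>N. \<forall>m\<ge>N. ?d n m < \<epsilon>" if "0 < \<epsilon>" for \<epsilon>
  proof -
    have "isCont ln (1 - prob E)" using E by (intro isCont_ln) auto
    then obtain \<delta> where \<delta>: "0 < \<delta>" "\<And>x. \<bar>x - (1 - prob E)\<bar> < \<delta> \<Longrightarrow> \<bar>ln x - ln (1 - prob E)\<bar> < \<epsilon> / 4"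
      unfolding continuous_at_eps_delta using \<open>0 < \<epsilon>\<close> by (metis dist_real_def divide_pos_pos zero_less_numeral)
    obtain N where N: "\<And>n. n \<ge> N \<Longrightarrow> ?u n < \<delta> / 2"
      using order_tendstoD(2)[OF i, of "\<delta> / 2"] \<delta>(1) by (auto simp: eventually_sequentially)
    have "?d n m < \<epsilon>" if "n \<ge> N" "m \<ge> N" for n m
    proof -
      have one: "\<bar>prob (C (i k)) - prob E\<bar> \<le> ?u k" for k
        using C E by (intro measure_diff_le events_fmeasurable)
      have two: "\<bar>prob (C (i n) \<union> C (i m)) - prob E\<bar> \<le> ?u n + ?u m"
        using measure_Union_diff_le[of "{True, False}" "\<lambda>b. if b then C (i n) else C (i m)" P "\<lambda>_. E"]
          C E by (simp add: events_fmeasurable add.commute Un_commute)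
      have "\<bar>ln (1 - prob (C (i n))) - ln (1 - prob E)\<bar> < \<epsilon> / 4"
        "\<bar>ln (1 - prob (C (i m))) - ln (1 - prob E)\<bar> < \<epsilon> / 4"
        "\<bar>ln (1 - prob (C (i n) \<union> C (i m))) - ln (1 - prob E)\<bar> < \<epsilon> / 4"
        using one[of n] one[of m] two N[OF that(1)] N[OF that(2)] \<delta>(1) by (intro \<delta>(2); linarith)+
      moreover have "?d n m = ln (1 - prob (C (i n))) + ln (1 - prob (C (i m)))
          - 2 * ln (1 - prob (C (i n) \<union> C (i m)))"
        using A by (simp add: measure_sym_diff measure_A measure_A_Un)
      ultimately show ?thesis by (simp only: abs_less_iff) linarith
    qed
    then show ?thesis by blast
  qed
  have "\<forall>k. \<exists>N. \<forall>n\<ge>N. \<forall>m\<ge>N. ?d n m < (1 / 2) ^ k" by (intro allI cauchy) simp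
  then obtain N where N: "\<And>k n m. n \<ge> N k \<Longrightarrow> m \<ge> N k \<Longrightarrow> ?d n m < (1 / 2) ^ k" by metis
  \<comment> \<open>Both \<open>r k\<close> and \<open>r (Suc k)\<close> are at least \<open>N k\<close>, and \<open>r\<close> tends to infinity.\<close>
  define r where "r k = k + (\<Sum>j\<le>k. N j)" for k
  have r: "N k \<le> r k" "r k \<le> r (Suc k)" for k
    unfolding r_def using member_le_sum[of k "{..k}" N] by auto
  have r_lim: "filterlim r at_top sequentially"
    by (rule filterlim_at_top_mono[OF filterlim_ident]) (auto simp: r_def)
  have "\<exists>B\<in>sets M. \<forall>n. emeasure M (sym_diff (A (i (r n))) B) \<le> ennreal (2 * (1 / 2) ^ n)"
  proof (rule fast_cauchy_sets_limit)
    show "emeasure M (sym_diff (A (i (r n))) (A (i (r (Suc n))))) \<le> ennreal ((1 / 2) ^ n)" for n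
    proof -
      have "?d (r n) (r (Suc n)) < (1 / 2) ^ n"
        using r[of n] by (intro N) auto
      moreover have "sym_diff (A (i (r n))) (A (i (r (Suc n)))) \<in> fmeasurable M"
        using A by (intro fmeasurable.Un fmeasurable.Diff)
      ultimately show ?thesis by (simp add: emeasure_eq_measure2 ennreal_leI)
    qed
  qed (use A in auto)
  then obtain B where B: "B \<in> sets M" "\<And>n. emeasure M (sym_diff (A (i (r n))) B) \<le> ennreal (2 * (1 / 2) ^ n)"
    by blast
  have D: "sym_diff (A (i (r n))) B \<in> fmeasurable M" for n
    using A B(1) B(2)[of n] by (intro fmeasurableI) (auto simp: less_top[symmetric] top_unique)
  have fB: "B \<in> fmeasurable M"
    by (rule fmeasurableI2[OF fmeasurable.Un[OF A[of "i (r 0)"] D[of 0]] _ B(1)]) blast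
  have "(\<lambda>n. measure M (sym_diff (A (i (r n))) B)) \<longlonglongrightarrow> 0"
  proof (rule Lim_null_comparison)
    have "measure M (sym_diff (A (i (r n))) B) \<le> 2 * (1 / 2) ^ n" for n
      using B(2)[of n] D[of n] by (simp add: emeasure_eq_measure2 ennreal_le_iff)
    then show "eventually (\<lambda>n. norm (measure M (sym_diff (A (i (r n))) B)) \<le> 2 * (1 / 2) ^ n) sequentially"
      by (intro always_eventually allI) simp
    have "(\<lambda>n. 2 * (1 / 2) ^ n :: real) \<longlonglongrightarrow> 2 * 0"
      by (intro tendsto_intros LIMSEQ_realpow_zero) auto
    then show "(\<lambda>n. 2 * (1 / 2) ^ n :: real) \<longlonglongrightarrow> 0" by simp
  qed
  moreover have "(\<lambda>n. prob (sym_diff (C (i (r n))) E)) \<longlonglongrightarrow> 0"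
    using filterlim_compose[OF i r_lim] .
  ultimately show ?thesis
    using E(1) fB unfolding matches_def by (intro exI[of _ B] conjI exI[of _ "\<lambda>n. i (r n)"])
qed

text \<open>A function with the matched sets \<open>B a\<close> as its level sets, given as the supremum of the levels
  \<open>a \<in> D'\<close> with \<open>x \<in> B a\<close>. The link formula turns properties of the distribution function of \<open>Z\<close> into what
  this needs: monotonicity makes the \<open>B a\<close> decreasing up to null sets, the limit 1 at infinity makes
  the supremum finite almost everywhere, and right-continuity gives \<open>{f > a} = B a\<close> up to null sets.\<close>

lemma layer_cake:
  fixes Z :: "'w \<Rightarrow> real"
  assumes Z [measurable]: "Z \<in> borel_measurable P" and D: "D \<subseteq> {0<..}"
    and D': "D' \<subseteq> D" "countable D'" "dense_levels D'"
    and ex: "\<And>a. a \<in> D \<Longrightarrow> \<exists>B. matches {\<omega> \<in> space P. a < Z \<omega>} B"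
  shows "\<exists>f\<in>L_vee M. (\<forall>x. 0 \<le> f x) \<and> (\<forall>a\<in>D. matches {\<omega> \<in> space P. a < Z \<omega>} {x \<in> space M. a < f x})"
proof -
  let ?E = "\<lambda>a. {\<omega> \<in> space P. a < Z \<omega>}"
  obtain B where B: "\<And>a. a \<in> D \<Longrightarrow> matches (?E a) (B a)" using ex by metis
  have fB: "B a \<in> fmeasurable M" if "a \<in> D" for a using B[OF that] by (rule matches_fmeasurable)
  define m where "m a = measure M (B a)" for a
  define F where "F = cdf (distr P borel Z)"
  interpret L: real_distribution "distr P borel Z" by (rule real_distribution_distr[OF Z])
  have F: "prob (space P - ?E a) = F a" for a
    unfolding F_def cdf_def by (subst measure_distr) (auto intro!: arg_cong[where f = prob])
  have mF: "F a = exp (- m a)" if "a \<in> D" for a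
    using matches_hit1[OF B[OF that]] by (simp add: F m_def)
  have mF': "m a = - ln (F a)" if "a \<in> D" for a using mF[OF that] by simp
  have m_Un: "measure M (B a \<union> B b) = m a" if "a \<in> D" "b \<in> D" "a < b" for a b
  proof -
    have "?E a \<union> ?E b = ?E a"
      using \<open>a < b\<close> by auto
    then have "exp (- measure M (B a \<union> B b)) = exp (- m a)"
      using matches_hit2[OF B[OF that(1)] B[OF that(2)]] mF[OF that(1)] by (simp add: F)
    then show ?thesis by simp
  qed
  have decr: "B b - B a \<in> null_sets M" if "a \<in> D" "b \<in> D" "a < b" for a b
  proof -
    have "measure M (B a \<union> B b) = m a + measure M (B b - B a)"
      using fB that by (simp add: measure_Un2 m_def)
    then have "measure M (B b - B a) = 0" using m_Un[OF that] by simp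
    moreover have "B b - B a \<in> fmeasurable M" using fB that by (intro fmeasurable.Diff)
    ultimately show ?thesis by (auto simp: null_sets_def emeasure_eq_measure2)
  qed
  have m_Diff: "measure M (B a - B b) = m a - m b" if "a \<in> D" "b \<in> D" "a < b" for a b
  proof -
    have "measure M (B b \<union> B a) = m b + measure M (B a - B b)"
      using fB that by (simp add: measure_Un2 m_def)
    then show ?thesis using m_Un[OF that] by (simp add: Un_commute)
  qed
  have [measurable]: "B a \<in> sets M" if "a \<in> D" for a using fB[OF that] by auto
  define g where "g x = (SUP a\<in>D'. ennreal a * indicator (B a) x)" for x
  define f where "f x = enn2real (g x)" for x
  have g [measurable]: "g \<in> borel_measurable M"
    unfolding g_def using D'
    by (intro borel_measurable_SUP borel_measurable_times_ennreal borel_measurable_indicator) auto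
  have fm [measurable]: "f \<in> borel_measurable M" unfolding f_def by measurable
  have above: "ennreal a < g x \<longleftrightarrow> (\<exists>b\<in>D'. a < b \<and> x \<in> B b)" if "0 \<le> a" for a x
  proof -
    have "ennreal a < g x \<longleftrightarrow> (\<exists>b\<in>D'. ennreal a < ennreal b * indicator (B b) x)"
      unfolding g_def by (rule less_SUP_iff)
    also have "\<dots> \<longleftrightarrow> (\<exists>b\<in>D'. a < b \<and> x \<in> B b)"
      using that by (intro bex_cong refl) (auto simp: indicator_def ennreal_less_iff)
    finally show ?thesis .
  qed
  \<comment> \<open>Where the supremum is infinite, \<open>f\<close> takes the default value \<open>0\<close> of \<open>enn2real\<close>; this set is null.\<close>
  define I where "I = {x \<in> space M. g x = \<infinity>}"
  have I: "I \<in> null_sets M"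
  proof -
    have sI: "I \<in> sets M" unfolding I_def by measurable
    have le: "emeasure M I \<le> ennreal (m c)" if c: "c \<in> D'" for c
    proof -
      have cD: "c \<in> D" "0 \<le> c" using c D' D by auto
      define N where "N = (\<Union>b\<in>{b \<in> D'. c < b}. B b - B c)"
      have N: "N \<in> null_sets M"
        unfolding N_def using D' cD by (intro null_sets_UN' decr) (auto intro: countable_subset)
      have "I \<subseteq> B c \<union> N"
      proof
        fix x assume "x \<in> I"
        then have "ennreal c < g x" by (simp add: I_def)
        then obtain b where "b \<in> D'" "c < b" "x \<in> B b" using above[OF cD(2)] by auto
        then show "x \<in> B c \<union> N" unfolding N_def by blast
      qed
      then have "emeasure M I \<le> emeasure M (B c \<union> N)"
        using N cD by (intro emeasure_mono) auto
      also have "\<dots> = emeasure M (B c)" using N cD by (intro emeasure_Un_null_set) auto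
      also have "\<dots> = ennreal (m c)" using fB cD by (simp add: m_def emeasure_eq_measure2)
      finally show ?thesis .
    qed
    have "\<exists>c\<in>D'. real n < c" for n
    proof -
      have "\<exists>c\<in>D'. real n < c \<and> c < real n + 1" using D'(3) by (simp add: dense_levels_def)
      then show ?thesis by blast
    qed
    then obtain c where c: "\<And>n. c n \<in> D'" "\<And>n. real n < c n" by metis
    have "filterlim c at_top sequentially"
      by (rule filterlim_at_top_mono[OF filterlim_real_sequentially]) (use c in \<open>auto intro: always_eventually less_imp_le\<close>)
    then have "(\<lambda>n. F (c n)) \<longlonglongrightarrow> 1"
      unfolding F_def by (rule filterlim_compose[OF L.cdf_lim_at_top_prob])
    then have "(\<lambda>n. - ln (F (c n))) \<longlonglongrightarrow> - ln 1" by (intro tendsto_intros) auto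
    moreover have "- ln (F (c n)) = m (c n)" for n using c D' by (subst mF') auto
    ultimately have "(\<lambda>n. m (c n)) \<longlonglongrightarrow> 0" by simp
    then have "(\<lambda>n. ennreal (m (c n))) \<longlonglongrightarrow> ennreal 0" by (rule tendsto_ennrealI)
    then have "emeasure M I \<le> ennreal 0"
      using le c by (intro LIMSEQ_le_const) auto
    then show ?thesis using sI by (auto simp: null_sets_def)
  qed
  have match: "matches (?E a) {x \<in> space M. a < f x}" if a: "a \<in> D" for a
  proof (rule matches_cong[OF B[OF a]])
    have a0: "0 \<le> a" using D a by auto
    show s: "{x \<in> space M. a < f x} \<in> sets M" by measurable
    obtain d where d: "\<And>n. d n \<in> D'" "\<And>n. a < d n" "d \<longlonglongrightarrow> a"
      using dense_levels_sequence[OF D'(3) a0] by blast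
    have dD: "d n \<in> D" for n using d D' by auto
    define N where "N = (\<Union>b\<in>{b \<in> D'. a < b}. B b - B a)"
    define R where "R = B a - (\<Union>n. B (d n))"
    have N: "N \<in> null_sets M"
      unfolding N_def using D' a by (intro null_sets_UN' decr) (auto intro: countable_subset)
    have R0: "R \<in> null_sets M"
    proof -
      have sR: "R \<in> sets M" unfolding R_def using a dD by auto
      have "emeasure M R \<le> ennreal (m a - m (d n))" for n
      proof -
        have "emeasure M R \<le> emeasure M (B a - B (d n))" unfolding R_def using a dD by (intro emeasure_mono) auto
        also have "\<dots> = ennreal (m a - m (d n))"
          using fB a dD m_Diff[OF a dD d(2)] by (subst emeasure_eq_measure2) (auto intro: fmeasurable.Diff)
        finally show ?thesis .
      qed
      moreover have "(\<lambda>n. ennreal (m a - m (d n))) \<longlonglongrightarrow> ennreal 0"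
      proof (rule tendsto_ennrealI)
        have "filterlim d (at_right a) sequentially"
          using d by (auto simp: filterlim_at intro: always_eventually)
        then have "(\<lambda>n. F (d n)) \<longlonglongrightarrow> F a"
          using L.cdf_is_right_cont[of a] unfolding F_def continuous_within by (rule filterlim_compose[rotated])
        moreover have "F a \<noteq> 0" using mF[OF a] by simp
        ultimately have "(\<lambda>n. - ln (F a) - (- ln (F (d n)))) \<longlonglongrightarrow> - ln (F a) - (- ln (F a))" by (intro tendsto_intros)
        then show "(\<lambda>n. m a - m (d n)) \<longlonglongrightarrow> 0" by (simp add: mF'[OF a] mF'[OF dD])
      qed
      ultimately have "emeasure M R \<le> ennreal 0" by (intro LIMSEQ_le_const) auto
      then show ?thesis using sR by (auto simp: null_sets_def)
    qed
    have "sym_diff (B a) {x \<in> space M. a < f x} \<subseteq> I \<union> N \<union> R"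
    proof
      fix x assume x: "x \<in> sym_diff (B a) {x \<in> space M. a < f x}"
      then have xs: "x \<in> space M" using sets.sets_into_space[of "B a" M] fB[OF a] by auto
      show "x \<in> I \<union> N \<union> R"
      proof (cases "x \<in> I")
        case False
        then have "g x < top" using xs by (simp add: I_def less_top)
        then have "g x = ennreal (f x)" by (simp add: f_def)
        then have "a < f x \<longleftrightarrow> (\<exists>b\<in>D'. a < b \<and> x \<in> B b)"
          using above[OF a0, of x] a0 by (simp add: ennreal_less_iff)
        then show ?thesis using x xs d unfolding N_def R_def by blast
      qed simp
    qed
    moreover have n: "I \<union> N \<union> R \<in> null_sets M" using I N R0 by (intro null_sets.Un)
    ultimately have "emeasure M (sym_diff (B a) {x \<in> space M. a < f x}) \<le> emeasure M (I \<union> N \<union> R)"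
      by (intro emeasure_mono) auto
    then show "emeasure M (sym_diff (B a) {x \<in> space M. a < f x}) = 0" using n by auto
  qed
  have "f \<in> L_vee M"
    unfolding L_vee_def
  proof (intro CollectI conjI allI impI fm)
    show "AE x in M. 0 \<le> f x" by (simp add: f_def)
    fix a :: real assume a: "0 < a"
    have "\<exists>d\<in>D'. 0 < d \<and> d < a" using D'(3) a by (simp add: dense_levels_def)
    then obtain d where d: "d \<in> D'" "d < a" by blast
    have "{x \<in> space M. a < f x} \<in> fmeasurable M"
      by (rule fmeasurableI2[OF matches_fmeasurable[OF match[of d]]]) (use d D' in auto)
    then show "emeasure M {x \<in> space M. a < f x} < \<infinity>" by (auto simp: fmeasurable_def)
  qed
  then show ?thesis using match by (intro bexI[of _ f]) (auto simp: f_def)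
qed

end

section \<open>Max-infinitely divisible processes\<close>

lemma essinf_zero_AE_nonneg:
  assumes "essinf P Z = 0" shows "AE \<omega> in P. 0 \<le> Z \<omega>"
proof -
  have le: "0 \<le> Liminf (ae_filter P) (\<lambda>\<omega>. ereal (Z \<omega>))" using assms by (simp add: essinf_def)
  have "AE \<omega> in P. ereal (- (1 / real (Suc n))) < ereal (Z \<omega>)" for n
  proof -
    have "ereal (- (1 / real (Suc n))) < 0" by simp
    then show ?thesis using le unfolding le_Liminf_iff by blast
  qed
  then have "AE \<omega> in P. \<forall>n. - (1 / real (Suc n)) < Z \<omega>" unfolding AE_all_countable by simp
  then show ?thesis
  proof eventually_elim
    case (elim \<omega>)
    show ?case
    proof (rule ccontr)
      assume "\<not> 0 \<le> Z \<omega>"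
      then obtain n where "1 / real (Suc n) < - Z \<omega>"
        using reals_Archimedean[of "- Z \<omega>"] by (auto simp: inverse_eq_divide)
      then show False using elim[rule_format, of n] by linarith
    qed
  qed
qed

lemma (in prob_space) essinf_zero_prob_pos:
  assumes Z [measurable]: "Z \<in> borel_measurable M" and "essinf M Z = 0" "0 < q"
  shows "0 < prob {\<omega> \<in> space M. Z \<omega> \<le> q}"
proof (rule ccontr)
  assume "\<not> 0 < prob {\<omega> \<in> space M. Z \<omega> \<le> q}"
  then have "prob {\<omega> \<in> space M. Z \<omega> \<le> q} = 0" using measure_nonneg[of M] by (simp add: less_le)
  then have "AE \<omega> in M. \<not> Z \<omega> \<le> q"
    by (subst AE_iff_measurable[of "{\<omega> \<in> space M. Z \<omega> \<le> q}"]) (auto simp: emeasure_eq_measure)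
  then have "AE \<omega> in M. ereal q \<le> ereal (Z \<omega>)" by eventually_elim simp
  then have "ereal q \<le> essinf M Z" unfolding essinf_def by (rule Liminf_bounded)
  then show False using assms by simp
qed

lemma fdd_eq_prob:
  assumes eq: "fdd_eq T P X Q Y" and Z: "finite Z" "fst ` Z \<subseteq> T"
  shows "measure P {\<omega> \<in> space P. \<forall>z\<in>Z. X (fst z) \<omega> \<le> snd z}
    = measure Q {\<omega> \<in> space Q. \<forall>z\<in>Z. Y (fst z) \<omega> \<le> (snd z :: real)}"
proof -
  let ?F = "fst ` Z"
  let ?N = "PiM ?F (\<lambda>_. borel :: real measure)"
  let ?B = "{x \<in> space ?N. \<forall>z\<in>Z. x (fst z) \<le> snd z}"
  have B: "?B \<in> sets ?N"
    using Z(1) by (intro sets.sets_Collect_finite_All) measurable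
  have X: "X t \<in> borel_measurable P" and Y: "Y t \<in> borel_measurable Q" if "t \<in> ?F" for t
    using eq Z that by (auto simp: fdd_eq_def process_def)
  have "measure (distr P ?N (\<lambda>\<omega>. \<lambda>t\<in>?F. X t \<omega>)) ?B = measure (distr Q ?N (\<lambda>\<omega>. \<lambda>t\<in>?F. Y t \<omega>)) ?B"
    using eq Z by (simp add: fdd_eq_def)
  moreover have "measure (distr P ?N (\<lambda>\<omega>. \<lambda>t\<in>?F. X t \<omega>)) ?B = measure P {\<omega> \<in> space P. \<forall>z\<in>Z. X (fst z) \<omega> \<le> snd z}"
    using B X by (subst measure_distr) (auto intro!: measurable_restrict arg_cong[where f = "measure P"] simp: space_PiM)
  moreover have "measure (distr Q ?N (\<lambda>\<omega>. \<lambda>t\<in>?F. Y t \<omega>)) ?B = measure Q {\<omega> \<in> space Q. \<forall>z\<in>Z. Y (fst z) \<omega> \<le> snd z}"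
    using B Y by (subst measure_distr) (auto intro!: measurable_restrict arg_cong[where f = "measure Q"] simp: space_PiM)
  ultimately show ?thesis by simp
qed

text \<open>The process \<open>Y\<close> behaves like one of \<open>n\<close> independent copies with maximum \<open>X\<close>; only its distribution
  functions are kept, as the \<open>n\<close>-th roots of those of \<open>X\<close>.\<close>

definition max_root ::
  "'i set \<Rightarrow> 'w measure \<Rightarrow> ('i \<Rightarrow> 'w \<Rightarrow> real) \<Rightarrow> nat \<Rightarrow> 'v measure \<Rightarrow> ('i \<Rightarrow> 'v \<Rightarrow> real) \<Rightarrow> bool" where
  "max_root T P X n Q Y \<longleftrightarrow> process T Q Y \<and>
    (\<forall>Z. finite Z \<longrightarrow> fst ` Z \<subseteq> T \<longrightarrow>
      measure Q {\<omega> \<in> space Q. \<forall>z\<in>Z. Y (fst z) \<omega> \<le> snd z} ^ n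
      = measure P {\<omega> \<in> space P. \<forall>z\<in>Z. X (fst z) \<omega> \<le> snd z})"

text \<open>The copies are independent and a maximum stays below a level iff all of them do.\<close>

lemma max_infinitely_divisible_root:
  fixes X :: "'i \<Rightarrow> 'w \<Rightarrow> real"
  assumes mid: "max_infinitely_divisible T P X" and n: "1 \<le> n"
  shows "\<exists>(Q :: (nat \<Rightarrow> 'i \<Rightarrow> real) measure) Y. max_root T P X n Q Y"
proof -
  obtain Q :: "(nat \<Rightarrow> 'i \<Rightarrow> real) measure" and Y where Q: "prob_space Q" and iid: "iid_processes T Q n Y"
    and max: "fdd_eq T P X Q (\<lambda>t \<omega>. Max ((\<lambda>i. Y i t \<omega>) ` {..<n}))"
    using mid n unfolding max_infinitely_divisible_def by blast
  interpret Q: prob_space Q by fact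
  have n0: "0 < n" using n by simp
  have ind: "Q.indep_vars (\<lambda>_. PiM T (\<lambda>_. borel)) (\<lambda>i \<omega>. \<lambda>t\<in>T. Y i t \<omega>) {..<n}"
    and fdd: "\<And>i. i < n \<Longrightarrow> fdd_eq T Q (Y 0) Q (Y i)" and Y0: "process T Q (Y 0)"
    using iid n0 by (auto simp: iid_processes_def)
  have "Q.prob {\<omega> \<in> space Q. \<forall>z\<in>Z. Y 0 (fst z) \<omega> \<le> snd z} ^ n
      = measure P {\<omega> \<in> space P. \<forall>z\<in>Z. X (fst z) \<omega> \<le> snd z}"
    if Z: "finite Z" "fst ` Z \<subseteq> T" for Z
  proof -
    let ?N = "PiM T (\<lambda>_. borel :: real measure)"
    let ?B = "{x \<in> space ?N. \<forall>z\<in>Z. x (fst z) \<le> snd z}"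
    have B: "?B \<in> sets ?N"
      using Z by (intro sets.sets_Collect_finite_All) (auto intro!: borel_measurable_le measurable_component_singleton)
    have vim: "(\<lambda>\<omega>. \<lambda>t\<in>T. Y i t \<omega>) -` ?B \<inter> space Q = {\<omega> \<in> space Q. \<forall>z\<in>Z. Y i (fst z) \<omega> \<le> snd z}" for i
      using Z(2) by (auto simp: space_PiM subset_eq)
    have "measure P {\<omega> \<in> space P. \<forall>z\<in>Z. X (fst z) \<omega> \<le> snd z}
      = Q.prob {\<omega> \<in> space Q. \<forall>z\<in>Z. Max ((\<lambda>i. Y i (fst z) \<omega>) ` {..<n}) \<le> snd z}"
      by (rule fdd_eq_prob[OF max Z])
    also have "{\<omega> \<in> space Q. \<forall>z\<in>Z. Max ((\<lambda>i. Y i (fst z) \<omega>) ` {..<n}) \<le> snd z}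
      = (\<Inter>i\<in>{..<n}. (\<lambda>\<omega>. \<lambda>t\<in>T. Y i t \<omega>) -` ?B \<inter> space Q)"
    proof (unfold vim, intro set_eqI)
      fix \<omega>
      have "Max ((\<lambda>i. Y i t \<omega>) ` {..<n}) \<le> q \<longleftrightarrow> (\<forall>i<n. Y i t \<omega> \<le> q)" for t q
        using n0 by (subst Max_le_iff) auto
      then show "\<omega> \<in> {\<omega> \<in> space Q. \<forall>z\<in>Z. Max ((\<lambda>i. Y i (fst z) \<omega>) ` {..<n}) \<le> snd z}
        \<longleftrightarrow> \<omega> \<in> (\<Inter>i\<in>{..<n}. {\<omega> \<in> space Q. \<forall>z\<in>Z. Y i (fst z) \<omega> \<le> snd z})"
        using n0 by auto
    qed
    also have "Q.prob \<dots> = (\<Prod>i\<in>{..<n}. Q.prob ((\<lambda>\<omega>. \<lambda>t\<in>T. Y i t \<omega>) -` ?B \<inter> space Q))"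
      by (rule Q.indep_varsD_finite[OF ind]) (use n0 B in auto)
    also have "\<dots> = (\<Prod>i\<in>{..<n}. Q.prob {\<omega> \<in> space Q. \<forall>z\<in>Z. Y 0 (fst z) \<omega> \<le> snd z})"
      unfolding vim using fdd_eq_prob[OF fdd Z] by (intro prod.cong) auto
    finally show ?thesis by simp
  qed
  then have "max_root T P X n Q (Y 0)" unfolding max_root_def using Y0 by blast
  then show ?thesis by blast
qed

text \<open>Each root stays below a single level with probability \<open>c\<^sup>1\<^sup>/\<^sup>n \<rightarrow> 1\<close>. For large \<open>n\<close> the union bound shows
  that it stays below all of the levels with positive probability, whose \<open>n\<close>-th power is the claim.\<close>

lemma max_infinitely_divisible_prob_pos:
  assumes X: "process T P X" and mid: "max_infinitely_divisible T P X"
    and pos: "\<And>t q. t \<in> T \<Longrightarrow> 0 < q \<Longrightarrow> 0 < measure P {\<omega> \<in> space P. X t \<omega> \<le> q}"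
    and Z: "finite Z" "Z \<subseteq> T \<times> {0<..}"
  shows "0 < measure P {\<omega> \<in> space P. \<forall>z\<in>Z. X (fst z) \<omega> \<le> snd z}"
proof -
  let ?c = "\<lambda>z. measure P {\<omega> \<in> space P. X (fst z) \<omega> \<le> snd z}"
  have "(\<lambda>n. \<Sum>z\<in>Z. 1 - root n (?c z)) \<longlonglongrightarrow> (\<Sum>z\<in>Z. 1 - 1)"
    using Z pos by (intro tendsto_sum tendsto_diff tendsto_const LIMSEQ_root_const) auto
  then have "(\<lambda>n. \<Sum>z\<in>Z. 1 - root n (?c z)) \<longlonglongrightarrow> 0" by simp
  then have "eventually (\<lambda>n. (\<Sum>z\<in>Z. 1 - root n (?c z)) < 1) sequentially"
    by (rule order_tendstoD) simp
  then obtain m where m: "\<And>n. n \<ge> m \<Longrightarrow> (\<Sum>z\<in>Z. 1 - root n (?c z)) < 1"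
    unfolding eventually_sequentially by blast
  define n where "n = max 1 m"
  have n: "1 \<le> n" "(\<Sum>z\<in>Z. 1 - root n (?c z)) < 1" using m[of n] by (auto simp: n_def)
  obtain Q :: "(nat \<Rightarrow> 'a \<Rightarrow> real) measure" and Y where "max_root T P X n Q Y"
    using max_infinitely_divisible_root[OF mid n(1)] by blast
  then have Y: "process T Q Y"
    and root: "\<And>Z. finite Z \<Longrightarrow> fst ` Z \<subseteq> T \<Longrightarrow>
      measure Q {\<omega> \<in> space Q. \<forall>z\<in>Z. Y (fst z) \<omega> \<le> snd z} ^ n
      = measure P {\<omega> \<in> space P. \<forall>z\<in>Z. X (fst z) \<omega> \<le> snd z}"
    unfolding max_root_def by blast+
  interpret Q: prob_space Q using Y by (simp add: process_def)
  let ?E = "\<lambda>z. {\<omega> \<in> space Q. Y (fst z) \<omega> \<le> snd z}"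
  have E: "?E z \<in> Q.events" if "z \<in> Z" for z
    using Y Z that by (auto simp: process_def intro!: borel_measurable_le)
  have pE: "Q.prob (?E z) = root n (?c z)" if "z \<in> Z" for z
    using root[of "{z}"] Z that n(1) real_root_power_cancel[of n "Q.prob (?E z)"] by auto
  define V where "V = (\<Union>z\<in>Z. space Q - ?E z)"
  have V: "V \<in> Q.events" unfolding V_def using Z E by (intro sets.finite_UN) auto
  have "Q.prob V \<le> (\<Sum>z\<in>Z. Q.prob (space Q - ?E z))"
    unfolding V_def using Z E by (intro measure_UNION_le) auto
  also have "\<dots> = (\<Sum>z\<in>Z. 1 - root n (?c z))"
    using E pE by (intro sum.cong) (auto simp: Q.prob_compl)
  finally have "Q.prob V < 1" using n(2) by simp
  moreover have "{\<omega> \<in> space Q. \<forall>z\<in>Z. Y (fst z) \<omega> \<le> snd z} = space Q - V" unfolding V_def by auto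
  ultimately have "0 < Q.prob {\<omega> \<in> space Q. \<forall>z\<in>Z. Y (fst z) \<omega> \<le> snd z}"
    using V by (simp add: Q.prob_compl)
  moreover have "fst ` Z \<subseteq> T" using Z by auto
  ultimately show ?thesis by (simp only: root[OF Z(1), symmetric] zero_less_power)
qed

text \<open>If \<open>X (s n)\<close> is within \<open>\<epsilon>\<close> of \<open>X t\<close> and \<open>a < q < a + \<epsilon>\<close>, the two events can differ only where \<open>X t\<close>
  is within \<open>2 \<epsilon>\<close> of \<open>a\<close>. This is unlikely for small \<open>\<epsilon>\<close> because \<open>a\<close> is not an atom.\<close>

lemma (in prob_space) exceedance_approximable:
  assumes X: "\<And>t. t \<in> T \<Longrightarrow> X t \<in> borel_measurable M" and t: "t \<in> T"
    and a: "0 < a" "prob {\<omega> \<in> space M. X t \<omega> = a} = 0"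
    and s: "range s \<subseteq> T" "converges_in_probability M (\<lambda>n. X (s n)) (X t)"
    and D: "\<And>t. t \<in> T \<Longrightarrow> dense_levels (D t)" and \<delta>: "0 < \<delta>"
  shows "\<exists>n. \<exists>q\<in>D (s n). prob (sym_diff {\<omega> \<in> space M. q < X (s n) \<omega>} {\<omega> \<in> space M. a < X t \<omega>}) < \<delta>"
proof -
  have [measurable]: "X t \<in> borel_measurable M" using X t by auto
  have sT: "s n \<in> T" for n using s by auto
  then have [measurable]: "X (s n) \<in> borel_measurable M" for n using X by auto
  interpret L: real_distribution "distr M borel (X t)" by (rule real_distribution_distr) simp
  let ?F = "cdf (distr M borel (X t))"
  have "measure (distr M borel (X t)) {a} = 0"
    using a(2) by (subst measure_distr) (auto simp: vimage_def Int_def conj_commute)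
  then have "isCont ?F a" by (simp add: L.isCont_cdf)
  then obtain d where d: "0 < d" "\<And>x. \<bar>x - a\<bar> < d \<Longrightarrow> \<bar>?F x - ?F a\<bar> < \<delta> / 4"
    unfolding continuous_at_eps_delta using \<delta> by (metis dist_real_def divide_pos_pos zero_less_numeral)
  define \<epsilon> where "\<epsilon> = d / 4"
  have \<epsilon>: "0 < \<epsilon>" using d(1) by (simp add: \<epsilon>_def)
  have near: "prob {\<omega> \<in> space M. a - 2 * \<epsilon> < X t \<omega> \<and> X t \<omega> \<le> a + 2 * \<epsilon>} < \<delta> / 2"
  proof -
    have "?F (a + 2 * \<epsilon>) - ?F (a - 2 * \<epsilon>) = measure (distr M borel (X t)) {a - 2 * \<epsilon><..a + 2 * \<epsilon>}"
      using \<epsilon> by (intro L.cdf_diff_eq) simp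
    also have "\<dots> = prob {\<omega> \<in> space M. a - 2 * \<epsilon> < X t \<omega> \<and> X t \<omega> \<le> a + 2 * \<epsilon>}"
      by (subst measure_distr) (auto intro!: arg_cong[where f = prob])
    finally have "prob {\<omega> \<in> space M. a - 2 * \<epsilon> < X t \<omega> \<and> X t \<omega> \<le> a + 2 * \<epsilon>} = ?F (a + 2 * \<epsilon>) - ?F (a - 2 * \<epsilon>)" ..
    moreover have "\<bar>?F (a + 2 * \<epsilon>) - ?F a\<bar> < \<delta> / 4" "\<bar>?F (a - 2 * \<epsilon>) - ?F a\<bar> < \<delta> / 4"
      using d(1) by (intro d(2); simp add: \<epsilon>_def)+
    ultimately show ?thesis by linarith
  qed
  have "(\<lambda>n. prob {\<omega> \<in> space M. \<bar>X (s n) \<omega> - X t \<omega>\<bar> > \<epsilon>}) \<longlonglongrightarrow> 0"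
    using s(2) \<epsilon> by (simp add: converges_in_probability_def)
  then have "eventually (\<lambda>n. prob {\<omega> \<in> space M. \<bar>X (s n) \<omega> - X t \<omega>\<bar> > \<epsilon>} < \<delta> / 2) sequentially"
    using \<delta> by (intro order_tendstoD) auto
  then obtain n where n: "prob {\<omega> \<in> space M. \<bar>X (s n) \<omega> - X t \<omega>\<bar> > \<epsilon>} < \<delta> / 2"
    by (auto simp: eventually_sequentially)
  obtain q where q: "q \<in> D (s n)" "a < q" "q < a + \<epsilon>"
    using D[OF sT[of n]] a(1) \<epsilon> unfolding dense_levels_def by (metis less_add_same_cancel1 less_imp_le)
  let ?A = "{\<omega> \<in> space M. \<bar>X (s n) \<omega> - X t \<omega>\<bar> > \<epsilon>}"
  let ?B = "{\<omega> \<in> space M. a - 2 * \<epsilon> < X t \<omega> \<and> X t \<omega> \<le> a + 2 * \<epsilon>}"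
  have "sym_diff {\<omega> \<in> space M. q < X (s n) \<omega>} {\<omega> \<in> space M. a < X t \<omega>} \<subseteq> ?A \<union> ?B"
    using q \<epsilon> by (auto simp: abs_if split: if_splits)
  then have "prob (sym_diff {\<omega> \<in> space M. q < X (s n) \<omega>} {\<omega> \<in> space M. a < X t \<omega>}) \<le> prob (?A \<union> ?B)"
    by (intro finite_measure_mono) measurable
  also have "\<dots> \<le> prob ?A + prob ?B" by (intro measure_Un_le) measurable
  also have "\<dots> < \<delta>" using n near by simp
  finally show ?thesis using q(1) by blast
qed


lemma countable_atoms:
  assumes "prob_space P" and Z: "Z \<in> borel_measurable P"
  shows "countable {a :: real. measure P {\<omega> \<in> space P. Z \<omega> = a} \<noteq> 0}"
proof -
  interpret prob_space P by fact
  interpret L: prob_space "distr P borel Z" by (rule prob_space_distr[OF Z])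
  have "measure (distr P borel Z) {a} = measure P {\<omega> \<in> space P. Z \<omega> = a}" for a
    using Z by (subst measure_distr) (auto intro!: arg_cong[where f = "measure P"])
  then show ?thesis using L.countable_support by simp
qed

section \<open>Poisson counts from generating functions\<close>

text \<open>The value \<open>0\<close> at infinity makes \<open>enat_power z e\<close> the sum of \<open>z ^ k\<close> over the finite values \<open>k\<close> of \<open>e\<close>,
  so infinite counts simply do not contribute to generating functions.\<close>

definition enat_power :: "real \<Rightarrow> enat \<Rightarrow> real" where
  "enat_power z e = (case e of enat n \<Rightarrow> z ^ n | \<infinity> \<Rightarrow> 0)"

lemma enat_power_bounds: "0 \<le> z \<Longrightarrow> z \<le> 1 \<Longrightarrow> 0 \<le> enat_power z e \<and> enat_power z e \<le> 1"
  by (auto simp: enat_power_def power_le_one split: enat.split)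

lemma enat_power_sums:
  "(\<lambda>k. z ^ k * indicator {enat k} e) sums enat_power z e"
proof (cases e)
  case (enat n)
  have "(\<lambda>k. z ^ k * indicator {enat k} e) = (\<lambda>k. if k = n then z ^ k else 0)"
    using enat by (auto simp: indicator_def)
  then show ?thesis using sums_single[of n "\<lambda>k. z ^ k"] by (simp add: enat_power_def enat)
next
  case infinity
  then show ?thesis by (simp add: enat_power_def)
qed

text \<open>Divide by \<open>z ^ k\<close> once the lower coefficients are known to vanish, and let \<open>z\<close> tend to \<open>0\<close> from
  the right.\<close>

lemma power_series_zero_on_unit_interval:
  fixes d :: "nat \<Rightarrow> real"
  assumes zero: "\<And>z. 0 < z \<Longrightarrow> z < 1 \<Longrightarrow> (\<lambda>k. d k * z ^ k) sums 0"
    and d: "\<And>k. \<bar>d k\<bar> \<le> C"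
  shows "d k = 0"
proof (induction k rule: less_induct)
  case (less k)
  have s: "summable (\<lambda>n. d (n + k) * x ^ n)" if "norm x < 1" for x
  proof (rule summable_comparison_test')
    show "summable (\<lambda>n. C * \<bar>x\<bar> ^ n)" using that by (intro summable_mult summable_geometric) auto
    show "norm (d (n + k) * x ^ n) \<le> C * \<bar>x\<bar> ^ n" if "n \<ge> 0" for n
      using d[of "n + k"] by (auto simp: abs_mult power_abs intro!: mult_right_mono)
  qed
  define f where "f x = (\<Sum>n. d (n + k) * x ^ n)" for x
  have "(f \<longlongrightarrow> d (0 + k)) (at 0)"
    using powser_limit_0[of 1 "\<lambda>n. d (n + k)" f] summable_sums[OF s] by (auto simp: f_def)
  then have "(f \<longlongrightarrow> d k) (at_right 0)" by (simp add: filterlim_at_split)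
  moreover have "f z = 0" if z: "0 < z" "z < 1" for z
  proof -
    have "(\<lambda>n. d (n + k) * z ^ (n + k)) sums (0 - (\<Sum>i<k. d i * z ^ i))"
      by (rule sums_split_initial_segment[OF zero[OF z]])
    also have "(\<Sum>i<k. d i * z ^ i) = 0" using less by simp
    finally have "(\<lambda>n. d (n + k) * z ^ n * z ^ k) sums 0" by (simp add: power_add mult.assoc)
    then have "(\<lambda>n. d (n + k) * z ^ n * z ^ k * (1 / z ^ k)) sums (0 * (1 / z ^ k))" by (rule sums_mult2)
    then show "f z = 0" using z unfolding f_def by (simp add: sums_iff)
  qed
  then have "eventually (\<lambda>z. f z = 0) (at_right 0)"
    unfolding eventually_at_right_field by (intro exI[of _ 1]) auto
  ultimately have "((\<lambda>_. 0) \<longlongrightarrow> d k) (at_right (0::real))" by (rule tendsto_cong[THEN iffD1, rotated])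
  then show "d k = 0" using tendsto_unique[OF trivial_limit_at_right_real _ tendsto_const] by fastforce
qed

text \<open>Comparison of coefficients in the presence of a weight \<open>W\<close>; the weight carries the other
  variables in the joint version below.\<close>

lemma (in prob_space) pgf_coefficient:
  fixes W :: "'a \<Rightarrow> real" and e :: "'a \<Rightarrow> enat"
  assumes W [measurable]: "W \<in> borel_measurable M" and W01: "\<And>\<omega>. 0 \<le> W \<omega> \<and> W \<omega> \<le> 1"
    and e [measurable]: "e \<in> measurable M (count_space UNIV)"
    and q: "\<And>k. 0 \<le> q k \<and> q k \<le> 1" and c: "0 \<le> c \<and> c \<le> 1"
    and pgf: "\<And>z. 0 < z \<Longrightarrow> z < 1 \<Longrightarrow>
      expectation (\<lambda>\<omega>. W \<omega> * enat_power z (e \<omega>)) = (\<Sum>k. q k * z ^ k) * c"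
  shows "expectation (\<lambda>\<omega>. W \<omega> * indicator {enat k} (e \<omega>)) = q k * c"
proof -
  define a where "a k = expectation (\<lambda>\<omega>. W \<omega> * indicator {enat k} (e \<omega>))" for k
  have int: "integrable M (\<lambda>\<omega>. W \<omega> * indicator {enat k} (e \<omega>))" for k
    by (rule integrable_const_bound[of _ 1]) (use W01 in \<open>auto simp: indicator_def\<close>)
  have a: "0 \<le> a k" "a k \<le> 1" for k
  proof -
    show "0 \<le> a k" unfolding a_def using W01 by (intro integral_nonneg_AE) (auto simp: indicator_def)
    have "a k \<le> expectation (\<lambda>_. 1)" unfolding a_def
      using W01 by (intro integral_mono int) (auto simp: indicator_def)
    then show "a k \<le> 1" by (simp add: prob_space)
  qed
  have "a k - q k * c = 0" for k
  proof (rule power_series_zero_on_unit_interval)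
    fix k
    have "q k * c \<le> 1" "0 \<le> q k * c" using q[of k] c by (auto intro: mult_le_one)
    then show "\<bar>a k - q k * c\<bar> \<le> 1" using a[of k] by linarith
  next
    fix z :: real assume z: "0 < z" "z < 1"
    have "(\<lambda>k. expectation (\<lambda>\<omega>. z ^ k * (W \<omega> * indicator {enat k} (e \<omega>))))
      sums (expectation (\<lambda>\<omega>. \<Sum>k. z ^ k * (W \<omega> * indicator {enat k} (e \<omega>))))"
    proof (rule sums_integral)
      show "integrable M (\<lambda>\<omega>. z ^ k * (W \<omega> * indicator {enat k} (e \<omega>)))" for k
        by (intro integrable_mult_right int)
      have sW: "summable (\<lambda>k. z ^ k)" using z by (simp add: summable_geometric)
      show "AE x in M. summable (\<lambda>k. norm (z ^ k * (W x * indicator {enat k} (e x))))"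
      proof (intro AE_I2 summable_comparison_test'[OF sW, of 0])
        fix \<omega> n
        show "norm (norm (z ^ n * (W \<omega> * indicator {enat n} (e \<omega>)))) \<le> z ^ n"
          using W01[of \<omega>] z by (auto simp: indicator_def abs_mult power_abs intro: mult_left_le)
      qed
      show "summable (\<lambda>k. \<integral>x. norm (z ^ k * (W x * indicator {enat k} (e x))) \<partial>M)"
      proof (rule summable_comparison_test'[OF sW, of 0])
        fix n
        have "(\<integral>x. norm (z ^ n * (W x * indicator {enat n} (e x))) \<partial>M) = z ^ n * a n"
          unfolding a_def using z W01
          by (subst integral_mult_right_zero[symmetric]) (auto intro!: Bochner_Integration.integral_cong simp: abs_mult power_abs indicator_def)
        then show "norm (\<integral>x. norm (z ^ n * (W x * indicator {enat n} (e x))) \<partial>M) \<le> z ^ n"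
          using z a[of n] by (auto simp: abs_mult power_abs intro: mult_left_le)
      qed
    qed
    moreover have "(\<Sum>k. z ^ k * (W \<omega> * indicator {enat k} (e \<omega>))) = W \<omega> * enat_power z (e \<omega>)" for \<omega>
      using sums_mult[OF enat_power_sums[of z "e \<omega>"], of "W \<omega>"] by (simp add: sums_iff mult_ac)
    ultimately have "(\<lambda>k. z ^ k * a k) sums ((\<Sum>k. q k * z ^ k) * c)"
      using pgf[OF z] by (simp add: a_def)
    moreover have "summable (\<lambda>k. q k * z ^ k)"
      by (rule summable_comparison_test'[of "\<lambda>k. z ^ k" 0])
         (use q z in \<open>auto simp: abs_mult power_abs intro: mult_left_le_one_le\<close>)
    then have "(\<lambda>k. q k * z ^ k * c) sums ((\<Sum>k. q k * z ^ k) * c)"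
      by (intro sums_mult2 summable_sums)
    ultimately have "(\<lambda>k. z ^ k * a k - q k * z ^ k * c) sums 0"
      using sums_diff by fastforce
    then show "(\<lambda>k. (a k - q k * c) * z ^ k) sums 0" by (simp add: algebra_simps)
  qed
  then show ?thesis by (simp add: a_def)
qed

text \<open>The generating factors are replaced by indicators one index at a time; the factors already
  replaced, and those still to come, form the weight.\<close>

lemma (in prob_space) joint_pgf_coefficients:
  fixes e :: "'i \<Rightarrow> 'a \<Rightarrow> enat" and q :: "'i \<Rightarrow> nat \<Rightarrow> real"
  assumes I: "finite I"
    and e [measurable]: "\<And>i. i \<in> I \<Longrightarrow> e i \<in> measurable M (count_space UNIV)"
    and q: "\<And>i k. 0 \<le> q i k \<and> q i k \<le> 1"
    and q1: "\<And>i z. 0 < z \<Longrightarrow> z < 1 \<Longrightarrow> 0 \<le> (\<Sum>k. q i k * z ^ k) \<and> (\<Sum>k. q i k * z ^ k) \<le> 1"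
    and pgf: "\<And>z. (\<And>i. 0 < z i \<and> z i < 1) \<Longrightarrow>
      expectation (\<lambda>\<omega>. \<Prod>i\<in>I. enat_power (z i) (e i \<omega>)) = (\<Prod>i\<in>I. \<Sum>k. q i k * z i ^ k)"
  shows "prob {\<omega> \<in> space M. \<forall>i\<in>I. e i \<omega> = enat (k i)} = (\<Prod>i\<in>I. q i (k i))"
proof -
  have "expectation (\<lambda>\<omega>. (\<Prod>i\<in>A. indicator {enat (k i)} (e i \<omega>)) * (\<Prod>i\<in>I - A. enat_power (z i) (e i \<omega>)))
    = (\<Prod>i\<in>A. q i (k i)) * (\<Prod>i\<in>I - A. \<Sum>k. q i k * z i ^ k)"
    if "A \<subseteq> I" "\<And>i. 0 < z i \<and> z i < 1" for A z
    using finite_subset[OF that(1) I] that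
  proof (induction A arbitrary: z rule: finite_induct)
    case empty
    then show ?case using pgf by simp
  next
    case (insert j A)
    let ?B = "I - insert j A"
    let ?g = "\<Prod>i\<in>?B. \<Sum>k. q i k * z i ^ k" and ?q = "\<Prod>i\<in>A. q i (k i)"
    let ?W = "\<lambda>\<omega>. (\<Prod>i\<in>A. indicator {enat (k i)} (e i \<omega>)) * (\<Prod>i\<in>?B. enat_power (z i) (e i \<omega>)) :: real"
    have j: "j \<in> I" "j \<notin> A" "A \<subseteq> I" using insert by auto
    have BI: "finite ?B" "I - A = insert j ?B" "j \<notin> ?B" using I j by auto
    have z01: "0 \<le> z i \<and> z i \<le> 1" for i using insert.prems(2)[of i] by auto
    have "expectation (\<lambda>\<omega>. ?W \<omega> * indicator {enat (k j)} (e j \<omega>))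
      = q j (k j) * (?q * ?g)"
    proof (rule pgf_coefficient)
      have [measurable]: "e i \<in> measurable M (count_space UNIV)" if "i \<in> A" for i
        using that j by (intro e) auto
      show "?W \<in> borel_measurable M"
        by (intro borel_measurable_times borel_measurable_prod)
           (use j e in \<open>auto intro!: measurable_compose[OF e] simp: enat_power_def\<close>)
      show "0 \<le> ?W \<omega> \<and> ?W \<omega> \<le> 1" for \<omega>
      proof -
        have "0 \<le> (\<Prod>i\<in>A. indicator {enat (k i)} (e i \<omega>) :: real)"
          "(\<Prod>i\<in>A. indicator {enat (k i)} (e i \<omega>) :: real) \<le> 1"
          by (rule prod_nonneg, simp) (rule prod_le_1, simp)
        moreover have "0 \<le> (\<Prod>i\<in>?B. enat_power (z i) (e i \<omega>))"
          using enat_power_bounds z01 by (intro prod_nonneg) blast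
        moreover have "(\<Prod>i\<in>?B. enat_power (z i) (e i \<omega>)) \<le> 1"
          using enat_power_bounds z01 by (intro prod_le_1) blast
        ultimately show ?thesis by (intro conjI mult_nonneg_nonneg mult_le_one)
      qed
      show "e j \<in> measurable M (count_space UNIV)" using e j by auto
      have "0 \<le> ?q" "?q \<le> 1"
        using q by (auto intro!: prod_nonneg prod_le_1)
      moreover have "0 \<le> ?g" "?g \<le> 1"
        using q1 insert.prems(2) by (auto intro!: prod_nonneg prod_le_1)
      ultimately show "0 \<le> ?q * ?g \<and>
        ?q * ?g \<le> 1"
        by (intro conjI mult_nonneg_nonneg mult_le_one)
    next
      fix y :: real assume y: "0 < y" "y < 1"
      have "expectation (\<lambda>\<omega>. (\<Prod>i\<in>A. indicator {enat (k i)} (e i \<omega>)) * (\<Prod>i\<in>I - A. enat_power ((z(j := y)) i) (e i \<omega>)))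
        = ?q * (\<Prod>i\<in>I - A. \<Sum>k. q i k * (z(j := y)) i ^ k)"
        using insert.prems j y by (intro insert.IH) auto
      moreover have "(\<Prod>i\<in>I - A. enat_power ((z(j := y)) i) (e i \<omega>))
          = enat_power y (e j \<omega>) * (\<Prod>i\<in>?B. enat_power (z i) (e i \<omega>))" for \<omega>
        unfolding BI(2) prod.insert[OF BI(1,3)] by (auto intro!: prod.cong)
      moreover have "(\<Prod>i\<in>I - A. \<Sum>k. q i k * (z(j := y)) i ^ k)
          = (\<Sum>k. q j k * y ^ k) * ?g"
        unfolding BI(2) prod.insert[OF BI(1,3)] by (auto intro!: prod.cong)
      ultimately show "expectation (\<lambda>\<omega>. ?W \<omega> * enat_power y (e j \<omega>))
        = (\<Sum>k. q j k * y ^ k) * (?q * ?g)"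
        by (simp add: mult_ac)
    qed (use q in auto)
    then show ?case
      unfolding prod.insert[OF insert.hyps(1,2)] by (simp add: mult_ac)
  qed
  from this[of I "\<lambda>_. 1/2"]
  have "expectation (\<lambda>\<omega>. \<Prod>i\<in>I. indicator {enat (k i)} (e i \<omega>)) = (\<Prod>i\<in>I. q i (k i))" by simp
  moreover have "expectation (\<lambda>\<omega>. \<Prod>i\<in>I. indicator {enat (k i)} (e i \<omega>) :: real)
    = expectation (indicator {\<omega> \<in> space M. \<forall>i\<in>I. e i \<omega> = enat (k i)})"
    by (rule Bochner_Integration.integral_cong) (use I in \<open>auto simp: indicator_def prod_zero_iff\<close>)
  moreover have "{\<omega> \<in> space M. \<forall>i\<in>I. e i \<omega> = enat (k i)} \<in> events"
  proof (rule sets.sets_Collect_finite_All[OF _ I])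
    fix i assume "i \<in> I"
    from measurable_sets[OF e[OF this], of "{enat (k i)}"]
    show "{\<omega> \<in> space M. e i \<omega> = enat (k i)} \<in> events" by (simp add: vimage_def Int_def conj_commute)
  qed
  ultimately show ?thesis by simp
qed


text \<open>All weights vanish when \<open>B\<close> has infinite measure, expressing that the count is then infinite.\<close>

definition poisson_weight :: "'a measure \<Rightarrow> 'a set \<Rightarrow> nat \<Rightarrow> real" where
  "poisson_weight M B k =
     (if emeasure M B = \<infinity> then 0 else measure M B ^ k / fact k * exp (- measure M B))"

lemma poisson_weight_pgf:
  "(\<lambda>k. poisson_weight M B k * z ^ k) sums
     (if emeasure M B = \<infinity> then 0 else exp (- (1 - z) * measure M B))"
proof (cases "emeasure M B = \<infinity>")
  case False
  have "(\<lambda>k. exp (- measure M B) * ((measure M B * z) ^ k /\<^sub>R fact k))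
      sums (exp (- measure M B) * exp (measure M B * z))"
    by (intro sums_mult exp_converges)
  moreover have "exp (- measure M B) * exp (measure M B * z) = exp (- (1 - z) * measure M B)"
    by (simp add: exp_add[symmetric] algebra_simps)
  ultimately show ?thesis
    using False by (simp add: poisson_weight_def power_mult_distrib field_simps)
qed (simp add: poisson_weight_def)

lemma poisson_weight_bounds: "0 \<le> poisson_weight M B k \<and> poisson_weight M B k \<le> 1"
proof
  show nn: "0 \<le> poisson_weight M B k" for k by (simp add: poisson_weight_def)
  have "(\<lambda>k. poisson_weight M B k * 1 ^ k) sums (if emeasure M B = \<infinity> then 0 else exp (- (1 - 1) * measure M B))"
    by (rule poisson_weight_pgf)
  then have s: "summable (poisson_weight M B)" "suminf (poisson_weight M B) \<le> 1"
    by (auto simp: sums_iff split: if_splits)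
  have "sum (poisson_weight M B) {k} \<le> suminf (poisson_weight M B)"
    using s nn by (intro sum_le_suminf) auto
  then show "poisson_weight M B k \<le> 1" using s by simp
qed

definition count_enat :: "('w \<Rightarrow> nat set) \<Rightarrow> (nat \<Rightarrow> 'w \<Rightarrow> 'a) \<Rightarrow> 'a set \<Rightarrow> 'w \<Rightarrow> enat" where
  "count_enat J U B \<omega> = (let N = {i \<in> J \<omega>. U i \<omega> \<in> B} in if finite N then enat (card N) else \<infinity>)"

lemma point_count_eq: "point_count J U B \<omega> = ennreal_of_enat (count_enat J U B \<omega>)"
  by (simp add: point_count_def count_enat_def Let_def)

text \<open>The joint generating function over disjoint sets is a product of Poisson ones (or \<open>0\<close>). It gives at
  once the marginal laws, almost sure infiniteness on sets of infinite measure, and independence.\<close>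

lemma (in prob_space) poisson_point_process_if_pgf:
  assumes U: "\<And>\<omega> i. \<omega> \<in> space M \<Longrightarrow> i \<in> J \<omega> \<Longrightarrow> U i \<omega> \<in> space N"
    and meas: "\<And>B. B \<in> sets N \<Longrightarrow> count_enat J U B \<in> measurable M (count_space UNIV)"
    and pgf: "\<And>(I :: nat set) B z. finite I \<Longrightarrow> (\<And>i. i \<in> I \<Longrightarrow> B i \<in> sets N) \<Longrightarrow> disjoint_family_on B I \<Longrightarrow>
      (\<And>i. 0 < z i \<and> z i < 1) \<Longrightarrow>
      expectation (\<lambda>\<omega>. \<Prod>i\<in>I. enat_power (z i) (count_enat J U (B i) \<omega>))
      = (\<Prod>i\<in>I. if emeasure N (B i) = \<infinity> then 0 else exp (- (1 - z i) * measure N (B i)))"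
  shows "poisson_point_process N M J U"
proof -
  let ?c = "count_enat J U"
  have joint: "prob {\<omega> \<in> space M. \<forall>i\<in>I. ?c (B i) \<omega> = enat (k i)} = (\<Prod>i\<in>I. poisson_weight N (B i) (k i))"
    if "finite I" "\<And>i. i \<in> I \<Longrightarrow> B i \<in> sets N" "disjoint_family_on B I" for I :: "nat set" and B k
  proof (rule joint_pgf_coefficients[where q = "\<lambda>i. poisson_weight N (B i)"])
    show "expectation (\<lambda>\<omega>. \<Prod>i\<in>I. enat_power (z i) (?c (B i) \<omega>))
      = (\<Prod>i\<in>I. \<Sum>k. poisson_weight N (B i) k * z i ^ k)"
      if "\<And>i. 0 < z i \<and> z i < 1" for z
      using pgf[OF \<open>finite I\<close> \<open>\<And>i. i \<in> I \<Longrightarrow> B i \<in> sets N\<close> \<open>disjoint_family_on B I\<close> that]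
      by (simp add: sums_unique[OF poisson_weight_pgf, symmetric])
    show "0 \<le> (\<Sum>k. poisson_weight N (B i) k * z ^ k) \<and> (\<Sum>k. poisson_weight N (B i) k * z ^ k) \<le> 1"
      if "0 < z" "z < 1" for i and z :: real
      using that by (simp add: sums_unique[OF poisson_weight_pgf, symmetric] mult_nonpos_nonneg)
  qed (use that meas in \<open>auto simp: poisson_weight_bounds\<close>)
  have single: "prob {\<omega> \<in> space M. ?c B \<omega> = enat k} = poisson_weight N B k"
    if "B \<in> sets N" for B k
    using joint[of "{0}" "\<lambda>_. B" "\<lambda>_. k"] that by (simp add: disjoint_family_on_def)
  have ev: "{\<omega> \<in> space M. ?c B \<omega> = x} \<in> events" if "B \<in> sets N" for B x
    using measurable_sets[OF meas[OF that], of "{x}"] by (simp add: vimage_def Int_def conj_commute)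
  have "AE \<omega> in M. point_count J U B \<omega> = \<infinity>" if B: "B \<in> sets N" "emeasure N B = \<infinity>" for B
  proof -
    have "AE \<omega> in M. ?c B \<omega> \<noteq> enat k" for k
    proof -
      have "prob {\<omega> \<in> space M. ?c B \<omega> = enat k} = 0"
        using single[OF B(1)] B(2) by (simp add: poisson_weight_def)
      then show ?thesis
        using AE_iff_measurable[OF ev[OF B(1)], of "\<lambda>\<omega>. ?c B \<omega> \<noteq> enat k"]
        by (simp add: emeasure_eq_measure)
    qed
    then have "AE \<omega> in M. \<forall>k. ?c B \<omega> \<noteq> enat k" unfolding AE_all_countable by blast
    then show ?thesis
      by eventually_elim (simp add: point_count_eq)
  qed
  moreover have "indep_vars (\<lambda>_. borel) (\<lambda>i. point_count J U (A i)) {..<n}"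
    if A: "\<forall>i<n. A i \<in> sets N" "disjoint_family_on A {..<n}" for n :: nat and A
  proof (cases "n = 0")
    case True
    then show ?thesis by (simp add: indep_vars_def indep_sets_def)
  next
    case False
    let ?E = "{{}, UNIV} \<union> range (\<lambda>k. {enat k})"
    have "indep_vars (\<lambda>_. count_space UNIV) (\<lambda>i. ?c (A i)) {..<n}"
    proof (subst indep_vars_finite[where E = "\<lambda>_. ?E"])
      have "sigma_sets UNIV ?E = UNIV"
      proof (intro set_eqI iffI UNIV_I)
        fix S :: "enat set"
        have s: "{x} \<in> sigma_sets UNIV ?E" for x
        proof (cases x)
          case infinity
          have "(\<Union>k. {enat k}) \<in> sigma_sets UNIV ?E" by (intro sigma_sets.Union) auto
          then have "UNIV - (\<Union>k. {enat k}) \<in> sigma_sets UNIV ?E" by (rule sigma_sets.Compl)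
          moreover have "UNIV - (\<Union>k. {enat k}) = {x}" using infinity by (auto simp: not_enat_eq)
          ultimately show ?thesis by simp
        qed auto
        interpret sigma_algebra UNIV "sigma_sets UNIV ?E" by (rule sigma_algebra_sigma_sets) auto
        have "(\<Union>x\<in>S. {x}) \<in> sigma_sets UNIV ?E" using s by (intro countable_UN') auto
        then show "S \<in> sigma_sets UNIV ?E" by simp
      qed
      then show "sets (count_space UNIV) = sigma_sets (space (count_space UNIV)) ?E" by simp
      show "Int_stable ?E" by (auto simp: Int_stable_def)
      show "\<forall>S\<in>{..<n} \<rightarrow> ?E. prob (\<Inter>j\<in>{..<n}. ?c (A j) -` S j \<inter> space M)
        = (\<Prod>j\<in>{..<n}. prob (?c (A j) -` S j \<inter> space M))"
      proof
        fix S assume S: "S \<in> {..<n} \<rightarrow> ?E"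
        show "prob (\<Inter>j\<in>{..<n}. ?c (A j) -` S j \<inter> space M)
          = (\<Prod>j\<in>{..<n}. prob (?c (A j) -` S j \<inter> space M))"
        proof (cases "\<exists>j<n. S j = {}")
          case True
          then obtain j where j: "j < n" "S j = {}" by auto
          then have "(\<Inter>j\<in>{..<n}. ?c (A j) -` S j \<inter> space M) = {}" by auto
          moreover have "(\<Prod>j\<in>{..<n}. prob (?c (A j) -` S j \<inter> space M)) = 0"
            using j by (intro prod_zero bexI[of _ j]) auto
          ultimately show ?thesis by simp
        next
          case ne: False
          define I where "I = {j. j < n \<and> S j \<noteq> UNIV}"
          have "\<exists>k. S j = {enat k}" if "j \<in> I" for j
          proof -
            have "S j \<in> ?E" using S that by (auto simp: I_def)
            then show ?thesis using ne that by (auto simp: I_def)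
          qed
          then obtain k where k: "\<And>j. j \<in> I \<Longrightarrow> S j = {enat (k j)}" by metis
          have I: "finite I" "I \<subseteq> {..<n}" by (auto simp: I_def)
          have "(\<Inter>j\<in>{..<n}. ?c (A j) -` S j \<inter> space M)
            = {\<omega> \<in> space M. \<forall>i\<in>I. ?c (A i) \<omega> = enat (k i)}"
          proof (intro set_eqI iffI)
            fix \<omega> assume w: "\<omega> \<in> (\<Inter>j\<in>{..<n}. ?c (A j) -` S j \<inter> space M)"
            then have "\<omega> \<in> space M" using INT_D[OF w, of 0] \<open>n \<noteq> 0\<close> by simp
            moreover have "?c (A i) \<omega> = enat (k i)" if "i \<in> I" for i
              using INT_D[OF w, of i] k[OF that] that I(2) by auto
            ultimately show "\<omega> \<in> {\<omega> \<in> space M. \<forall>i\<in>I. ?c (A i) \<omega> = enat (k i)}" by simp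
          next
            fix \<omega> assume w: "\<omega> \<in> {\<omega> \<in> space M. \<forall>i\<in>I. ?c (A i) \<omega> = enat (k i)}"
            have "?c (A j) \<omega> \<in> S j" if "j < n" for j
              using w k[of j] that by (cases "j \<in> I") (auto simp: I_def)
            then show "\<omega> \<in> (\<Inter>j\<in>{..<n}. ?c (A j) -` S j \<inter> space M)" using w by auto
          qed
          then have "prob (\<Inter>j\<in>{..<n}. ?c (A j) -` S j \<inter> space M)
              = (\<Prod>i\<in>I. poisson_weight N (A i) (k i))"
            using joint[OF I(1), of A k] A I disjoint_family_on_mono[OF I(2) A(2)] by auto
          also have "\<dots> = (\<Prod>i\<in>I. prob (?c (A i) -` S i \<inter> space M))"
          proof (intro prod.cong refl)
            fix i assume "i \<in> I"
            have "?c (A i) -` S i \<inter> space M = {\<omega> \<in> space M. ?c (A i) \<omega> = enat (k i)}"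
              using k[OF \<open>i \<in> I\<close>] by auto
            then show "poisson_weight N (A i) (k i) = prob (?c (A i) -` S i \<inter> space M)"
              using single[of "A i" "k i"] A I \<open>i \<in> I\<close> by auto
          qed
          also have "\<dots> = (\<Prod>j\<in>{..<n}. prob (?c (A j) -` S j \<inter> space M))"
            using I by (intro prod.mono_neutral_left) (auto simp: I_def prob_space)
          finally show ?thesis .
        qed
      qed
    qed (use False A meas in auto)
    from indep_vars_compose2[OF this, of "\<lambda>_. ennreal_of_enat" "\<lambda>_. borel"]
    show ?thesis by (simp add: point_count_eq[abs_def])
  qed
  moreover have "point_count J U B \<in> borel_measurable M" if "B \<in> sets N" for B
    unfolding point_count_eq[abs_def] by (rule measurable_compose[OF meas[OF that]]) simp
  moreover have "prob {\<omega> \<in> space M. point_count J U B \<omega> = of_nat k}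
      = measure N B ^ k / fact k * exp (- measure N B)"
    if B: "B \<in> sets N" "emeasure N B < \<infinity>" for B k
  proof -
    have "point_count J U B \<omega> = of_nat k \<longleftrightarrow> ?c B \<omega> = enat k" for \<omega>
      unfolding point_count_eq ennreal_of_enat_enat[symmetric] by (simp only: ennreal_of_enat_inj)
    then show ?thesis using single[OF B(1), of k] B(2) by (simp add: poisson_weight_def less_top)
  qed
  ultimately show ?thesis
    unfolding poisson_point_process_def using U prob_space_axioms by (intro conjI) auto
qed

section \<open>Construction of a Poisson process\<close>

lemma indep_vars_PiM_coordinates:
  assumes "\<And>i. prob_space (L i)"
  shows "prob_space.indep_vars (PiM UNIV L) L (\<lambda>i \<omega>. \<omega> i) UNIV"
proof -
  interpret P: prob_space "PiM UNIV L" by (rule prob_space_PiM) (rule assms)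
  show ?thesis
    by (subst P.indep_vars_iff_distr_eq_PiM')
       (auto simp: distr_PiM_component assms restrict_UNIV)
qed

text \<open>Conditioning on the Poisson number \<open>N\<close> of factors leaves the exponential series in \<open>c m\<close>.\<close>

lemma (in prob_space) random_product_expectation:
  fixes N :: "'a \<Rightarrow> nat" and h :: "nat \<Rightarrow> 'a \<Rightarrow> real"
  assumes N [measurable]: "N \<in> measurable M (count_space UNIV)"
    and h [measurable]: "\<And>j. h j \<in> borel_measurable M" and h01: "\<And>j \<omega>. 0 \<le> h j \<omega> \<and> h j \<omega> \<le> 1"
    and ind: "\<And>n. expectation (\<lambda>\<omega>. indicator {n} (N \<omega>) * (\<Prod>j<n. h j \<omega>)) = (c ^ n / fact n * exp (- c)) * m ^ n"
  shows "expectation (\<lambda>\<omega>. \<Prod>j<N \<omega>. h j \<omega>) = exp (- c * (1 - m))"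
proof -
  let ?f = "\<lambda>n \<omega>. indicator {n} (N \<omega>) * (\<Prod>j<n. h j \<omega>) :: real"
  have p01: "0 \<le> (\<Prod>j<n. h j \<omega>) \<and> (\<Prod>j<n. h j \<omega>) \<le> 1" for n \<omega>
    using h01 by (auto intro!: prod_nonneg prod_le_1)
  have int: "integrable M (?f n)" for n
    by (rule integrable_const_bound[of _ 1]) (use p01 in \<open>auto simp: indicator_def\<close>)
  have s: "(\<lambda>n. ?f n \<omega>) sums (\<Prod>j<N \<omega>. h j \<omega>)" for \<omega>
  proof -
    have "(\<lambda>n. ?f n \<omega>) = (\<lambda>n. if n = N \<omega> then \<Prod>j<n. h j \<omega> else 0)" by (auto simp: indicator_def)
    then show ?thesis using sums_single[of "N \<omega>" "\<lambda>n. \<Prod>j<n. h j \<omega>"] by simp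
  qed
  have e: "(\<lambda>n. exp (- c) * ((c * m) ^ n /\<^sub>R fact n)) sums (exp (- c) * exp (c * m))"
    by (intro sums_mult exp_converges)
  have ee: "exp (- c) * ((c * m) ^ n /\<^sub>R fact n) = (c ^ n / fact n * exp (- c)) * m ^ n" for n
    by (simp add: power_mult_distrib field_simps)
  have "(\<lambda>n. expectation (?f n)) sums (expectation (\<lambda>\<omega>. \<Sum>n. ?f n \<omega>))"
  proof (rule sums_integral[OF int])
    show "AE \<omega> in M. summable (\<lambda>n. norm (?f n \<omega>))"
      using sums_summable[OF s] p01 by simp
    have "expectation (\<lambda>\<omega>. norm (?f n \<omega>)) = exp (- c) * ((c * m) ^ n /\<^sub>R fact n)" for n
      using p01 unfolding ee ind[symmetric] by (intro Bochner_Integration.integral_cong) auto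
    then show "summable (\<lambda>n. expectation (\<lambda>\<omega>. norm (?f n \<omega>)))"
      using sums_summable[OF e] by simp
  qed
  then have "(\<lambda>n. exp (- c) * ((c * m) ^ n /\<^sub>R fact n)) sums expectation (\<lambda>\<omega>. \<Prod>j<N \<omega>. h j \<omega>)"
    unfolding ind ee sums_unique[OF s, symmetric] .
  then have "expectation (\<lambda>\<omega>. \<Prod>j<N \<omega>. h j \<omega>) = exp (- c) * exp (c * m)"
    using e sums_unique2 by blast
  also have "\<dots> = exp (- c * (1 - m))" by (simp add: exp_add[symmetric] algebra_simps)
  finally show ?thesis .
qed


lemma prob_space_embed_measure:
  assumes "prob_space N" "inj f" shows "prob_space (embed_measure N f)"
  by (subst embed_measure_eq_distr[OF assms(2)])
    (rule prob_space.prob_space_distr[OF assms(1) measurable_embed_measure2[OF assms(2)]])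

lemma measurable_the_embed: "the \<in> measurable (embed_measure N Some) N"
  by (rule measurable_embed_measure1) simp

lemma distr_PiM_embed_Some:
  assumes "\<And>i. prob_space (b i)"
  shows "distr (PiM UNIV (\<lambda>i. embed_measure (b i) Some)) (b i) (\<lambda>\<omega>. the (\<omega> i)) = b i"
proof -
  let ?L = "\<lambda>i. embed_measure (b i) Some"
  have L: "prob_space (?L i)" for i by (rule prob_space_embed_measure[OF assms]) simp
  have "distr (PiM UNIV ?L) (b i) (\<lambda>\<omega>. the (\<omega> i)) = distr (distr (PiM UNIV ?L) (?L i) (\<lambda>\<omega>. \<omega> i)) (b i) the"
    by (subst distr_distr[OF measurable_the_embed]) (auto simp: comp_def)
  also have "distr (PiM UNIV ?L) (?L i) (\<lambda>\<omega>. \<omega> i) = ?L i"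
    by (rule distr_PiM_component) (auto intro: L)
  also have "distr (?L i) (b i) the = distr (distr (b i) (?L i) Some) (b i) the"
    by (subst (1) embed_measure_eq_distr) simp_all
  also have "\<dots> = distr (b i) (b i) (\<lambda>x. x)"
    by (subst distr_distr[OF measurable_the_embed measurable_embed_measure2]) (auto simp: comp_def)
  finally show ?thesis by simp
qed

text \<open>Counting only the points of the first \<open>K\<close> blocks; the counts stabilise or tend to infinity.\<close>

lemma power_card_tendsto_enat_power:
  fixes N :: "nat set" and r :: "nat \<Rightarrow> nat"
  assumes fin: "\<And>K. finite {i \<in> N. r i < K}" and z: "0 < z" "z < 1"
  shows "(\<lambda>K. z ^ card {i \<in> N. r i < K}) \<longlonglongrightarrow> enat_power z (if finite N then enat (card N) else \<infinity>)"
proof (cases "finite N")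
  case True
  then obtain K0 where K0: "\<And>i. i \<in> N \<Longrightarrow> r i < K0"
    by (metis finite_imageI finite_nat_set_iff_bounded imageI)
  have "eventually (\<lambda>K. z ^ card {i \<in> N. r i < K} = z ^ card N) sequentially"
    using eventually_ge_at_top[of K0]
  proof eventually_elim
    case (elim K)
    then have "{i \<in> N. r i < K} = N" using K0 by fastforce
    then show ?case by simp
  qed
  then show ?thesis using True by (auto simp: enat_power_def intro: tendsto_eventually)
next
  case False
  have "filterlim (\<lambda>K. card {i \<in> N. r i < K}) at_top sequentially"
    unfolding filterlim_at_top
  proof
    fix n
    obtain F where F: "F \<subseteq> N" "finite F" "card F = n"
      using infinite_arbitrarily_large[OF False] by blast
    then obtain K0 where K0: "\<And>i. i \<in> F \<Longrightarrow> r i < K0"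
      by (metis finite_imageI finite_nat_set_iff_bounded imageI)
    show "eventually (\<lambda>K. n \<le> card {i \<in> N. r i < K}) sequentially"
      using eventually_ge_at_top[of K0]
    proof eventually_elim
      case (elim K)
      then have "F \<subseteq> {i \<in> N. r i < K}" using K0 F(1) by fastforce
      then show ?case using card_mono[OF fin] F(3) by metis
    qed
  qed
  moreover have "(\<lambda>n. z ^ n) \<longlonglongrightarrow> 0" using z by (intro LIMSEQ_realpow_zero) auto
  ultimately have "(\<lambda>K. z ^ card {i \<in> N. r i < K}) \<longlonglongrightarrow> 0"
    using filterlim_compose by blast
  then show ?thesis using False by (simp add: enat_power_def)
qed

lemma exp_partial_masses_tendsto:
  assumes S: "range S \<subseteq> sets M" "(\<Union>k. S k) = space M" "\<And>k. emeasure M (S k) \<noteq> \<infinity>" "disjoint_family S"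
    and B: "B \<in> sets M" and y: "0 < y"
  shows "(\<lambda>K. exp (- y * (\<Sum>k<K. measure M (B \<inter> S k)))) \<longlonglongrightarrow>
    (if emeasure M B = \<infinity> then 0 else exp (- y * measure M B))"
proof -
  let ?s = "\<lambda>K. \<Sum>k<K. measure M (B \<inter> S k)"
  have Bk: "emeasure M (B \<inter> S k) = ennreal (measure M (B \<inter> S k))" for k
  proof -
    have "emeasure M (B \<inter> S k) \<le> emeasure M (S k)" using S(1) by (intro emeasure_mono) auto
    then show ?thesis using S(3)[of k] by (intro emeasure_eq_ennreal_measure) (auto simp: top_unique)
  qed
  have U: "(\<Union>k. B \<inter> S k) = B" using S(2) sets.sets_into_space[OF B] by auto
  have "(\<lambda>k. emeasure M (B \<inter> S k)) sums emeasure M (\<Union>k. B \<inter> S k)"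
    unfolding sums_def
    using S(1,4) B suminf_emeasure[of "\<lambda>k. B \<inter> S k" M]
    by (subst suminf_emeasure[symmetric])
       (auto simp: disjoint_family_on_def intro!: summable_LIMSEQ)
  then have lim: "(\<lambda>K. ennreal (?s K)) \<longlonglongrightarrow> emeasure M B"
    unfolding U sums_def Bk by (simp add: sum_ennreal)
  show ?thesis
  proof (cases "emeasure M B = \<infinity>")
    case False
    have nn: "0 \<le> ?s K" for K by (intro sum_nonneg) auto
    have "?s \<longlonglongrightarrow> measure M B"
      using lim tendsto_enn2real[of "\<lambda>K. ennreal (?s K)" "measure M B" sequentially] False nn
      by (simp add: emeasure_eq_ennreal_measure)
    then show ?thesis using False by (auto intro!: tendsto_intros)
  next
    case True
    have "filterlim ?s at_top sequentially"
      unfolding filterlim_at_top_dense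
    proof
      fix C :: real
      have "eventually (\<lambda>K. ennreal C < ennreal (?s K)) sequentially"
        using order_tendstoD(1)[OF lim, of "ennreal C"] True by simp
      then show "eventually (\<lambda>K. C < ?s K) sequentially"
        by eventually_elim (metis ennreal_leI linorder_not_le)
    qed
    then have "filterlim (\<lambda>K. y * ?s K) at_top sequentially"
      using y by (intro filterlim_tendsto_pos_mult_at_top[OF tendsto_const]) auto
    then have "(\<lambda>K. exp (- (y * ?s K))) \<longlonglongrightarrow> 0"
      by (intro filterlim_compose[OF exp_at_bot]) (simp add: filterlim_uminus_at_top[symmetric])
    then show ?thesis using True by simp
  qed
qed


lemma exists_poisson_number_law:
  assumes "0 \<le> c"
  shows "\<exists>N :: real measure. prob_space N \<and> sets N = sets borel \<and>
    (\<forall>n. measure N {x. nat \<lfloor>x\<rfloor> = n} = c ^ n / fact n * exp (- c))"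
proof (cases "c = 0")
  case True
  have "prob_space (return borel (0::real))" by (intro prob_space_return) simp
  moreover have "measure (return borel (0::real)) {x. nat \<lfloor>x\<rfloor> = n} = c ^ n / fact n * exp (- c)" for n
  proof -
    have "{x::real. nat \<lfloor>x\<rfloor> = n} \<in> sets borel" by measurable
    then show ?thesis using True by (subst measure_return) (auto simp: indicator_def power_0_left)
  qed
  ultimately show ?thesis by (intro exI[of _ "return borel 0"]) simp
next
  case False
  then have c: "0 < c" using assms by simp
  let ?N = "distr (measure_pmf (poisson_pmf c)) borel real"
  have "measure ?N {x. nat \<lfloor>x\<rfloor> = n} = c ^ n / fact n * exp (- c)" for n
  proof -
    have "{x::real. nat \<lfloor>x\<rfloor> = n} \<in> sets borel" by measurable
    moreover have "real -` {x. nat \<lfloor>x\<rfloor> = n} = {n}" by auto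
    ultimately show ?thesis using c by (subst measure_distr) (auto simp: measure_pmf_single)
  qed
  moreover have "prob_space ?N" by (intro measure_pmf.prob_space_distr) simp
  ultimately show ?thesis by (intro exI[of _ ?N]) simp
qed

text \<open>For a null set \<open>S\<close> any probability measure will do, as the block then almost surely has no point.\<close>

lemma exists_normalized_restriction:
  assumes S: "S \<in> sets M" "emeasure M S \<noteq> \<infinity>" and x: "x \<in> space M"
  shows "\<exists>N. prob_space N \<and> sets N = sets M \<and>
    (\<forall>B\<in>sets M. measure M S * measure N B = measure M (B \<inter> S))"
proof (cases "measure M S = 0")
  case True
  have "measure M (B \<inter> S) = 0" if "B \<in> sets M" for B
  proof -
    have "emeasure M (B \<inter> S) \<le> emeasure M S" using S that by (intro emeasure_mono) auto
    also have "emeasure M S = 0" using True S by (simp add: emeasure_eq_ennreal_measure)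
    finally show ?thesis by (simp add: measure_def)
  qed
  then show ?thesis using True x
    by (intro exI[of _ "return M x"]) (simp add: prob_space_return)
next
  case False
  have e: "emeasure M S \<noteq> 0" using False by (auto simp: measure_def)
  have "measure M S * measure (uniform_measure M S) B = measure M (B \<inter> S)" if "B \<in> sets M" for B
    using e S that False by (subst measure_uniform_measure) (auto simp: Int_commute)
  then show ?thesis using e S
    by (intro exI[of _ "uniform_measure M S"]) (simp add: prob_space_uniform_measure)
qed

text \<open>All variables of the construction are coordinates of one sequence of independent real numbers,
  wrapped by \<open>Some\<close>: index \<open>(k, 0)\<close> holds the number of points in block \<open>k\<close> and index \<open>(k, j + 1)\<close> the
  position of its candidate point \<open>j\<close>.\<close>

lemma exists_poisson_point_process:
  fixes M :: "real measure"
  assumes "sigma_finite_measure M" and x: "x \<in> space M"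
  shows "\<exists>(Q :: (nat \<Rightarrow> real option) measure) J U. poisson_point_process M Q J U"
proof -
  interpret sigma_finite_measure M by fact
  obtain S :: "nat \<Rightarrow> real set" where S: "range S \<subseteq> sets M" "(\<Union>k. S k) = space M" "\<And>k. emeasure M (S k) \<noteq> \<infinity>" "disjoint_family S"
    using sigma_finite_disjoint by blast
  define c where "c k = measure M (S k)" for k
  have "\<forall>k. \<exists>N :: real measure. prob_space N \<and> sets N = sets borel \<and>
    (\<forall>n. measure N {x. nat \<lfloor>x\<rfloor> = n} = c k ^ n / fact n * exp (- c k))"
    using exists_poisson_number_law by (simp add: c_def)
  then obtain num :: "nat \<Rightarrow> real measure" where num: "\<And>k. prob_space (num k)" "\<And>k. sets (num k) = sets borel"
    "\<And>k n. measure (num k) {x. nat \<lfloor>x\<rfloor> = n} = c k ^ n / fact n * exp (- c k)" by metis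
  have "\<forall>k. \<exists>N. prob_space N \<and> sets N = sets M \<and> (\<forall>B\<in>sets M. c k * measure N B = measure M (B \<inter> S k))"
    unfolding c_def using S x by (intro allI exists_normalized_restriction) auto
  then obtain pos where pos: "\<And>k. prob_space (pos k)" "\<And>k. sets (pos k) = sets M"
    "\<And>k B. B \<in> sets M \<Longrightarrow> c k * measure (pos k) B = measure M (B \<inter> S k)" by metis
  \<comment> \<open>The law of coordinate \<open>i\<close>: a number of points or the position of a point.\<close>
  define b where "b i = (case prod_decode i of (k, j) \<Rightarrow> if j = 0 then num k else pos k)" for i
  have b: "prob_space (b i)" for i using num pos by (auto simp: b_def split: prod.split)
  have b_num: "b (prod_encode (k, 0)) = num k" and b_pos: "b (prod_encode (k, Suc j)) = pos k" for k j
    by (simp_all add: b_def)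
  define L where "L i = embed_measure (b i) Some" for i
  have L: "prob_space (L i)" for i unfolding L_def by (rule prob_space_embed_measure[OF b]) simp
  define Q where "Q = PiM (UNIV :: nat set) L"
  interpret Q: prob_space Q unfolding Q_def by (rule prob_space_PiM) (rule L)
  have co: "(\<lambda>\<omega>. \<omega> i) \<in> measurable Q (L i)" for i unfolding Q_def by measurable
  have the_i: "(\<lambda>\<omega>. the (\<omega> i)) \<in> measurable Q (b i)" for i
    using measurable_compose[OF co measurable_the_embed[of "b i", folded L_def]] .
  have law: "distr Q (b i) (\<lambda>\<omega>. the (\<omega> i)) = b i" for i
    unfolding Q_def L_def by (rule distr_PiM_embed_Some[OF b])
  have indep: "Q.indep_vars L (\<lambda>i \<omega>. \<omega> i) UNIV"
    unfolding Q_def by (rule indep_vars_PiM_coordinates[OF L])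
  define cnt where "cnt k \<omega> = nat \<lfloor>the (\<omega> (prod_encode (k, 0)))\<rfloor>" for k and \<omega> :: "nat \<Rightarrow> real option"
  define pt where "pt k j \<omega> = the (\<omega> (prod_encode (k, Suc j)))" for k j and \<omega> :: "nat \<Rightarrow> real option"
  have cnt [measurable]: "cnt k \<in> measurable Q (count_space UNIV)" for k
    unfolding cnt_def using the_i[of "prod_encode (k, 0)", unfolded b_num measurable_cong_sets[OF refl num(2)]]
    by measurable
  have pt [measurable]: "pt k j \<in> measurable Q M" for k j
    unfolding pt_def using the_i[of "prod_encode (k, Suc j)"] 
    unfolding b_pos measurable_cong_sets[OF refl pos(2)] .

  have block: "Q.expectation (\<lambda>\<omega>. \<Prod>j<cnt k \<omega>. g (pt k j \<omega>)) = exp (- c k * (1 - integral\<^sup>L (pos k) g))"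
    if g [measurable]: "g \<in> borel_measurable M" and g01: "\<And>x. 0 \<le> g x \<and> g x \<le> 1" for k g
  proof (rule Q.random_product_expectation)
    fix n
    let ?h = "\<lambda>i. case snd (prod_decode i) of 0 \<Rightarrow> (\<lambda>u. indicator {n} (nat \<lfloor>u\<rfloor>)) | Suc j \<Rightarrow> g"
    let ?X = "\<lambda>i \<omega>. ?h i (the (\<omega> i)) :: real"
    let ?I = "(\<lambda>j. prod_encode (k, j)) ` {..n}"
    have h: "?h i \<in> borel_measurable (b i)" for i
    proof (cases "snd (prod_decode i)")
      case 0
      have "(\<lambda>u::real. indicator {n} (nat \<lfloor>u\<rfloor>) :: real) \<in> borel_measurable borel" by measurable
      then show ?thesis using 0 num(2)
        by (auto simp: b_def measurable_cong_sets[OF num(2) refl] split: prod.split)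
    next
      case (Suc j)
      then show ?thesis using g
        by (auto simp: b_def measurable_cong_sets[OF pos(2) refl] split: prod.split)
    qed
    have X: "Q.expectation (?X i) = integral\<^sup>L (b i) (?h i)" for i
      by (rule integral_distr[OF the_i[of i] h[of i], unfolded law, symmetric])
    have "Q.indep_vars (\<lambda>_. borel) ?X ?I"
      using Q.indep_vars_compose2[OF Q.indep_vars_subset[OF indep, of ?I], of "\<lambda>i x. ?h i (the x)" "\<lambda>_. borel"]
        measurable_compose[OF measurable_the_embed h, folded L_def] by simp
    moreover have "integrable Q (?X i)" for i
      by (rule Q.integrable_const_bound[of _ 1])
         (use g01 measurable_compose[OF the_i h] in \<open>auto split: nat.split simp: indicator_def\<close>)
    ultimately have "Q.expectation (\<lambda>\<omega>. \<Prod>i\<in>?I. ?X i \<omega>) = (\<Prod>i\<in>?I. integral\<^sup>L (b i) (?h i))"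
      by (subst Q.indep_vars_lebesgue_integral) (auto simp: X)
    moreover have "(\<Prod>i\<in>?I. F i) = F (prod_encode (k, 0)) * (\<Prod>j<n. F (prod_encode (k, Suc j)))" for F :: "nat \<Rightarrow> real"
    proof -
      have "(\<Prod>i\<in>?I. F i) = (\<Prod>j<Suc n. F (prod_encode (k, j)))"
        by (subst prod.reindex) (auto simp: inj_on_def lessThan_Suc_atMost simp del: prod.lessThan_Suc)
      then show ?thesis by (simp only: prod.lessThan_Suc_shift comp_def)
    qed
    moreover have "integral\<^sup>L (num k) (\<lambda>u. indicator {n} (nat \<lfloor>u\<rfloor>)) = c k ^ n / fact n * exp (- c k)"
    proof -
      have b0: "{u::real. nat \<lfloor>u\<rfloor> = n} \<in> sets borel" by measurable
      have "integral\<^sup>L (num k) (\<lambda>u. indicator {n} (nat \<lfloor>u\<rfloor>) :: real) = integral\<^sup>L (num k) (indicator {u. nat \<lfloor>u\<rfloor> = n})"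
        by (rule Bochner_Integration.integral_cong) (auto simp: indicator_def)
      moreover have "{u::real. nat \<lfloor>u\<rfloor> = n} \<in> sets (num k)" using b0 by (simp add: num(2))
      ultimately show ?thesis using num(3) sets_eq_imp_space_eq[OF num(2)] by simp
    qed
    ultimately show "Q.expectation (\<lambda>\<omega>. indicator {n} (cnt k \<omega>) * (\<Prod>j<n. g (pt k j \<omega>)))
      = (c k ^ n / fact n * exp (- c k)) * integral\<^sup>L (pos k) g ^ n"
      by (simp add: b_num b_pos cnt_def pt_def)
  qed (use g01 measurable_compose[OF pt g] in auto)

  have blocks: "Q.expectation (\<lambda>\<omega>. \<Prod>k<K. \<Prod>j<cnt k \<omega>. g (pt k j \<omega>))
      = (\<Prod>k<K. exp (- c k * (1 - integral\<^sup>L (pos k) g)))"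
    if g [measurable]: "g \<in> borel_measurable M" and g01: "\<And>x. 0 \<le> g x \<and> g x \<le> 1" for K g
  proof -
    let ?B = "\<lambda>k. range (\<lambda>j. prod_encode (k, j))"
    let ?F = "\<lambda>k \<eta>. \<Prod>j<nat \<lfloor>the (\<eta> (prod_encode (k, 0)))\<rfloor>. g (the (\<eta> (prod_encode (k, Suc j))))"
    have "Q.indep_vars (\<lambda>k. PiM (?B k) L) (\<lambda>k \<omega>. restrict (\<lambda>i. \<omega> i) (?B k)) {..<K}"
      by (rule Q.indep_vars_restrict[OF indep]) (auto simp: disjoint_family_on_def)
    moreover have "?F k \<in> borel_measurable (PiM (?B k) L)" for k
    proof -
      have a: "(\<lambda>\<eta>. the (\<eta> (prod_encode (k, j)))) \<in> measurable (PiM (?B k) L) (b (prod_encode (k, j)))" for j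
      proof -
        have "(\<lambda>\<eta>. \<eta> (prod_encode (k, j))) \<in> measurable (PiM (?B k) L) (L (prod_encode (k, j)))"
          by (rule measurable_component_singleton) auto
        from measurable_compose[OF this measurable_the_embed[of "b (prod_encode (k, j))", folded L_def]]
        show ?thesis .
      qed
      have 0: "(\<lambda>\<eta>. the (\<eta> (prod_encode (k, 0)))) \<in> borel_measurable (PiM (?B k) L)"
        using a[of 0] unfolding b_num measurable_cong_sets[OF refl num(2)] .
      have j: "(\<lambda>\<eta>. the (\<eta> (prod_encode (k, Suc j)))) \<in> measurable (PiM (?B k) L) M" for j
        using a[of "Suc j"] unfolding b_pos measurable_cong_sets[OF refl pos(2)] .
      show ?thesis
      proof (rule measurable_compose_countable[where g = "\<lambda>\<eta>. nat \<lfloor>the (\<eta> (prod_encode (k, 0)))\<rfloor>"])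
        show "(\<lambda>\<eta>. \<Prod>j<n. g (the (\<eta> (prod_encode (k, Suc j))))) \<in> borel_measurable (PiM (?B k) L)" for n
          by (intro borel_measurable_prod measurable_compose[OF j g])
        show "(\<lambda>\<eta>. nat \<lfloor>the (\<eta> (prod_encode (k, 0)))\<rfloor>) \<in> measurable (PiM (?B k) L) (count_space UNIV)"
          using 0 by measurable
      qed
    qed
    ultimately have "Q.indep_vars (\<lambda>_. borel) (\<lambda>k \<omega>. ?F k (restrict (\<lambda>i. \<omega> i) (?B k))) {..<K}"
      using Q.indep_vars_compose2[of "\<lambda>k. PiM (?B k) L" "\<lambda>k \<omega>. restrict (\<lambda>i. \<omega> i) (?B k)" "{..<K}" ?F "\<lambda>_. borel"] by blast
    then have ind: "Q.indep_vars (\<lambda>_. borel) (\<lambda>k \<omega>. \<Prod>j<cnt k \<omega>. g (pt k j \<omega>)) {..<K}"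
      by (simp add: cnt_def[abs_def] pt_def[abs_def])
    have "integrable Q (\<lambda>\<omega>. \<Prod>j<cnt k \<omega>. g (pt k j \<omega>))" if "k < K" for k
    proof (rule Q.integrable_const_bound[of _ 1])
      show "(\<lambda>\<omega>. \<Prod>j<cnt k \<omega>. g (pt k j \<omega>)) \<in> borel_measurable Q"
        using ind that by (auto simp: Q.indep_vars_def)
      have "0 \<le> (\<Prod>j<n. g (pt k j \<omega>)) \<and> (\<Prod>j<n. g (pt k j \<omega>)) \<le> 1" for n \<omega>
        using g01 by (auto intro!: prod_nonneg prod_le_1)
      then show "AE \<omega> in Q. norm (\<Prod>j<cnt k \<omega>. g (pt k j \<omega>)) \<le> 1" by auto
    qed
    then show ?thesis
      by (subst Q.indep_vars_lebesgue_integral[OF _ ind]) (auto simp: block[OF g g01])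
  qed

  define J where "J \<omega> = {i. snd (prod_decode i) < cnt (fst (prod_decode i)) \<omega>}" for \<omega>
  define U where "U i \<omega> = pt (fst (prod_decode i)) (snd (prod_decode i)) \<omega>" for i \<omega>
  have dec: "p = prod_encode (k, j)" if "prod_decode p = (k, j)" for p k j
    using that by (metis prod_decode_inverse)
  let ?N = "\<lambda>B \<omega>. {i \<in> J \<omega>. U i \<omega> \<in> B}"
  have "poisson_point_process M Q J U"
  proof (rule Q.poisson_point_process_if_pgf)
    show "U i \<omega> \<in> space M" if "\<omega> \<in> space Q" "i \<in> J \<omega>" for \<omega> i
      unfolding U_def by (rule measurable_space[OF pt that(1)])
    show "count_enat J U B \<in> measurable Q (count_space UNIV)" if B [measurable]: "B \<in> sets M" for B
    proof -
      have Ni: "{\<omega> \<in> space Q. i \<in> ?N B \<omega>} \<in> sets Q" for i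
        unfolding J_def U_def by measurable
      have eq: "point_count J U B \<omega> = (\<Sum>i. indicator {\<omega> \<in> space Q. i \<in> ?N B \<omega>} \<omega>)" if "\<omega> \<in> space Q" for \<omega>
      proof -
        have "point_count J U B \<omega> = (\<integral>\<^sup>+i. indicator (?N B \<omega>) i \<partial>count_space UNIV)"
          by (simp add: point_count_def)
        also have "\<dots> = (\<Sum>i. indicator (?N B \<omega>) i)" by (rule nn_integral_count_space_nat)
        finally show ?thesis using that by (simp add: indicator_def)
      qed
      have "(\<lambda>\<omega>. \<Sum>i. indicator {\<omega> \<in> space Q. i \<in> ?N B \<omega>} \<omega> :: ennreal) \<in> borel_measurable Q"
        by (intro borel_measurable_suminf_order borel_measurable_indicator Ni)
      then have "point_count J U B \<in> borel_measurable Q"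
        using eq by (rule measurable_cong[THEN iffD2, rotated])
      then have "{\<omega> \<in> space Q. point_count J U B \<omega> = ennreal_of_enat x} \<in> sets Q" for x by measurable
      then have "count_enat J U B -` {x} \<inter> space Q \<in> sets Q" for x
        by (simp add: point_count_eq vimage_def Int_def conj_commute)
      then show ?thesis
        by (subst measurable_count_space_eq2_countable) (auto intro: countableI_type)
    qed
  next
    fix I :: "nat set" and B and z :: "nat \<Rightarrow> real"
    assume I: "finite I" and B: "\<And>i. i \<in> I \<Longrightarrow> B i \<in> sets M" and disj: "disjoint_family_on B I"
      and z: "\<And>i. 0 < z i \<and> z i < 1"
    \<comment> \<open>The generating function of the counts is the expected product of \<open>g\<close> over all points.\<close>
    define g where "g x = (\<Prod>i\<in>I. if x \<in> B i then z i else 1)" for x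
    have z01: "0 \<le> (if x \<in> B i then z i else 1) \<and> (if x \<in> B i then z i else 1) \<le> 1" for x i
      using z[of i] by auto
    have g01: "0 \<le> g x \<and> g x \<le> 1" for x
      unfolding g_def using z01 by (auto intro!: prod_nonneg prod_le_1)
    have gm: "g \<in> borel_measurable M"
      unfolding g_def using B by (intro borel_measurable_prod measurable_If_set) auto
    \<comment> \<open>As the sets are disjoint, at most one factor of \<open>g x\<close> differs from \<open>1\<close>.\<close>
    have g_sum: "g x = 1 - (\<Sum>i\<in>I. (1 - z i) * indicator (B i) x)" for x
    proof (cases "\<exists>i\<in>I. x \<in> B i")
      case True
      then obtain i where i: "i \<in> I" "x \<in> B i" by auto
      have "x \<notin> B j" if "j \<in> I - {i}" for j
        using disj i that by (auto simp: disjoint_family_on_def)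
      then have "g x = z i * 1" "(\<Sum>i\<in>I. (1 - z i) * indicator (B i) x) = (1 - z i) * 1 + 0"
        unfolding g_def using i I
        by (auto simp: prod.remove[OF I i(1)] sum.remove[OF I i(1)] intro!: prod.neutral sum.neutral)
      then show ?thesis by simp
    next
      case False
      then show ?thesis by (simp add: g_def)
    qed
    have m: "c k * (1 - integral\<^sup>L (pos k) g) = (\<Sum>i\<in>I. (1 - z i) * measure M (B i \<inter> S k))" for k
    proof -
      interpret p: prob_space "pos k" by (rule pos)
      have Bk: "B i \<in> sets (pos k)" if "i \<in> I" for i using B pos that by auto
      have int: "integrable (pos k) (\<lambda>x. (1 - z i) * indicator (B i) x)" if "i \<in> I" for i
        using Bk[OF that] by (intro integrable_mult_right integrable_real_indicator) (auto simp: p.emeasure_eq_measure)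
      have "integral\<^sup>L (pos k) g = integral\<^sup>L (pos k) (\<lambda>_. 1) - (\<Sum>i\<in>I. integral\<^sup>L (pos k) (\<lambda>x. (1 - z i) * indicator (B i) x))"
        unfolding g_sum[abs_def] using int
        by (subst Bochner_Integration.integral_diff) (auto intro!: Bochner_Integration.integrable_sum Bochner_Integration.integral_sum)
      also have "\<dots> = 1 - (\<Sum>i\<in>I. (1 - z i) * measure (pos k) (B i))"
        using Bk by (auto simp: p.prob_space intro!: sum.cong)
      finally have "integral\<^sup>L (pos k) g = 1 - (\<Sum>i\<in>I. (1 - z i) * measure (pos k) (B i))" .
      then have "c k * (1 - integral\<^sup>L (pos k) g) = (\<Sum>i\<in>I. (1 - z i) * (c k * measure (pos k) (B i)))"
        by (simp add: sum_distrib_left mult_ac)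
      then show ?thesis using pos(3) B by simp
    qed
    let ?P = "\<lambda>K \<omega>. \<Prod>k<K. \<Prod>j<cnt k \<omega>. g (pt k j \<omega>)"
    have P: "?P K \<omega> = (\<Prod>i\<in>I. z i ^ card {p \<in> ?N (B i) \<omega>. fst (prod_decode p) < K})" for K \<omega>
    proof -
      let ?T = "Sigma {..<K} (\<lambda>k. {..<cnt k \<omega>})"
      have "?P K \<omega> = (\<Prod>(k, j)\<in>?T. g (pt k j \<omega>))" by (subst prod.Sigma) auto
      also have "\<dots> = (\<Prod>i\<in>I. \<Prod>(k, j)\<in>?T. if pt k j \<omega> \<in> B i then z i else 1)"
        unfolding g_def by (subst prod.swap) (simp add: case_prod_unfold)
      also have "\<dots> = (\<Prod>i\<in>I. z i ^ card {p \<in> ?N (B i) \<omega>. fst (prod_decode p) < K})"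
      proof (intro prod.cong refl)
        fix i
        have "(\<Prod>(k, j)\<in>?T. if pt k j \<omega> \<in> B i then z i else 1)
          = z i ^ card {p \<in> ?T. pt (fst p) (snd p) \<omega> \<in> B i}"
        proof -
          have "finite ?T" by simp
          then have "(\<Prod>p\<in>?T. if pt (fst p) (snd p) \<omega> \<in> B i then z i else 1)
            = (\<Prod>p\<in>{p \<in> ?T. pt (fst p) (snd p) \<omega> \<in> B i}. z i)" by (rule prod.inter_filter[symmetric])
          then show ?thesis by (simp only: case_prod_unfold prod_constant)
        qed
        also have "card {p \<in> ?T. pt (fst p) (snd p) \<omega> \<in> B i} = card (prod_encode ` {p \<in> ?T. pt (fst p) (snd p) \<omega> \<in> B i})"
          by (intro card_image[symmetric] inj_prod_encode)
        also have "prod_encode ` {p \<in> ?T. pt (fst p) (snd p) \<omega> \<in> B i} = {p \<in> ?N (B i) \<omega>. fst (prod_decode p) < K}"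
        proof (intro equalityI subsetI)
          fix p assume "p \<in> {p \<in> ?N (B i) \<omega>. fst (prod_decode p) < K}"
          then show "p \<in> prod_encode ` {p \<in> ?T. pt (fst p) (snd p) \<omega> \<in> B i}"
            by (cases "prod_decode p", intro image_eqI[of _ _ "prod_decode p"])
               (auto simp: J_def U_def intro: dec)
        qed (auto simp: J_def U_def)
        finally show "(\<Prod>(k, j)\<in>?T. if pt k j \<omega> \<in> B i then z i else 1)
          = z i ^ card {p \<in> ?N (B i) \<omega>. fst (prod_decode p) < K}" .
      qed
      finally show ?thesis .
    qed
    have fin: "finite {p \<in> ?N C \<omega>. fst (prod_decode p) < K}" for C \<omega> K
    proof (rule finite_subset)
      show "{p \<in> ?N C \<omega>. fst (prod_decode p) < K} \<subseteq> prod_encode ` Sigma {..<K} (\<lambda>k. {..<cnt k \<omega>})"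
      proof
        fix p assume "p \<in> {p \<in> ?N C \<omega>. fst (prod_decode p) < K}"
        then show "p \<in> prod_encode ` Sigma {..<K} (\<lambda>k. {..<cnt k \<omega>})"
          by (cases "prod_decode p", intro image_eqI[of _ _ "prod_decode p"])
             (auto simp: J_def intro: dec)
      qed
    qed auto
    have lim: "(\<lambda>K. ?P K \<omega>) \<longlonglongrightarrow> (\<Prod>i\<in>I. enat_power (z i) (count_enat J U (B i) \<omega>))" for \<omega>
      unfolding P count_enat_def Let_def using z by (intro tendsto_prod power_card_tendsto_enat_power fin) auto
    have Pm: "?P K \<in> borel_measurable Q" for K
    proof (intro borel_measurable_prod)
      fix k
      show "(\<lambda>\<omega>. \<Prod>j<cnt k \<omega>. g (pt k j \<omega>)) \<in> borel_measurable Q"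
        by (rule measurable_compose_countable[OF _ cnt[of k]])
           (intro borel_measurable_prod measurable_compose[OF pt gm])
    qed
    have P01: "0 \<le> ?P K \<omega> \<and> ?P K \<omega> \<le> 1" for K \<omega>
      using g01 by (auto intro!: prod_nonneg prod_le_1)
    have "(\<lambda>K. Q.expectation (?P K)) \<longlonglongrightarrow> Q.expectation (\<lambda>\<omega>. \<Prod>i\<in>I. enat_power (z i) (count_enat J U (B i) \<omega>))"
    proof (rule integral_dominated_convergence[where w = "\<lambda>_. 1"])
      show "(\<lambda>\<omega>. \<Prod>i\<in>I. enat_power (z i) (count_enat J U (B i) \<omega>)) \<in> borel_measurable Q"
        by (rule borel_measurable_LIMSEQ_real[OF lim Pm])
      show "AE \<omega> in Q. norm (?P K \<omega>) \<le> 1" for K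
      proof (rule AE_I2)
        fix \<omega>
        show "norm (?P K \<omega>) \<le> 1" using P01[of \<omega> K] by simp
      qed
    qed (use Pm lim in auto)
    moreover have "Q.expectation (?P K) = (\<Prod>i\<in>I. exp (- (1 - z i) * (\<Sum>k<K. measure M (B i \<inter> S k))))" for K
    proof -
      have "Q.expectation (?P K) = (\<Prod>k<K. \<Prod>i\<in>I. exp (- (1 - z i) * measure M (B i \<inter> S k)))"
      proof (subst blocks[OF gm g01], intro prod.cong refl)
        fix k
        have "exp (- c k * (1 - integral\<^sup>L (pos k) g)) = exp (\<Sum>i\<in>I. - (1 - z i) * measure M (B i \<inter> S k))"
          using m[of k] by (simp only: mult_minus_left sum_negf)
        then show "exp (- c k * (1 - integral\<^sup>L (pos k) g)) = (\<Prod>i\<in>I. exp (- (1 - z i) * measure M (B i \<inter> S k)))"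
          using I by (simp add: exp_sum)
      qed
      also have "\<dots> = (\<Prod>i\<in>I. exp (- (1 - z i) * (\<Sum>k<K. measure M (B i \<inter> S k))))"
        by (subst prod.swap) (simp add: exp_sum[symmetric] sum_distrib_left)
      finally show ?thesis .
    qed
    moreover have "(\<lambda>K. \<Prod>i\<in>I. exp (- (1 - z i) * (\<Sum>k<K. measure M (B i \<inter> S k))))
      \<longlonglongrightarrow> (\<Prod>i\<in>I. if emeasure M (B i) = \<infinity> then 0 else exp (- (1 - z i) * measure M (B i)))"
      using z B by (intro tendsto_prod exp_partial_masses_tendsto S) auto
    ultimately show "Q.expectation (\<lambda>\<omega>. \<Prod>i\<in>I. enat_power (z i) (count_enat J U (B i) \<omega>))
      = (\<Prod>i\<in>I. if emeasure M (B i) = \<infinity> then 0 else exp (- (1 - z i) * measure M (B i)))"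
      using LIMSEQ_unique by simp
  qed
  then show ?thesis by blast
qed

section \<open>Suprema over a Poisson process\<close>

lemma borel_eq_sigma_atMost_dense_levels:
  assumes "dense_levels D"
  shows "sets (borel :: real measure) = sets (sigma UNIV {{..a} | a. a < 0 \<or> a \<in> D})"
    (is "_ = sets (sigma UNIV ?E)")
proof (rule antisym)
  have "{..a} \<in> sigma_sets UNIV ?E" for a
  proof (cases "a < 0")
    case False
    then obtain d where d: "\<And>n. d n \<in> D" "\<And>n. a < d n" "d \<longlonglongrightarrow> a"
      using dense_levels_sequence[OF assms] by (metis not_less)
    have "{..a} = (\<Inter>n. {..d n})"
    proof (intro equalityI subsetI)
      fix x assume "x \<in> (\<Inter>n. {..d n})"
      then have "x \<le> d n" for n by auto
      then show "x \<in> {..a}" using LIMSEQ_le_const[OF d(3)] by auto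
    next
      fix x assume "x \<in> {..a}"
      then show "x \<in> (\<Inter>n. {..d n})" using d(2) by (auto intro: order_trans less_imp_le)
    qed
    moreover interpret sigma_algebra UNIV "sigma_sets UNIV ?E" by (rule sigma_algebra_sigma_sets) auto
    have "(\<Inter>n. {..d n}) \<in> sigma_sets UNIV ?E" using d(1) by (intro countable_INT) auto
    ultimately show ?thesis by simp
  qed auto
  then show "sets (borel :: real measure) \<subseteq> sets (sigma UNIV ?E)"
    using sigma_sets_mono[of "range (\<lambda>a::real. {..a})" UNIV ?E]
    unfolding borel_eq_atMost by auto
  show "sets (sigma UNIV ?E) \<subseteq> sets (borel :: real measure)"
    by (subst sets_measure_of) (auto intro!: sets.sigma_sets_subset[where a = ?E and M = borel, simplified])
qed

text \<open>The half-lines up to negative levels and up to levels from a dense set of positive ones generate the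
  Borel sets. This choice suits nonnegative processes, whose distribution functions vanish at the
  former and are known at the latter.\<close>

lemma PiM_borel_measure_eqI:
  fixes \<mu> \<nu> :: "('i \<Rightarrow> real) measure"
  assumes F: "finite F" and D: "\<And>t. t \<in> F \<Longrightarrow> dense_levels (D t)"
    and \<mu>: "prob_space \<mu>" "sets \<mu> = sets (PiM F (\<lambda>_. borel))"
    and \<nu>: "sets \<nu> = sets (PiM F (\<lambda>_. borel))"
    and eq: "\<And>a. (\<And>t. t \<in> F \<Longrightarrow> a t < 0 \<or> a t \<in> D t) \<Longrightarrow>
      emeasure \<mu> {x \<in> space (PiM F (\<lambda>_. borel)). \<forall>t\<in>F. x t \<le> a t}
      = emeasure \<nu> {x \<in> space (PiM F (\<lambda>_. borel)). \<forall>t\<in>F. x t \<le> a t}"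
  shows "\<mu> = \<nu>"
proof -
  let ?E = "\<lambda>t. {{..a} | a. a < 0 \<or> a \<in> D t}"
  let ?\<Omega> = "PiE F (\<lambda>_. UNIV :: real set)"
  define G where "G = {{x \<in> ?\<Omega>. \<forall>t\<in>j. x t \<in> A t} | A j. j \<in> {F} \<and> A \<in> Pi j ?E}"
  have "\<exists>d\<in>D t. real n < d" if "t \<in> F" for t n
  proof -
    have "\<exists>d\<in>D t. real n < d \<and> d < real n + 1" using D[OF that] by (simp add: dense_levels_def)
    then show ?thesis by blast
  qed
  then have "\<forall>n. \<forall>t\<in>F. \<exists>d. d \<in> D t \<and> real n < d" by blast
  then have "\<forall>n. \<exists>d. \<forall>t\<in>F. d t \<in> D t \<and> real n < d t" by (intro allI bchoice) blast
  then obtain d where d: "\<And>t n. t \<in> F \<Longrightarrow> d n t \<in> D t \<and> real n < d n t"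
    by (auto dest!: choice)
  have "sets (PiM F (\<lambda>_. borel)) = sets (PiM F (\<lambda>t. sigma UNIV (?E t)))"
    using borel_eq_sigma_atMost_dense_levels D by (intro sets_PiM_cong) auto
  also have "\<dots> = sets (sigma ?\<Omega> G)"
    unfolding G_def
  proof (rule sets_PiM_sigma)
    fix t assume t: "t \<in> F"
    have "(\<Union>n. {..d n t}) = UNIV"
    proof (intro set_eqI iffI UNIV_I)
      fix x
      obtain n where "x < real n" using reals_Archimedean2 by blast
      then show "x \<in> (\<Union>n. {..d n t})" using d[OF t, of n] by (intro UN_I[of n]) auto
    qed
    then show "\<exists>S\<subseteq>?E t. countable S \<and> UNIV = \<Union> S"
      using d[OF t] by (intro exI[of _ "range (\<lambda>n. {..d n t})"]) auto
  qed (use F in auto)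
  finally have sets_eq: "sets (PiM F (\<lambda>_. borel)) = sigma_sets ?\<Omega> G"
    by (subst (asm) sets_measure_of) (auto simp: G_def)
  have G: "\<exists>a. X = {x \<in> ?\<Omega>. \<forall>t\<in>F. x t \<le> a t} \<and> (\<forall>t\<in>F. a t < 0 \<or> a t \<in> D t)" if X: "X \<in> G" for X
  proof -
    obtain A where A: "A \<in> Pi F ?E" "X = {x \<in> ?\<Omega>. \<forall>t\<in>F. x t \<in> A t}" using X by (auto simp: G_def)
    then have "\<forall>t\<in>F. \<exists>a. A t = {..a} \<and> (a < 0 \<or> a \<in> D t)" by (auto simp: Pi_iff)
    then obtain a where "\<forall>t\<in>F. A t = {..a t} \<and> (a t < 0 \<or> a t \<in> D t)" by metis
    then show ?thesis using A(2) by (intro exI[of _ a]) auto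
  qed
  have G': "{x \<in> ?\<Omega>. \<forall>t\<in>F. x t \<le> a t} \<in> G" if "\<And>t. t \<in> F \<Longrightarrow> a t < 0 \<or> a t \<in> D t" for a
    unfolding G_def using that by (auto intro!: exI[of _ "\<lambda>t. {..a t}"])
  have sp: "space (PiM F (\<lambda>_. borel :: real measure)) = ?\<Omega>" by (simp add: space_PiM)
  show ?thesis
  proof (rule measure_eqI_generator_eq[where E = G and \<Omega> = ?\<Omega>])
    show "Int_stable G"
      unfolding Int_stable_def
    proof (intro ballI)
      fix X Y assume X: "X \<in> G" and Y: "Y \<in> G"
      obtain a where a: "X = {x \<in> ?\<Omega>. \<forall>t\<in>F. x t \<le> a t}" "\<forall>t\<in>F. a t < 0 \<or> a t \<in> D t"
        using G[OF X] by auto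
      obtain b where b: "Y = {x \<in> ?\<Omega>. \<forall>t\<in>F. x t \<le> b t}" "\<forall>t\<in>F. b t < 0 \<or> b t \<in> D t"
        using G[OF Y] by auto
      note ab = a b
      have "X \<inter> Y = {x \<in> ?\<Omega>. \<forall>t\<in>F. x t \<le> min (a t) (b t)}" unfolding ab(1,3) by auto
      also have "\<dots> \<in> G" using ab by (intro G') (auto simp: min_def)
      finally show "X \<inter> Y \<in> G" .
    qed
    show "emeasure \<mu> X = emeasure \<nu> X" if "X \<in> G" for X
    proof -
      obtain a where a: "X = {x \<in> ?\<Omega>. \<forall>t\<in>F. x t \<le> a t}" "\<forall>t\<in>F. a t < 0 \<or> a t \<in> D t"
        using G[OF \<open>X \<in> G\<close>] by auto
      show ?thesis using eq[of a] a(2) unfolding sp a(1) by auto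
    qed
    show "range (\<lambda>n. {x \<in> ?\<Omega>. \<forall>t\<in>F. x t \<le> d n t}) \<subseteq> G"
      using d by (intro image_subsetI G') auto
    show "(\<Union>n. {x \<in> ?\<Omega>. \<forall>t\<in>F. x t \<le> d n t}) = ?\<Omega>"
    proof (intro equalityI subsetI)
      fix x assume x: "x \<in> ?\<Omega>"
      obtain n where n: "Max (insert 0 (x ` F)) < real n" using reals_Archimedean2 by blast
      have "x t \<le> d n t" if "t \<in> F" for t
      proof -
        have "x t \<le> Max (insert 0 (x ` F))" using F that by (intro Max_ge) auto
        then show ?thesis using n d[OF that, of n] by linarith
      qed
      then show "x \<in> (\<Union>n. {x \<in> ?\<Omega>. \<forall>t\<in>F. x t \<le> d n t})" using x by blast
    qed auto
    show "emeasure \<mu> {x \<in> ?\<Omega>. \<forall>t\<in>F. x t \<le> d n t} \<noteq> \<infinity>" for n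
      using prob_space.finite_measure[OF \<mu>(1)] by (simp add: finite_measure.emeasure_finite)
  qed (use \<mu> \<nu> sets_eq in \<open>auto simp: G_def\<close>)
qed

context
  fixes M :: "'a measure" and Q :: "'w measure" and J U
  assumes ppp: "poisson_point_process M Q J U"
begin

lemma prob_Q: "prob_space Q" using ppp by (simp add: poisson_point_process_def)

lemma void_events: "B \<in> sets M \<Longrightarrow> {\<omega> \<in> space Q. \<forall>i\<in>J \<omega>. U i \<omega> \<notin> B} \<in> sets Q"
  and void_prob: "B \<in> sets M \<Longrightarrow> emeasure M B < \<infinity> \<Longrightarrow>
    measure Q {\<omega> \<in> space Q. \<forall>i\<in>J \<omega>. U i \<omega> \<notin> B} = exp (- measure M B)"
proof -
  assume B: "B \<in> sets M"
  have eq: "{\<omega> \<in> space Q. \<forall>i\<in>J \<omega>. U i \<omega> \<notin> B} = {\<omega> \<in> space Q. point_count J U B \<omega> = 0}"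
    by (auto simp: point_count_def emeasure_count_space_eq_0)
  have [measurable]: "point_count J U B \<in> borel_measurable Q"
    using B ppp by (simp add: poisson_point_process_def)
  show "{\<omega> \<in> space Q. \<forall>i\<in>J \<omega>. U i \<omega> \<notin> B} \<in> sets Q" unfolding eq by measurable
  assume "emeasure M B < \<infinity>"
  then have "measure Q {\<omega> \<in> space Q. point_count J U B \<omega> = of_nat 0} = measure M B ^ 0 / fact 0 * exp (- measure M B)"
    using B ppp unfolding poisson_point_process_def by blast
  then show "measure Q {\<omega> \<in> space Q. \<forall>i\<in>J \<omega>. U i \<omega> \<notin> B} = exp (- measure M B)"
    unfolding eq by simp
qed

context
  fixes f :: "'a \<Rightarrow> real"
  assumes f: "f \<in> L_vee M" and f_nonneg: "\<And>x. x \<in> space M \<Longrightarrow> 0 \<le> f x"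
begin

lemma exceedance_sets [measurable]: "{x \<in> space M. a < f x} \<in> sets M"
proof -
  have [measurable]: "f \<in> borel_measurable M" using f by (simp add: L_vee_def)
  show ?thesis by measurable
qed

lemma exceedance_finite: "0 < a \<Longrightarrow> emeasure M {x \<in> space M. a < f x} < \<infinity>"
  using f by (simp add: L_vee_def)

lemma point_in_space: "\<omega> \<in> space Q \<Longrightarrow> i \<in> J \<omega> \<Longrightarrow> U i \<omega> \<in> space M"
  using ppp by (simp add: poisson_point_process_def)

text \<open>The real supremum over an unbounded set is a fixed value, so measurability of the supremum has
  to be shown on this event and off it separately.\<close>

definition sup_finite :: "'w \<Rightarrow> bool" where
  "sup_finite \<omega> \<longleftrightarrow> (\<exists>n::nat. \<forall>i\<in>J \<omega>. U i \<omega> \<notin> {x \<in> space M. real n < f x})"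

lemma sup_integral_le_iff:
  assumes w: "\<omega> \<in> space Q" "sup_finite \<omega>"
  shows "sup_integral J U f \<omega> \<le> a \<longleftrightarrow> 0 \<le> a \<and> (\<forall>i\<in>J \<omega>. U i \<omega> \<notin> {x \<in> space M. a < f x})"
proof (cases "J \<omega> = {}")
  case False
  have sp: "U i \<omega> \<in> space M" if "i \<in> J \<omega>" for i using point_in_space[OF w(1) that] .
  obtain n :: nat where "\<forall>i\<in>J \<omega>. f (U i \<omega>) \<le> n"
    using w(2) sp by (fastforce simp: sup_finite_def not_less)
  then have bdd: "bdd_above ((\<lambda>i. f (U i \<omega>)) ` J \<omega>)" by (intro bdd_aboveI2) auto
  have "sup_integral J U f \<omega> \<le> a \<longleftrightarrow> (\<forall>i\<in>J \<omega>. f (U i \<omega>) \<le> a)"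
    using False bdd by (simp add: sup_integral_def cSUP_le_iff)
  moreover have "0 \<le> a" if "\<forall>i\<in>J \<omega>. f (U i \<omega>) \<le> a"
    using that False f_nonneg[OF sp] by (meson ex_in_conv order_trans)
  ultimately show ?thesis using sp by (auto simp: not_less)
qed (simp add: sup_integral_def)

lemma sup_integral_infinite:
  assumes w: "\<omega> \<in> space Q" "\<not> sup_finite \<omega>"
  shows "sup_integral J U f \<omega> = Sup UNIV"
proof -
  have ne: "J \<omega> \<noteq> {}" using w by (auto simp: sup_finite_def)
  have 1: "\<not> (\<forall>x\<in>(\<lambda>i. f (U i \<omega>)) ` J \<omega>. x \<le> z)" for z
  proof
    assume a: "\<forall>x\<in>(\<lambda>i. f (U i \<omega>)) ` J \<omega>. x \<le> z"
    obtain n where "z < real n" using reals_Archimedean2 by blast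
    then have "\<forall>i\<in>J \<omega>. U i \<omega> \<notin> {x \<in> space M. real n < f x}" using a by fastforce
    then show False using w by (auto simp: sup_finite_def)
  qed
  have 2: "\<not> (\<forall>x\<in>UNIV. x \<le> z)" for z :: real by (auto intro!: exI[of _ "z + 1"] simp: not_le)
  have eq: "(\<lambda>z. \<forall>x\<in>(\<lambda>i. f (U i \<omega>)) ` J \<omega>. x \<le> z) = (\<lambda>z. \<forall>x\<in>UNIV. x \<le> z)"
    by (intro ext) (simp only: 1 2)
  have "Sup ((\<lambda>i. f (U i \<omega>)) ` J \<omega>) = Sup UNIV" unfolding Sup_real_def eq ..
  then show ?thesis using ne by (simp add: sup_integral_def)
qed

lemma sup_finite_events: "{\<omega> \<in> space Q. sup_finite \<omega>} \<in> sets Q"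
  unfolding sup_finite_def by (rule sets.sets_Collect_countable_Ex) (rule void_events, measurable)

lemma sup_integral_measurable: "sup_integral J U f \<in> borel_measurable Q"
  unfolding borel_measurable_iff_le
proof
  fix a
  let ?V = "{\<omega> \<in> space Q. \<forall>i\<in>J \<omega>. U i \<omega> \<notin> {x \<in> space M. a < f x}}"
  let ?S = "{\<omega> \<in> space Q. sup_finite \<omega>}"
  have "{\<omega> \<in> space Q. sup_integral J U f \<omega> \<le> a}
    = (if 0 \<le> a then ?V \<inter> ?S else {}) \<union> (if Sup UNIV \<le> a then space Q - ?S else {})"
  proof (intro set_eqI)
    fix \<omega>
    show "\<omega> \<in> {\<omega> \<in> space Q. sup_integral J U f \<omega> \<le> a}
      \<longleftrightarrow> \<omega> \<in> (if 0 \<le> a then ?V \<inter> ?S else {}) \<union> (if Sup UNIV \<le> a then space Q - ?S else {})"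
      using sup_integral_le_iff[of \<omega> a] sup_integral_infinite[of \<omega>]
      by (cases "\<omega> \<in> space Q"; cases "sup_finite \<omega>") auto
  qed
  moreover have "?V \<in> sets Q" by (rule void_events) measurable
  ultimately show "{\<omega> \<in> space Q. sup_integral J U f \<omega> \<le> a} \<in> sets Q"
    using sup_finite_events by auto
qed

lemma AE_sup_finite: "AE \<omega> in Q. sup_finite \<omega>"
proof -
  interpret Q: prob_space Q by (rule prob_Q)
  let ?E = "\<lambda>n::nat. {x \<in> space M. real (Suc n) < f x}"
  have "(\<lambda>n. emeasure M (?E n)) \<longlonglongrightarrow> emeasure M (\<Inter>n. ?E n)"
  proof (rule Lim_emeasure_decseq)
    show "decseq ?E" by (auto simp: decseq_def)
    show "emeasure M (?E n) \<noteq> \<infinity>" for n using exceedance_finite[of "real (Suc n)"] by simp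
  qed auto
  moreover have "(\<Inter>n. ?E n) = {}"
  proof (intro equals0I)
    fix x assume x: "x \<in> (\<Inter>n. ?E n)"
    obtain n where "f x < real n" using reals_Archimedean2 by blast
    moreover have "real (Suc n) < f x" using x by blast
    ultimately show False by simp
  qed
  ultimately have "(\<lambda>n. emeasure M (?E n)) \<longlonglongrightarrow> ennreal 0" by simp
  then have "(\<lambda>n. measure M (?E n)) \<longlonglongrightarrow> 0" unfolding measure_def by (rule tendsto_enn2real) simp
  then have "(\<lambda>n. exp (- measure M (?E n))) \<longlonglongrightarrow> exp (- 0)" by (intro tendsto_intros)
  moreover have "exp (- measure M (?E n)) \<le> measure Q {\<omega> \<in> space Q. sup_finite \<omega>}" for n
  proof -
    have "exp (- measure M (?E n)) = measure Q {\<omega> \<in> space Q. \<forall>i\<in>J \<omega>. U i \<omega> \<notin> ?E n}"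
      using exceedance_finite[of "real (Suc n)"] by (intro void_prob[symmetric]) auto
    also have "\<dots> \<le> measure Q {\<omega> \<in> space Q. sup_finite \<omega>}"
      unfolding sup_finite_def
      by (intro Q.finite_measure_mono sup_finite_events[unfolded sup_finite_def]) blast
    finally show ?thesis .
  qed
  ultimately have "1 \<le> measure Q {\<omega> \<in> space Q. sup_finite \<omega>}"
    by (intro LIMSEQ_le_const2) auto
  then show ?thesis using Q.prob_Collect_eq_1[OF sup_finite_events] Q.prob_le_1
    by (meson antisym)
qed

end

text \<open>Below a negative level both sides are zero. Otherwise, almost surely, all suprema stay below their
  levels iff no point lies in the union of the level sets.\<close>

lemma fdd_eq_sup_integral:
  fixes X :: "'i \<Rightarrow> 'v \<Rightarrow> real" and f :: "'i \<Rightarrow> 'a \<Rightarrow> real"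
  assumes X: "process T P X" and X_nonneg: "\<And>t. t \<in> T \<Longrightarrow> AE \<omega> in P. 0 \<le> X t \<omega>"
    and f: "\<And>t. t \<in> T \<Longrightarrow> f t \<in> L_vee M" "\<And>t x. t \<in> T \<Longrightarrow> x \<in> space M \<Longrightarrow> 0 \<le> f t x"
    and D: "\<And>t. t \<in> T \<Longrightarrow> dense_levels (D t)"
    and cdf: "\<And>F a. finite F \<Longrightarrow> F \<subseteq> T \<Longrightarrow> (\<And>t. t \<in> F \<Longrightarrow> a t \<in> D t) \<Longrightarrow>
      measure P {\<omega> \<in> space P. \<forall>t\<in>F. X t \<omega> \<le> a t} = exp (- measure M (\<Union>t\<in>F. {x \<in> space M. a t < f t x}))"
  shows "fdd_eq T P X Q (\<lambda>t. sup_integral J U (f t))"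
proof -
  interpret Q: prob_space Q by (rule prob_Q)
  interpret P: prob_space P using X by (simp add: process_def)
  have Xm: "X t \<in> borel_measurable P" if "t \<in> T" for t using X that by (simp add: process_def)
  have Im: "sup_integral J U (f t) \<in> borel_measurable Q" if "t \<in> T" for t
    using f[OF that] by (rule sup_integral_measurable)
  have "distr P (PiM F (\<lambda>_. borel)) (\<lambda>\<omega>. \<lambda>t\<in>F. X t \<omega>)
    = distr Q (PiM F (\<lambda>_. borel)) (\<lambda>\<omega>. \<lambda>t\<in>F. sup_integral J U (f t) \<omega>)"
    if F: "finite F" "F \<subseteq> T" for F
  proof (rule PiM_borel_measure_eqI[OF F(1), of D])
    have mX: "(\<lambda>\<omega>. \<lambda>t\<in>F. X t \<omega>) \<in> measurable P (PiM F (\<lambda>_. borel))"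
      using F(2) Xm by (intro measurable_restrict) auto
    have mI: "(\<lambda>\<omega>. \<lambda>t\<in>F. sup_integral J U (f t) \<omega>) \<in> measurable Q (PiM F (\<lambda>_. borel))"
      using F(2) Im by (intro measurable_restrict) auto
    show "prob_space (distr P (PiM F (\<lambda>_. borel)) (\<lambda>\<omega>. \<lambda>t\<in>F. X t \<omega>))"
      by (rule P.prob_space_distr[OF mX])
    fix a assume a: "\<And>t. t \<in> F \<Longrightarrow> a t < 0 \<or> a t \<in> D t"
    let ?dP = "distr P (PiM F (\<lambda>_. borel)) (\<lambda>\<omega>. \<lambda>t\<in>F. X t \<omega>)"
    let ?dQ = "distr Q (PiM F (\<lambda>_. borel)) (\<lambda>\<omega>. \<lambda>t\<in>F. sup_integral J U (f t) \<omega>)"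
    let ?SP = "{\<omega> \<in> space P. \<forall>t\<in>F. X t \<omega> \<le> a t}"
    let ?SQ = "{\<omega> \<in> space Q. \<forall>t\<in>F. sup_integral J U (f t) \<omega> \<le> a t}"
    let ?B = "{x \<in> space (PiM F (\<lambda>_. borel)). \<forall>t\<in>F. x t \<le> a t}"
    have B: "?B \<in> sets (PiM F (\<lambda>_. borel))"
      using F(1) by (intro sets.sets_Collect_finite_All) measurable
    have "(\<lambda>\<omega>. \<lambda>t\<in>F. X t \<omega>) -` ?B \<inter> space P = ?SP"
      "(\<lambda>\<omega>. \<lambda>t\<in>F. sup_integral J U (f t) \<omega>) -` ?B \<inter> space Q
        = ?SQ"
      by (auto simp: space_PiM)
    then have e: "emeasure ?dP ?B
          = P.prob ?SP"
      "emeasure ?dQ ?B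
          = Q.prob ?SQ"
      using B mX mI by (auto simp: emeasure_distr P.emeasure_eq_measure Q.emeasure_eq_measure)
    have evI: "?SQ \<in> sets Q"
      using F Im by (intro sets.sets_Collect_finite_All) (auto intro!: borel_measurable_le)
    have fin: "AE \<omega> in Q. \<forall>t\<in>F. sup_finite (f t) \<omega>"
      using F AE_sup_finite[OF f] by (intro AE_finite_allI) auto
    have "P.prob ?SP
      = Q.prob ?SQ"
    proof (cases "\<exists>t\<in>F. a t < 0")
      case True
      then obtain t where t: "t \<in> F" "a t < 0" by auto
      have tT: "t \<in> T" using t F by auto
      have "P.prob ?SP = P.prob {}"
      proof (rule P.finite_measure_eq_AE)
        show "AE \<omega> in P. (\<omega> \<in> ?SP) = (\<omega> \<in> {})"
          using X_nonneg[OF tT] by eventually_elim (use t in force)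
        show "?SP \<in> sets P"
          using F Xm by (intro sets.sets_Collect_finite_All) (auto intro!: borel_measurable_le)
      qed simp
      moreover have "Q.prob ?SQ = Q.prob {}"
      proof (rule Q.finite_measure_eq_AE[OF _ evI])
        show "AE \<omega> in Q. (\<omega> \<in> ?SQ) = (\<omega> \<in> {})"
          using fin AE_space
        proof eventually_elim
          case (elim \<omega>)
          then have "\<not> sup_integral J U (f t) \<omega> \<le> a t"
            using sup_integral_le_iff[OF f[OF tT], of \<omega> "a t"] t by auto
          then show ?case using t by auto
        qed
      qed simp
      ultimately show ?thesis by simp
    next
      case False
      then have aD: "a t \<in> D t" "0 < a t" if "t \<in> F" for t
        using a[OF that] that D F(2) by (auto simp: dense_levels_def)
      let ?E = "\<lambda>t. {x \<in> space M. a t < f t x}"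
      have E: "?E t \<in> sets M" "emeasure M (?E t) < \<infinity>" if "t \<in> F" for t
        using f[of t] that F(2) aD exceedance_sets[of "f t"] exceedance_finite[of "f t"] by auto
      have U: "(\<Union>t\<in>F. ?E t) \<in> sets M" using E F by auto
      have "emeasure M (\<Union>t\<in>F. ?E t) \<le> (\<Sum>t\<in>F. emeasure M (?E t))"
        using E F by (intro emeasure_subadditive_finite) auto
      also have "\<dots> < \<infinity>" using E F by (simp add: less_top)
      finally have "Q.prob {\<omega> \<in> space Q. \<forall>i\<in>J \<omega>. U i \<omega> \<notin> (\<Union>t\<in>F. ?E t)} = exp (- measure M (\<Union>t\<in>F. ?E t))"
        by (rule void_prob[OF U])
      also have "Q.prob {\<omega> \<in> space Q. \<forall>i\<in>J \<omega>. U i \<omega> \<notin> (\<Union>t\<in>F. ?E t)}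
        = Q.prob ?SQ"
      proof (rule Q.finite_measure_eq_AE[OF _ void_events[OF U] evI])
        show "AE \<omega> in Q. (\<omega> \<in> {\<omega> \<in> space Q. \<forall>i\<in>J \<omega>. U i \<omega> \<notin> (\<Union>t\<in>F. ?E t)})
          = (\<omega> \<in> ?SQ)"
          using fin AE_space
        proof eventually_elim
          case (elim \<omega>)
          then have "sup_integral J U (f t) \<omega> \<le> a t \<longleftrightarrow> (\<forall>i\<in>J \<omega>. U i \<omega> \<notin> ?E t)" if "t \<in> F" for t
            using sup_integral_le_iff[OF f, of t \<omega> "a t"] aD[OF that] that F(2) by auto
          then show ?case using elim by blast
        qed
      qed
      finally show ?thesis using cdf[OF F] aD by simp
    qed
    then show "emeasure ?dP ?B
      = emeasure ?dQ ?B"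
      unfolding e by simp
  qed (use D F in auto)
  then show ?thesis
    using X Im Q.prob_space_axioms by (auto simp: fdd_eq_def process_def)
qed

end

section \<open>Minimal spectral representations\<close>

theorem theorem2p8:
  fixes T :: "'i set" and P :: "'w measure" and X :: "'i \<Rightarrow> 'w \<Rightarrow> real"
  assumes "process T P X"
    and "max_infinitely_divisible T P X"
    and "\<And>t. t \<in> T \<Longrightarrow> essinf P (X t) = 0"
    and "condition_S T P X"
  shows "\<exists>(\<mu> :: real measure) (f :: 'i \<Rightarrow> real \<Rightarrow> real).
           sets \<mu> = sets (restrict_space borel {0..1}) \<and>
           sigma_finite_measure \<mu> \<and>
           minimal_spectral_representation T P X \<mu> f"
proof -
  interpret P: prob_space P using assms(1) by (simp add: process_def)
  have X: "X t \<in> borel_measurable P" if "t \<in> T" for t using assms(1) that by (simp add: process_def)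
  have pos: "0 < P.prob {\<omega> \<in> space P. X t \<omega> \<le> q}" if "t \<in> T" "0 < q" for t q
    using P.essinf_zero_prob_pos[OF X assms(3)] that by blast
  obtain T0 s where T0: "T0 \<subseteq> T" "countable T0"
    and s: "\<And>t. t \<in> T \<Longrightarrow> range (s t) \<subseteq> T0" "\<And>t. t \<in> T \<Longrightarrow> converges_in_probability P (\<lambda>n. X (s t n)) (X t)"
  proof -
    obtain T0 where T0: "T0 \<subseteq> T" "countable T0"
      and ex: "\<forall>t\<in>T. \<exists>s. range s \<subseteq> T0 \<and> converges_in_probability P (\<lambda>n. X (s n)) (X t)"
      using assms(4) unfolding condition_S_def by blast
    from bchoice[OF ex] obtain s where "\<forall>t\<in>T. range (s t) \<subseteq> T0 \<and> converges_in_probability P (\<lambda>n. X (s t n)) (X t)"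
      by blast
    with T0 show thesis by (intro that[of T0 s]) auto
  qed
  \<comment> \<open>The positive continuity points of the distribution of \<open>X t\<close>.\<close>
  define D where "D t = {a. 0 < a \<and> P.prob {\<omega> \<in> space P. X t \<omega> = a} = 0}" for t
  have "\<forall>t\<in>T. \<exists>L. countable L \<and> dense_levels L \<and> L \<subseteq> D t"
  proof
    fix t assume t: "t \<in> T"
    obtain L where L: "countable L" "dense_levels L" "L \<inter> {a. P.prob {\<omega> \<in> space P. X t \<omega> = a} \<noteq> 0} = {}"
      using exists_dense_levels_avoiding[OF countable_atoms[OF P.prob_space_axioms X[OF t]]] by blast
    then have "L \<subseteq> D t" by (auto simp: D_def dense_levels_def)
    with L show "\<exists>L. countable L \<and> dense_levels L \<and> L \<subseteq> D t" by blast
  qed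
  from bchoice[OF this] obtain L where "\<forall>t\<in>T. countable (L t) \<and> dense_levels (L t) \<and> L t \<subseteq> D t" ..
  then have L: "\<And>t. t \<in> T \<Longrightarrow> countable (L t)"
    "\<And>t. t \<in> T \<Longrightarrow> dense_levels (L t)" "\<And>t. t \<in> T \<Longrightarrow> L t \<subseteq> D t" by simp_all
  have Lpos: "L t \<subseteq> {0<..}" if "t \<in> T" for t using L(2)[OF that] by (simp add: dense_levels_def)

  \<comment> \<open>The recorded comparisons \<open>X s > q\<close>, numbered by \<open>to_nat_on\<close>.
    For an unused number \<open>i\<close>, in particular if \<open>T\<close> is empty, \<open>k i\<close> is empty.\<close>
  define pairs where "pairs = Sigma T0 L"
  have pairs: "countable pairs"
    unfolding pairs_def using T0 L by (intro countable_SIGMA) auto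
  have pairs_pos: "pairs \<subseteq> T \<times> {0<..}"
    unfolding pairs_def using T0 Lpos by blast
  define k where "k i = {z \<in> pairs. to_nat_on pairs z = i}" for i
  have k_pair: "k (to_nat_on pairs z) = {z}" if "z \<in> pairs" for z
    using that inj_on_to_nat_on[OF pairs] by (auto simp: k_def inj_on_def)
  have k_cases: "k i = {} \<or> (\<exists>z\<in>pairs. k i = {z})" for i
    using k_pair by (cases "k i = {}") (auto simp: k_def)
  have k_fin: "finite (k i)" for i using k_cases[of i] by auto
  have k_T: "z \<in> T \<times> {0<..}" if "z \<in> k i" for i z using that pairs_pos by (auto simp: k_def)

  define p where "p Z = P.prob {\<omega> \<in> space P. \<forall>z\<in>(\<Union>i\<in>Z. k i). X (fst z) \<omega> \<le> snd z}" for Z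
  have p_pos: "0 < p Z" if "finite Z" for Z
    unfolding p_def using that k_fin k_T
    by (intro max_infinitely_divisible_prob_pos[OF assms(1,2) pos]) auto
  have "\<forall>n. \<exists>Q :: (nat \<Rightarrow> 'i \<Rightarrow> real) measure. \<exists>Y. max_root T P X (Suc n) Q Y"
    using max_infinitely_divisible_root[OF assms(2)] by auto
  from choice[OF this] obtain Q :: "nat \<Rightarrow> (nat \<Rightarrow> 'i \<Rightarrow> real) measure"
    where "\<forall>n. \<exists>Y. max_root T P X (Suc n) (Q n) Y" ..
  from choice[OF this] obtain Y where Y: "\<forall>n. max_root T P X (Suc n) (Q n) (Y n)" ..
  then have Y_process: "process T (Q n) (Y n)"
    and Y_root: "finite Z \<Longrightarrow> fst ` Z \<subseteq> T \<Longrightarrow>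
      measure (Q n) {\<omega> \<in> space (Q n). \<forall>z\<in>Z. Y n (fst z) \<omega> \<le> snd z} ^ Suc n
      = P.prob {\<omega> \<in> space P. \<forall>z\<in>Z. X (fst z) \<omega> \<le> snd z}" for n Z
    by (simp_all only: max_root_def) 
  \<comment> \<open>The exceedance pattern of the \<open>(n + 1)\<close>-st root.\<close>
  define h where "h n \<omega> i \<longleftrightarrow> (\<exists>z\<in>k i. snd z < Y n (fst z) \<omega>)" for n \<omega> i
  define R where "R n = distr (Q n) bool_seq (h n)" for n
  have h: "h n \<in> measurable (Q n) bool_seq" for n
  proof (rule measurable_bool_seqI)
    fix i
    show "{\<omega> \<in> space (Q n). h n \<omega> i} \<in> sets (Q n)"
      unfolding h_def using k_fin Y_process[of n] k_T
      by (intro sets.sets_Collect_finite_Ex) (fastforce simp: process_def intro!: borel_measurable_less)+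
  qed
  interpret max_roots R p
  proof (rule max_roots.intro)
    show "prob_space (R n)" for n
      unfolding R_def using Y_process[of n] h by (intro prob_space.prob_space_distr) (auto simp: process_def)
    show "sets (R n) = sets bool_seq" for n by (simp add: R_def)
    show "0 < p Z" if "finite Z" for Z by (rule p_pos[OF that])
    fix n Z assume Z: "finite (Z :: nat set)"
    have "measure (R n) {x. \<forall>i\<in>Z. \<not> x i} = measure (Q n) (h n -` {x. \<forall>i\<in>Z. \<not> x i} \<inter> space (Q n))"
      unfolding R_def using pattern_in_sets[of "{}" Z] Z by (intro measure_distr h) (simp add: countable_finite)
    also have "h n -` {x. \<forall>i\<in>Z. \<not> x i} \<inter> space (Q n)
      = {\<omega> \<in> space (Q n). \<forall>z\<in>(\<Union>i\<in>Z. k i). Y n (fst z) \<omega> \<le> snd z}"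
      by (auto simp: h_def not_less)
    finally show "measure (R n) {x. \<forall>i\<in>Z. \<not> x i} ^ Suc n = p Z"
      unfolding p_def using Z k_fin k_T by (subst Y_root[symmetric]) fastforce+
  qed
  obtain \<mu> A where \<mu>: "sets \<mu> = sets (restrict_space borel {0..1::real})" and A: "\<And>i. A i \<in> sets \<mu>"
    and hit: "\<And>Z. finite Z \<Longrightarrow> emeasure \<mu> (\<Union>i\<in>Z. A i) = ennreal (- ln (p Z))"
    and rest: "emeasure \<mu> (space \<mu> - (\<Union>i. A i)) = 0"
    and gen: "\<And>B. B \<in> sets \<mu> \<Longrightarrow> \<exists>B'\<in>sigma_sets (space \<mu>) (range A). emeasure \<mu> (sym_diff B' B) = 0"
    by (rule exponent_measure_unit_interval) blast
  have sp: "space \<mu> = {0..1}" using sets_eq_imp_space_eq[OF \<mu>] by (simp add: space_restrict_space)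
  have fA: "A i \<in> fmeasurable \<mu>" for i using hit[of "{i}"] A by (intro fmeasurableI) auto
  have sf: "sigma_finite_measure \<mu>"
  proof
    show "\<exists>S. countable S \<and> S \<subseteq> sets \<mu> \<and> \<Union> S = space \<mu> \<and> (\<forall>a\<in>S. emeasure \<mu> a \<noteq> \<infinity>)"
      using A sets.sets_into_space[OF A] rest fmeasurableD2[OF fA]
      by (intro exI[of _ "insert (space \<mu> - (\<Union>i. A i)) (range A)"]) auto
  qed
  define C where "C i = {\<omega> \<in> space P. \<exists>z\<in>k i. snd z < X (fst z) \<omega>}" for i
  interpret E: exponent_model P \<mu> C A
  proof
    show "C i \<in> P.events" for i
      unfolding C_def using k_fin k_T X
      by (intro sets.sets_Collect_finite_Ex) (fastforce intro!: borel_measurable_less)+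
    show "A i \<in> fmeasurable \<mu>" for i by (rule fA)
    fix Z assume Z: "finite (Z :: nat set)"
    have "space P - (\<Union>i\<in>Z. C i) = {\<omega> \<in> space P. \<forall>z\<in>(\<Union>i\<in>Z. k i). X (fst z) \<omega> \<le> snd z}"
      unfolding C_def not_less[symmetric] by blast
    then have "P.prob (space P - (\<Union>i\<in>Z. C i)) = p Z" by (simp add: p_def)
    moreover have "measure \<mu> (\<Union>i\<in>Z. A i) = - ln (p Z)"
    proof -
      have "p Z \<le> 1" by (simp add: p_def)
      then have "0 \<le> - ln (p Z)" using p_pos[OF Z] by simp
      then show ?thesis unfolding measure_def hit[OF Z] by simp
    qed
    ultimately show "P.prob (space P - (\<Union>i\<in>Z. C i)) = exp (- measure \<mu> (\<Union>i\<in>Z. A i))"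
      using p_pos[OF Z] by simp
  qed
  have C_pair: "C (to_nat_on pairs z) = {\<omega> \<in> space P. snd z < X (fst z) \<omega>}" if "z \<in> pairs" for z
    unfolding C_def k_pair[OF that] by simp

  let ?E = "\<lambda>t a. {\<omega> \<in> space P. a < X t \<omega>}"
  have ev: "(?E t a) \<in> P.events" if "t \<in> T" for t a
    using X[OF that] by measurable
  have match_ex: "\<exists>B. E.matches (?E t a) B" if t: "t \<in> T" and a: "a \<in> D t" for t a
  proof -
    have "\<exists>i. P.prob (sym_diff (C i) (?E t a)) < \<delta>" if "0 < \<delta>" for \<delta>
    proof -
      have "\<exists>n. \<exists>q\<in>L (s t n). P.prob (sym_diff {\<omega> \<in> space P. q < X (s t n) \<omega>} (?E t a)) < \<delta>"
        using a s[OF t] T0(1) L(2) \<open>0 < \<delta>\<close>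
        by (intro P.exceedance_approximable[where T = T]) (auto simp: D_def intro: X t)
      then obtain n q where q: "q \<in> L (s t n)" "P.prob (sym_diff {\<omega> \<in> space P. q < X (s t n) \<omega>} (?E t a)) < \<delta>"
        by blast
      have "(s t n, q) \<in> pairs" using q s[OF t] by (auto simp: pairs_def)
      then show ?thesis using q(2) C_pair[of "(s t n, q)"] by (intro exI[of _ "to_nat_on pairs (s t n, q)"]) simp
    qed
    then have "\<forall>n. \<exists>i. P.prob (sym_diff (C i) (?E t a)) < inverse (real (Suc n))" by simp
    then obtain i where i: "\<And>n. P.prob (sym_diff (C (i n)) (?E t a)) < inverse (real (Suc n))" by metis
    have "(\<lambda>n. P.prob (sym_diff (C (i n)) (?E t a))) \<longlonglongrightarrow> 0"
      by (rule Lim_null_comparison[OF _ LIMSEQ_inverse_real_of_nat])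
         (use i in \<open>auto intro!: always_eventually less_imp_le simp del: of_nat_Suc\<close>)
    moreover have "P.prob (?E t a) < 1"
    proof -
      have "{\<omega> \<in> space P. X t \<omega> \<le> a} = space P - (?E t a)" by auto
      then show ?thesis using pos[OF t, of a] a ev[OF t, of a] by (simp add: P.prob_compl D_def)
    qed
    ultimately show ?thesis using ev[OF t] by (intro E.matches_exists)
  qed
  have "\<forall>t\<in>T. \<exists>f. f \<in> L_vee \<mu> \<and> (\<forall>x. 0 \<le> f x) \<and>
    (\<forall>a\<in>D t. E.matches (?E t a) {x \<in> space \<mu>. a < f x})"
    using E.layer_cake[OF X _ L(3,1,2) match_ex] by (auto simp: D_def Bex_def)
  from bchoice[OF this] obtain f where "\<forall>t\<in>T. f t \<in> L_vee \<mu> \<and> (\<forall>x. 0 \<le> f t x) \<and>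
    (\<forall>a\<in>D t. E.matches (?E t a) {x \<in> space \<mu>. a < f t x})" ..
  then have f: "\<And>t. t \<in> T \<Longrightarrow> f t \<in> L_vee \<mu>" "\<And>t x. t \<in> T \<Longrightarrow> 0 \<le> f t x"
    and match: "\<And>t a. t \<in> T \<Longrightarrow> a \<in> D t \<Longrightarrow> E.matches (?E t a) {x \<in> space \<mu>. a < f t x}"
    by simp_all

  have "spectral_representation T P X \<mu> f"
  proof -
    obtain Q :: "(nat \<Rightarrow> real option) measure" and J U where ppp: "poisson_point_process \<mu> Q J U"
      using exists_poisson_point_process[OF sf, of 0] sp by auto
    have "fdd_eq T P X Q (\<lambda>t. sup_integral J U (f t))"
    proof (rule fdd_eq_sup_integral[OF ppp assms(1) _ f(1) _ L(2)])
      show "AE \<omega> in P. 0 \<le> X t \<omega>" if "t \<in> T" for t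
        using essinf_zero_AE_nonneg[OF assms(3)[OF that]] .
      fix F a assume F: "finite F" "F \<subseteq> T" "\<And>t. t \<in> F \<Longrightarrow> a t \<in> L t"
      have m: "E.matches (?E t (a t)) {x \<in> space \<mu>. a t < f t x}" if "t \<in> F" for t
        using F that L(3)[of t] by (intro match) auto
      have "{\<omega> \<in> space P. \<forall>t\<in>F. X t \<omega> \<le> a t} = space P - (\<Union>t\<in>F. {\<omega> \<in> space P. a t < X t \<omega>})"
        by (auto simp: not_less)
      then show "P.prob {\<omega> \<in> space P. \<forall>t\<in>F. X t \<omega> \<le> a t}
          = exp (- measure \<mu> (\<Union>t\<in>F. {x \<in> space \<mu>. a t < f t x}))"
        using E.matches_hit[OF F(1) m] by simp
    qed (use f in auto)
    then show ?thesis unfolding spectral_representation_def using sf f ppp by blast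
  qed
  moreover have A_level: "emeasure \<mu> (sym_diff {x \<in> space \<mu>. q < f t x} (A i)) = 0"
    "t \<in> T" "0 < q" if "k i = {(t, q)}" for i t q
  proof -
    have z: "(t, q) \<in> pairs" "i = to_nat_on pairs (t, q)" using that by (auto simp: k_def)
    then show t: "t \<in> T" "0 < q" using pairs_pos by auto
    have "E.matches (?E t q) (A i)"
      using E.matches_self[of i] C_pair[OF z(1)] z(2) by simp
    moreover have "q \<in> D t" using z(1) L(3) t T0 by (auto simp: pairs_def)
    ultimately show "emeasure \<mu> (sym_diff {x \<in> space \<mu>. q < f t x} (A i)) = 0"
      using match[OF t(1)] E.matches_unique by blast
  qed
  moreover have A_empty: "emeasure \<mu> (A i) = 0" if "k i = {}" for i
    using hit[of "{i}"] that by (simp add: p_def P.prob_space)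
  moreover have "\<exists>G\<in>generated_sets T \<mu> f. emeasure \<mu> (sym_diff G B) = 0" if B: "B \<in> sets \<mu>" for B
  proof -
    let ?G = "generated_sets T \<mu> f"
    have Gs: "?G \<subseteq> sets \<mu>"
      unfolding generated_sets_def
      by (rule sets.sigma_sets_subset) (use f in \<open>auto simp: L_vee_def intro: measurable_sets\<close>)
    interpret G: sigma_algebra "space \<mu>" ?G
      unfolding generated_sets_def by (rule sigma_algebra_sigma_sets) auto
    have basic: "\<exists>G\<in>?G. sym_diff G (A i) \<in> null_sets \<mu>" for i
    proof -
      consider "k i = {}" | t q where "k i = {(t, q)}" using k_cases[of i] by force
      then show ?thesis
      proof cases
        case 1
        then show ?thesis using A_empty[OF 1] A by (intro bexI[of _ "{}"]) (auto simp: null_sets_def)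
      next
        case (2 t q)
        have "{x \<in> space \<mu>. q < f t x} = f t -` {q<..} \<inter> space \<mu>" by auto
        then have "{x \<in> space \<mu>. q < f t x} \<in> ?G"
          unfolding generated_sets_def using A_level(2)[OF 2]
          by (intro sigma_sets.Basic CollectI exI[of _ t] exI[of _ "{q<..}"]) simp
        then show ?thesis using A_level(1)[OF 2] A Gs
          by (intro bexI[of _ "{x \<in> space \<mu>. q < f t x}"]) (auto simp: null_sets_def)
      qed
    qed
    obtain B' where B': "B' \<in> sigma_sets (space \<mu>) (range A)" "emeasure \<mu> (sym_diff B' B) = 0"
      using gen[OF B] by blast
    obtain G where G: "G \<in> ?G" "sym_diff G B' \<in> null_sets \<mu>"
      using sigma_sets_almost_in_subalgebra[OF G.sigma_algebra_axioms Gs _ _ B'(1)] basic A by blast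
    have B's: "B' \<in> sets \<mu>" using B'(1) sets.sigma_sets_subset[of "range A" \<mu>] A by blast
    have "sym_diff G B \<in> null_sets \<mu>"
    proof (rule null_sets_subset)
      show "sym_diff G B' \<union> sym_diff B' B \<in> null_sets \<mu>"
      proof (rule null_sets.Un[OF G(2)])
        show "sym_diff B' B \<in> null_sets \<mu>" using B'(2) B's B by (simp add: null_sets_def)
      qed
      show "sym_diff G B \<in> sets \<mu>" using G(1) Gs B by auto
    qed blast
    then show ?thesis using G(1) by (intro bexI[of _ G]) auto
  qed
  moreover have "\<not> (\<exists>B\<in>sets \<mu>. emeasure \<mu> B > 0 \<and> (\<forall>t\<in>T. AE x in \<mu>. x \<in> B \<longrightarrow> f t x = 0))"
  proof
    assume "\<exists>B\<in>sets \<mu>. emeasure \<mu> B > 0 \<and> (\<forall>t\<in>T. AE x in \<mu>. x \<in> B \<longrightarrow> f t x = 0)"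
    then obtain B where B: "B \<in> sets \<mu>" "emeasure \<mu> B > 0" "\<And>t. t \<in> T \<Longrightarrow> AE x in \<mu>. x \<in> B \<longrightarrow> f t x = 0" by blast
    \<comment> \<open>On \<open>A i\<close> some \<open>f t\<close> exceeds a positive level almost everywhere.\<close>
    have "AE x in \<mu>. x \<in> B \<longrightarrow> x \<notin> A i" for i
    proof -
      consider "k i = {}" | t q where "k i = {(t, q)}" using k_cases[of i] by force
      then show ?thesis
      proof cases
        case 1
        then have "A i \<in> null_sets \<mu>" using A_empty[OF 1] A by auto
        from AE_not_in[OF this] show ?thesis by eventually_elim simp
      next
        case (2 t q)
        have fm: "f t \<in> borel_measurable \<mu>" using f(1) A_level(2)[OF 2] by (simp add: L_vee_def)
        then have "{x \<in> space \<mu>. q < f t x} \<in> sets \<mu>" by measurable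
        then have "sym_diff {x \<in> space \<mu>. q < f t x} (A i) \<in> null_sets \<mu>"
          using A_level(1)[OF 2] A by (auto simp: null_sets_def)
        from AE_not_in[OF this] B(3)[OF A_level(2)[OF 2]] show ?thesis
          by eventually_elim (use A_level(3)[OF 2] in auto)
      qed
    qed
    then have "AE x in \<mu>. \<forall>i. x \<in> B \<longrightarrow> x \<notin> A i" unfolding AE_all_countable by blast
    moreover have "space \<mu> - (\<Union>i. A i) \<in> null_sets \<mu>" using rest A by auto
    then have "AE x in \<mu>. x \<notin> space \<mu> - (\<Union>i. A i)" by (rule AE_not_in)
    ultimately have "AE x in \<mu>. x \<notin> B" using AE_space by eventually_elim blast
    then have "emeasure \<mu> B = 0" using B(1) by (simp add: AE_iff_null_sets[symmetric] flip: null_setsD1)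
    then show False using B(2) by simp
  qed
  ultimately have "minimal_spectral_representation T P X \<mu> f"
    unfolding minimal_spectral_representation_def by blast
  then show ?thesis using \<mu> sf by blast
qed

end
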